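(* Each object $M_\lambda$ ($\lambda\in\Lambda$) of $\mathcal A$ is indecomposable, and every indecomposable object of $\mathcal A$ is isomorphic to $M_\lambda$ for some weight $\lambda$. For every weight $\lambda$ there are non-zero maps $$\mathrm{id}\colon M_\lambda\to M_\lambda,\qquad d_\lambda\colon M_{\lambda\circ}\to M_\lambda,\qquad u_\lambda\colon M_\lambda\to M_{\lambda\bullet},\qquad u_\lambda\circ d_\lambda\colon M_{\lambda\circ}\to M_{\lambda\bullet},$$ and these are the only non-zero maps, up to scalar multiples, between the objects $M_\alpha$: each of the spaces $\mathrm{Hom}(M_\lambda,M_\lambda)$, $\mathrm{Hom}(M_{\lambda\circ},M_\lambda)$, $\mathrm{Hom}(M_\lambda,M_{\lambda\bullet})$, $\mathrm{Hom}(M_{\lambda\circ},M_{\lambda\bullet})$ is one-dimensional, spanned by the indicated map, and $\mathrm{Hom}_{\mathcal A}(M_\alpha,M_\beta)=0$ for every pair $(\alpha,\beta)$ not of one of these four forms.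
   Context: Fix a field $k$. A weight is a finite (possibly empty) word in the two letters $\bullet,\circ$; $\Lambda$ is the set of weights, $\ell(\lambda)$ the length of $\lambda$. The second Delannoy category $\mathcal A$. Let $\mathbb G=\mathrm{Aut}(\mathbf R,<)$ be the group of order-preserving bijections of $\mathbf R$, and for a totally ordered set $I$ let $I^{(n)}$ be the set of tuples $x_1<\cdots<x_n$ in $I$ ($I^{(0)}$ is a point). For finite $S\subset\mathbf R$ let $\mathbb G(S)$ be its pointwise stabilizer. A $\mathbb G$-set means a set with a $\mathbb G$-action having finitely many orbits and such that every point stabilizer contains some $\mathbb G(S)$; the transitive ones are, up to isomorphism, the $\mathbf R^{(n)}$. If $S=\{a_1<\dots<a_r\}$ and $I_0=(-\infty,a_1),I_1=(a_1,a_2),\dots,I_r=(a_r,\infty)$ (with $I_0=\mathbf R$ if $r=0$), every $\mathbb G(S)$-orbit $O$ on a $\mathbb G$-set is isomorphic, as a $\mathbb G(S)$-set, to $\prod_{j=0}^r I_j^{(n_j)}$ for some $n_j\ge 0$; put $\mu_2(O)=(-1)^{n_0+\cdots+n_r}$ if $n_r=0$ and $\mu_2(O)=0$ if $n_r>0$. If $\varphi\colon X\to k$ is invariant under some $\mathbb G(S)$, put $\int_X\varphi=\sum_O\varphi(O)\mu_2(O)$, the sum over the finitely many $\mathbb G(S)$-orbits $O$ on $X$; this is independent of $S$. Consider the category with objects $\mathscr A(X)$ for $\mathbb G$-sets $X$, morphisms $\mathscr A(X)\to\mathscr A(Y)$ being the $\mathbb G$-invariant functions $A\colon Y\times X\to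 k$ ("$Y\times X$ matrices"), and composition $(BA)(z,x)=\int_Y B(z,y)A(y,x)\,dy$. It is $k$-linear additive with $\mathscr A(X)\oplus\mathscr A(Y)=\mathscr A(X\amalg Y)$, and symmetric monoidal with $\mathscr A(X)\otimes\mathscr A(Y)=\mathscr A(X\times Y)$ (Kronecker product on morphisms). $\mathcal A$ is its Karoubi (idempotent) completion. The objects $M_\lambda$. For a weight $\lambda=\lambda_1\cdots\lambda_n$ let $E_\lambda$ be the indicator function of the set of $(y,x)\in\mathbf R^{(n)}\times\mathbf R^{(n)}$ such that $y_i\le x_i$ whenever $\lambda_i=\bullet$; $x_i\le y_i$ whenever $\lambda_i=\circ$; and $y_i<x_{i+1}$, $x_i<y_{i+1}$ for $1\le i<n$. It is an idempotent endomorphism of $\mathscr A(\mathbf R^{(n)})$, and $M_\lambda=E_\lambda\mathscr A(\mathbf R^{(n)})$ is the corresponding direct summand. *)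

theory Defs
  imports Complex_Main "HOL-Algebra.Group_Action" "HOL-Library.Function_Algebras"
begin

section \<open>The group of order-preserving bijections of the line, and its sets\<close>

definition aut_R :: "(real \<Rightarrow> real) monoid" where
  "aut_R = \<lparr>carrier = {g. bij g \<and> strict_mono g}, mult = (\<circ>), one = id\<rparr>"

definition aut_R_fix :: "real set \<Rightarrow> (real \<Rightarrow> real) monoid" where
  "aut_R_fix S = aut_R\<lparr>carrier := {g \<in> carrier aut_R. \<forall>s\<in>S. g s = s}\<rparr>"

record 'x gset =
  pts :: "'x set"
  act :: "(real \<Rightarrow> real) \<Rightarrow> 'x \<Rightarrow> 'x"

definition gset :: "'x gset \<Rightarrow> bool" where
  "gset X \<longleftrightarrow>
     group_action aut_R (pts X) (act X) \<and>
     finite (orbits aut_R (pts X) (act X)) \<and>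
     (\<forall>x\<in>pts X. \<exists>S. finite S \<and> carrier (aut_R_fix S) \<subseteq> stabilizer aut_R (act X) x)"

text \<open>The tuples $x_1 < \dots < x_n$ in \<open>I\<close>, as lists.\<close>

definition incr :: "real set \<Rightarrow> nat \<Rightarrow> real list set" where
  "incr I n = {xs. length xs = n \<and> sorted_wrt (<) xs \<and> set xs \<subseteq> I}"

text \<open>The action is cut down with \<^const>\<open>restrict\<close> because \<^const>\<open>BijGroup\<close> consists of
  extensional functions.\<close>

definition RR :: "nat \<Rightarrow> real list gset" where
  "RR n = \<lparr>pts = incr UNIV n, act = (\<lambda>g. restrict (map g) (incr UNIV n))\<rparr>"


section \<open>The measure and integration\<close>

text \<open>For $S = \{a_1 < \dots < a_r\}$ the open intervals $I_0, \dots, I_r$ cut out by \<open>S\<close>; note that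
  $a_j$ is the list entry with index $j - 1$.\<close>

definition gap :: "real set \<Rightarrow> nat \<Rightarrow> real set" where
  "gap S j = {t. (0 < j \<longrightarrow> sorted_list_of_set S ! (j - 1) < t) \<and>
                 (j < card S \<longrightarrow> t < sorted_list_of_set S ! j)}"

text \<open>The product of the $I_j^{(n_j)}$ for \<open>ns\<close> the list $n_0, \dots, n_r$; a point is the list of
  its \<open>r + 1\<close> components.\<close>

definition cell :: "real set \<Rightarrow> nat list \<Rightarrow> real list list set" where
  "cell S ns = {ps. length ps = length ns \<and> (\<forall>j<length ns. ps ! j \<in> incr (gap S j) (ns ! j))}"

definition iso_to_cell :: "'x gset \<Rightarrow> real set \<Rightarrow> 'x set \<Rightarrow> nat list \<Rightarrow> bool" where
  "iso_to_cell X S Orb ns \<longleftrightarrow>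
     (\<exists>f. bij_betw f Orb (cell S ns) \<and>
          (\<forall>g\<in>carrier (aut_R_fix S). \<forall>x\<in>Orb. f (act X g x) = map (map g) (f x)))"

text \<open>An orbit determines the exponents $n_0, \dots, n_r$ uniquely.\<close>

definition exponents :: "'x gset \<Rightarrow> real set \<Rightarrow> 'x set \<Rightarrow> nat list" where
  "exponents X S Orb = (THE ns. length ns = Suc (card S) \<and> iso_to_cell X S Orb ns)"

definition mu2 :: "'x gset \<Rightarrow> real set \<Rightarrow> 'x set \<Rightarrow> 'k::field" where
  "mu2 X S Orb = (let ns = exponents X S Orb in
     if last ns = 0 then (- 1) ^ sum_list ns else 0)"

definition invariant_fun :: "'x gset \<Rightarrow> real set \<Rightarrow> ('x \<Rightarrow> 'k) \<Rightarrow> bool" where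
  "invariant_fun X S \<phi> \<longleftrightarrow> (\<forall>g\<in>carrier (aut_R_fix S). \<forall>x\<in>pts X. \<phi> (act X g x) = \<phi> x)"

definition integral_over :: "'x gset \<Rightarrow> real set \<Rightarrow> ('x \<Rightarrow> 'k::field) \<Rightarrow> 'k" where
  "integral_over X S \<phi> =
     (\<Sum>Orb\<in>orbits (aut_R_fix S) (pts X) (act X). \<phi> (SOME x. x \<in> Orb) * mu2 X S Orb)"

text \<open>The value does not depend on the choice of the finite set \<open>S\<close>.\<close>

definition gset_integral :: "'x gset \<Rightarrow> ('x \<Rightarrow> 'k::field) \<Rightarrow> 'k" where
  "gset_integral X \<phi> = integral_over X (SOME S. finite S \<and> invariant_fun X S \<phi>) \<phi>"


section \<open>Matrices\<close>

text \<open>A $Y \times X$ matrix is a function \<open>A\<close> with entries \<open>A y x\<close>, extended by \<open>0\<close> outside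
  $Y \times X$ so that equality of matrices is equality of functions. Addition and \<open>0\<close> are
  pointwise.\<close>

definition matrices :: "'x gset \<Rightarrow> 'y gset \<Rightarrow> ('y \<Rightarrow> 'x \<Rightarrow> 'k::field) set" where
  "matrices X Y = {A.
     (\<forall>y x. A y x \<noteq> 0 \<longrightarrow> y \<in> pts Y \<and> x \<in> pts X) \<and>
     (\<forall>g\<in>carrier aut_R. \<forall>y\<in>pts Y. \<forall>x\<in>pts X. A (act Y g y) (act X g x) = A y x)}"

definition mcomp :: "'y gset \<Rightarrow> ('z \<Rightarrow> 'y \<Rightarrow> 'k) \<Rightarrow> ('y \<Rightarrow> 'x \<Rightarrow> 'k) \<Rightarrow> ('z \<Rightarrow> 'x \<Rightarrow> 'k::field)" where
  "mcomp Y B A = (\<lambda>z x. gset_integral Y (\<lambda>y. B z y * A y x))"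

definition mscale :: "'k \<Rightarrow> ('y \<Rightarrow> 'x \<Rightarrow> 'k) \<Rightarrow> ('y \<Rightarrow> 'x \<Rightarrow> 'k::field)" where
  "mscale c A = (\<lambda>y x. c * A y x)"

interpretation mat: vector_space "mscale :: 'k::field \<Rightarrow> ('y \<Rightarrow> 'x \<Rightarrow> 'k) \<Rightarrow> _"
  by unfold_locales (auto simp: mscale_def fun_eq_iff algebra_simps)

definition line_spanned_by :: "('y \<Rightarrow> 'x \<Rightarrow> 'k::field) set \<Rightarrow> ('y \<Rightarrow> 'x \<Rightarrow> 'k) \<Rightarrow> bool" where
  "line_spanned_by V A \<longleftrightarrow> A \<noteq> 0 \<and> mat.dim V = 1 \<and> V = mat.span {A}"


section \<open>The idempotent completion\<close>

text \<open>An object is a pair of a set with action and an idempotent matrix on it. The carriers of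
  different objects may have different types.\<close>

record ('x, 'k) obj =
  base :: "'x gset"
  idem :: "'x \<Rightarrow> 'x \<Rightarrow> 'k"

definition object :: "('x, 'k::field) obj \<Rightarrow> bool" where
  "object P \<longleftrightarrow> gset (base P) \<and> idem P \<in> matrices (base P) (base P) \<and>
     mcomp (base P) (idem P) (idem P) = idem P"

definition Hom :: "('x, 'k) obj \<Rightarrow> ('y, 'k) obj \<Rightarrow> ('y \<Rightarrow> 'x \<Rightarrow> 'k::field) set" where
  "Hom P Q = {A \<in> matrices (base P) (base Q).
     mcomp (base Q) (idem Q) A = A \<and> mcomp (base P) A (idem P) = A}"

text \<open>In the idempotent completion the identity of an object is its idempotent, and composition is
  that of matrices.\<close>

abbreviation ident :: "('x, 'k::field) obj \<Rightarrow> ('x \<Rightarrow> 'x \<Rightarrow> 'k)" where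
  "ident P \<equiv> idem P"

abbreviation cmp :: "('y, 'k) obj \<Rightarrow> ('z \<Rightarrow> 'y \<Rightarrow> 'k) \<Rightarrow> ('y \<Rightarrow> 'x \<Rightarrow> 'k) \<Rightarrow> ('z \<Rightarrow> 'x \<Rightarrow> 'k::field)" where
  "cmp Q B A \<equiv> mcomp (base Q) B A"

definition isomorphic :: "('x, 'k::field) obj \<Rightarrow> ('y, 'k) obj \<Rightarrow> bool" where
  "isomorphic P Q \<longleftrightarrow>
     (\<exists>A\<in>Hom P Q. \<exists>B\<in>Hom Q P. cmp Q B A = ident P \<and> cmp P A B = ident Q)"

definition zero_object :: "('x, 'k::field) obj \<Rightarrow> bool" where
  "zero_object P \<longleftrightarrow> ident P = 0"

text \<open>\<open>P\<close> is a direct sum (biproduct) of \<open>Q\<close> and \<open>R\<close>.\<close>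

definition is_direct_sum ::
  "('x, 'k::field) obj \<Rightarrow> ('y, 'k) obj \<Rightarrow> ('z, 'k) obj \<Rightarrow> bool" where
  "is_direct_sum P Q R \<longleftrightarrow>
     (\<exists>i1\<in>Hom Q P. \<exists>i2\<in>Hom R P. \<exists>p1\<in>Hom P Q. \<exists>p2\<in>Hom P R.
        cmp P p1 i1 = ident Q \<and> cmp P p2 i2 = ident R \<and>
        cmp P p1 i2 = 0 \<and> cmp P p2 i1 = 0 \<and>
        cmp Q i1 p1 + cmp R i2 p2 = ident P)"

text \<open>The first argument names the type carrying the summands \<open>Q\<close> and \<open>R\<close>, over which HOL cannot
  quantify. Every direct summand of \<open>P\<close> is isomorphic to one with the same underlying set as \<open>P\<close>
  (and another idempotent), so the choice \<open>TYPE('x)\<close> already tests all decompositions of \<open>P\<close>.\<close>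

definition indecomposable :: "'y itself \<Rightarrow> ('x, 'k::field) obj \<Rightarrow> bool" where
  "indecomposable ty P \<longleftrightarrow> object P \<and> \<not> zero_object P \<and>
     (\<forall>(Q :: ('y, 'k) obj) (R :: ('y, 'k) obj).
        object Q \<and> object R \<and> is_direct_sum P Q R \<longrightarrow> zero_object Q \<or> zero_object R)"


section \<open>Weights and the objects attached to them\<close>

datatype letter = Bullet | Circ

type_synonym weight = "letter list"

definition E_mat :: "weight \<Rightarrow> real list \<Rightarrow> real list \<Rightarrow> 'k::field" where
  "E_mat w y x =
     (if y \<in> pts (RR (length w)) \<and> x \<in> pts (RR (length w)) \<and>
         (\<forall>i<length w. (w ! i = Bullet \<longrightarrow> y ! i \<le> x ! i) \<and> (w ! i = Circ \<longrightarrow> x ! i \<le> y ! i)) \<and>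
         (\<forall>i. Suc i < length w \<longrightarrow> y ! i < x ! Suc i \<and> x ! i < y ! Suc i)
      then 1 else 0)"

definition M_obj :: "weight \<Rightarrow> (real list, 'k::field) obj" where
  "M_obj w = \<lparr>base = RR (length w), idem = E_mat w\<rparr>"

end

theory Submission
  imports Defs
begin

text \<open>On functions of one variable the integral is the sum of the jumps \<open>\<phi> a - \<phi> (a-)\<close> of a step function,
  and on \<open>RR n\<close> it is the iterated integral; transporting along charts of the orbits gives the
  integral on every set, its independence of \<open>S\<close>, and the interchange of two integrals, hence
  associativity of composition. A function is fixed by \<open>E_mat w\<close> iff it is fixed by an integral operator
  in each single variable. For a function of two tuples fixed on both sides, this means that it is
  unchanged when certain neighbouring coordinates pass each other and vanishes when certain coordinates
  are adjacent. Peeling off one coordinate of each tuple at a time, such a function is found to be a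
  multiple of one explicit kernel, and to vanish unless the weights are in one of the four positions.
  Finally the identity of \<open>RR n\<close> is modulo matrices that factor through \<open>RR (n - 1)\<close> the sum of the
  \<open>E_mat w\<close>, so that every identity is a sum of maps through objects \<open>M_obj w\<close>. As non-isomorphisms
  between these compose to zero along chains, an indecomposable object is one of them.\<close>

section \<open>Order automorphisms of the line\<close>

text \<open>In one variable the integral gives closed bounded intervals measure 1, half-open ones
  measure 0, closed rays to the right measure 1 and closed rays to the left measure 0. Everything
  rests on this. Conditions at two base points differ by an integral over a half-open interval, so
  two values agree or one vanishes. The asymmetry of the rays is the reason why an unmatched last
  letter in a pair of words must be \<open>Bullet\<close>, which is the source of the maps d and u.
  Peeling takes place on open half-lines, since the remaining coordinates lie to the right of those
  removed. The delicate point is a \<open>Circ\<close> at the front of the rest: its vanishing rule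
  is not inherited and is recovered by a detour through other positions, in
  \<open>bistepwise_peel\<close>. The decomposition of the identity comes from writing equality of
  two coordinates as a \<le> b plus b \<le> a minus the constant 1, where the constant factors
  through one coordinate fewer. That chains of non-isomorphisms die out is controlled by
  \<open>tail_rank\<close>, which strictly drops along each of them.\<close>

abbreviation finv :: "('a \<Rightarrow> 'b) \<Rightarrow> 'b \<Rightarrow> 'a" where "finv \<equiv> inv_into UNIV"

definition autf :: "real set \<Rightarrow> (real \<Rightarrow> real) set" where
  "autf S = {g. bij g \<and> strict_mono g \<and> (\<forall>s\<in>S. g s = s)}"

lemma carrier_aut_R: "carrier aut_R = autf {}"
  by (auto simp: aut_R_def autf_def)

lemma carrier_aut_R_fix: "carrier (aut_R_fix S) = autf S"
  by (auto simp: aut_R_fix_def aut_R_def autf_def)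

lemma autf_id [simp]: "id \<in> autf S" "(\<lambda>x. x) \<in> autf S"
  by (auto simp: autf_def strict_mono_def bij_id[unfolded id_def])

lemma autf_comp: "g \<in> autf S \<Longrightarrow> h \<in> autf S \<Longrightarrow> g \<circ> h \<in> autf S"
  by (auto simp: autf_def bij_comp strict_mono_def)

lemma autf_less: "g \<in> autf S \<Longrightarrow> g x < g y \<longleftrightarrow> x < y"
  by (auto simp: autf_def strict_mono_less)

lemma autf_le: "g \<in> autf S \<Longrightarrow> g x \<le> g y \<longleftrightarrow> x \<le> y"
  by (auto simp: autf_def strict_mono_less_eq)

lemma autf_eq: "g \<in> autf S \<Longrightarrow> g x = g y \<longleftrightarrow> x = y"
  by (auto simp: autf_def strict_mono_eq)

lemma autf_fix: "g \<in> autf S \<Longrightarrow> s \<in> S \<Longrightarrow> g s = s"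
  by (auto simp: autf_def)

lemma autf_antimono: "S \<subseteq> T \<Longrightarrow> autf T \<subseteq> autf S"
  by (auto simp: autf_def)

lemma autf_empty: "g \<in> autf S \<Longrightarrow> g \<in> autf {}"
  by (auto simp: autf_def)

lemma autf_bij: "g \<in> autf S \<Longrightarrow> bij g"
  by (auto simp: autf_def)

lemma autf_inv: assumes "g \<in> autf S" shows "finv g \<in> autf S"
proof -
  have b: "bij g" and f: "\<And>s. s \<in> S \<Longrightarrow> g s = s" using assms by (auto simp: autf_def)
  have "strict_mono (finv g)"
    by (rule strict_monoI) (metis b autf_less[OF assms] bij_inv_eq_iff)
  moreover have "\<And>s. s \<in> S \<Longrightarrow> finv g s = s"
    by (metis b f bij_inv_eq_iff)
  ultimately show ?thesis using b by (auto simp: autf_def bij_imp_bij_inv)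
qed

lemma autf_inv_simps: assumes "g \<in> autf S" shows "finv g (g x) = x" "g (finv g x) = x" "finv g \<circ> g = id" "g \<circ> finv g = id"
  using autf_bij[OF assms] by (auto simp: bij_is_inj bij_is_surj surj_f_inv_f fun_eq_iff)

lemma group_aut_R: "group aut_R"
proof (rule groupI)
  fix x y assume "x \<in> carrier aut_R" "y \<in> carrier aut_R"
  then show "x \<otimes>\<^bsub>aut_R\<^esub> y \<in> carrier aut_R"
    using autf_comp[of x "{}" y] by (simp add: carrier_aut_R) (simp add: aut_R_def)
next
  fix x assume "x \<in> carrier aut_R"
  then have "x \<in> autf {}" by (simp add: carrier_aut_R)
  then show "\<exists>y\<in>carrier aut_R. y \<otimes>\<^bsub>aut_R\<^esub> x = \<one>\<^bsub>aut_R\<^esub>"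
    using autf_inv[of x "{}"] autf_inv_simps(3)[of x "{}"]
    by (intro bexI[of _ "finv x"]) (simp_all add: carrier_aut_R, simp_all add: aut_R_def)
qed (auto simp: carrier_aut_R, auto simp: aut_R_def comp_assoc)

lemma mult_aut_R: "g \<otimes>\<^bsub>aut_R\<^esub> h = g \<circ> h"
  by (simp add: aut_R_def)

lemma one_aut_R: "\<one>\<^bsub>aut_R\<^esub> = id"
  by (simp add: aut_R_def)

section \<open>Moving points and tuples by automorphisms that fix a finite set\<close>

lemma piecewise_linear_autf:
  fixes c d p q :: real
  assumes "c < p" "p < d" "c < q" "q < d"
  shows "\<exists>g\<in>autf {}. g p = q \<and> (\<forall>t. t \<le> c \<or> d \<le> t \<longrightarrow> g t = t)"
proof -
  \<comment> \<open>\<open>k\<close> and \<open>m\<close> are the slopes of the two linear pieces,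
    from \<open>c\<close> to \<open>p\<close> and from \<open>p\<close> to \<open>d\<close>, that
    meet at height \<open>q\<close>.\<close>
  define k where "k = (q - c) / (p - c)"
  define m where "m = (d - q) / (d - p)"
  have k: "k > 0" "k * (p - c) = q - c" and m: "m > 0" "m * (d - p) = d - q"
    using assms by (auto simp: k_def m_def)
  define g where "g t = (if t \<le> c \<or> d \<le> t then t else if t \<le> p then c + k * (t - c) else d - m * (d - t))" for t
  have lo: "c < g t \<and> g t \<le> q" if "c < t" "t \<le> p" for t
    using that assms k mult_left_mono[of "t - c" "p - c" k] by (auto simp: g_def)
  have hi: "q < g t \<and> g t < d" if "p < t" "t < d" for t
    using that assms m mult_strict_left_mono[of "d - t" "d - p" m] by (auto simp: g_def)
  have "g s < g t" if "s < t" for s t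
  proof -
    consider "t \<le> c \<or> d \<le> s" | "s \<le> c" "d \<le> t" | "s \<le> c" "c < t" "t < d" | "c < s" "s < d" "d \<le> t"
      | "c < s" "t \<le> p" | "p < s" "t < d" | "c < s" "s \<le> p" "p < t" "t < d"
      by (meson not_le)
    then show ?thesis
    proof cases
      case 3
      have "g s = s" using 3 by (simp add: g_def)
      then show ?thesis using lo[of t] hi[of t] 3 assms by (cases "t \<le> p") auto
    next
      case 4
      have "g t = t" using 4 by (simp add: g_def)
      then show ?thesis using lo[of s] hi[of s] 4 assms by (cases "s \<le> p") auto
    next
      case 5
      then show ?thesis using that k assms by (simp add: g_def)
    next
      case 6
      then show ?thesis using that m assms by (simp add: g_def)
    next
      case 7
      then show ?thesis using lo[of s] hi[of t] by auto
    qed (use that assms in \<open>auto simp: g_def\<close>)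
  qed
  then have sm: "strict_mono g" by (simp add: strict_mono_def)
  have "\<exists>t. g t = y" for y
  proof -
    consider "y \<le> c \<or> d \<le> y" | "c < y" "y \<le> q" | "q < y" "y < d" by linarith
    then show ?thesis
    proof cases
      case 1 then show ?thesis by (intro exI[of _ y]) (simp add: g_def)
    next
      case 2
      have "(y - c) / k \<le> p - c" using 2 k by (simp add: pos_divide_le_eq mult.commute)
      moreover have "0 < (y - c) / k" using 2 k by simp
      ultimately show ?thesis using k assms
        by (intro exI[of _ "c + (y - c) / k"]) (auto simp: g_def)
    next
      case 3
      have "(d - y) / m < d - p" using 3 m by (simp add: pos_divide_less_eq mult.commute)
      moreover have "0 < (d - y) / m" using 3 m by simp
      ultimately show ?thesis using m assms
        by (intro exI[of _ "d - (d - y) / m"]) (auto simp: g_def)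
    qed
  qed
  then have "surj g" by (metis surjI surj_def)
  with sm have "g \<in> autf {}" by (auto simp: autf_def bij_def strict_mono_imp_inj_on)
  moreover have "g p = q" using assms k by (simp add: g_def)
  ultimately show ?thesis by (intro bexI[of _ g]) (auto simp: g_def)
qed

lemma finite_gap_below:
  fixes m :: real
  assumes "finite F" "m \<notin> F"
  shows "\<exists>c<m. F \<inter> {c<..m} = {}"
proof (cases "F \<inter> {..m} = {}")
  case True then show ?thesis by (intro exI[of _ "m - 1"]) auto
next
  case False
  define c where "c = Max (F \<inter> {..m})"
  have f: "finite (F \<inter> {..m})" using assms by auto
  have "c \<in> F \<inter> {..m}" unfolding c_def using f False by (rule Max_in)
  moreover have "\<And>s. s \<in> F \<inter> {..m} \<Longrightarrow> s \<le> c" unfolding c_def using f by (rule Max_ge)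
  ultimately show ?thesis using assms by (intro exI[of _ c]) (force simp: order_le_less)
qed

lemma finite_gap_above:
  fixes m :: real
  assumes "finite F" "m \<notin> F"
  shows "\<exists>d>m. F \<inter> {m..<d} = {}"
proof -
  obtain c where "c < - m" "uminus ` F \<inter> {c<..- m} = {}"
    using finite_gap_below[of "uminus ` F" "- m"] assms by (auto simp: image_iff)
  then show ?thesis by (intro exI[of _ "- c"]) force
qed

text \<open>A finite \<open>F\<close> leaves room on both sides of the interval from
  \<open>p\<close> to \<open>q\<close>, so a piecewise linear map supported in an open interval free
  of \<open>F\<close> makes the move.\<close>

lemma autf_move:
  assumes "finite F" "p \<le> q" "F \<inter> {p..q} = {}"
  shows "\<exists>g\<in>autf F. g p = q" "\<exists>g\<in>autf F. g q = p"
proof -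
  obtain c where c: "c < p" "F \<inter> {c<..p} = {}" using finite_gap_below[of F p] assms by fastforce
  obtain d where d: "q < d" "F \<inter> {q..<d} = {}" using finite_gap_above[of F q] assms by fastforce
  have out: "s \<le> c \<or> d \<le> s" if "s \<in> F" for s
  proof -
    have "s \<notin> {p..q}" "s \<notin> {c<..p}" "s \<notin> {q..<d}" using that assms(3) c(2) d(2) by blast+
    then show ?thesis using assms(2) by (simp add: not_le not_less) linarith
  qed
  obtain g where "g \<in> autf {}" "g p = q" "\<forall>t. t \<le> c \<or> d \<le> t \<longrightarrow> g t = t"
    using piecewise_linear_autf[of c p d q] assms(2) c d by auto
  with out have "g \<in> autf F" by (auto simp: autf_def)
  with \<open>g p = q\<close> show 1: "\<exists>g\<in>autf F. g p = q" by blast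
  then show "\<exists>g\<in>autf F. g q = p" by (metis autf_inv autf_inv_simps(1))
qed

text \<open>For finite \<open>S\<close> this is the relation of lying in the same orbit of the
  stabilizer of \<open>S\<close> on the line: a class is a point of \<open>S\<close> or one of the
  open gaps.\<close>

definition sametype :: "real set \<Rightarrow> real \<Rightarrow> real \<Rightarrow> bool" where
  "sametype S u v \<longleftrightarrow> (\<forall>s\<in>S. (s < u \<longleftrightarrow> s < v) \<and> (s = u \<longleftrightarrow> s = v))"

lemma sametype_refl [simp]: "sametype S u u"
  by (simp add: sametype_def)

lemma sametype_sym: "sametype S u v \<Longrightarrow> sametype S v u"
  by (simp add: sametype_def)

lemma sametype_trans: "sametype S u v \<Longrightarrow> sametype S v w \<Longrightarrow> sametype S u w"
  by (simp add: sametype_def)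

lemma sametype_less: "sametype S u v \<Longrightarrow> s \<in> S \<Longrightarrow> u < s \<longleftrightarrow> v < s"
  unfolding sametype_def by (metis linorder_neqE_linordered_idom less_asym)

lemma autf_less_fix: "g \<in> autf S \<Longrightarrow> s \<in> S \<Longrightarrow> s < g u \<longleftrightarrow> s < u" "g \<in> autf S \<Longrightarrow> s \<in> S \<Longrightarrow> g u < s \<longleftrightarrow> u < s"
   "g \<in> autf S \<Longrightarrow> s \<in> S \<Longrightarrow> s = g u \<longleftrightarrow> s = u"
  by (metis autf_fix autf_less) (metis autf_fix autf_less, metis autf_fix autf_eq)

lemma sametype_autf: "g \<in> autf S \<Longrightarrow> sametype S u (g u)"
  by (simp add: sametype_def autf_less_fix)

text \<open>The points of \<open>F\<close>, all lying to the left, stay fixed as well. This lets a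
  tuple be put in place from left to right without disturbing the coordinates already
  placed.\<close>

lemma sametype_move:
  assumes "finite S" "finite F" "sametype S u v" "\<forall>f\<in>F. f < u \<and> f < v"
  shows "\<exists>g\<in>autf (S \<union> F). g u = v"
proof (cases "u \<in> S")
  case True then show ?thesis using assms(3) by (intro bexI[of _ id]) (auto simp: sametype_def)
next
  case False
  then have "(S \<union> F) \<inter> {min u v..max u v} = {}"
    using assms(3,4) sametype_less[OF assms(3)] unfolding sametype_def by (auto simp: disjoint_iff min_def max_def)
  then show ?thesis using autf_move[of "S \<union> F" "min u v" "max u v"] assms by (auto simp: min_def max_def split: if_splits)
qed

text \<open>The last coordinate is moved into place by a map that fixes the images of the earlier
  ones. Hence orbits of a stabilizer on increasing tuples are described coordinate by
  coordinate.\<close>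

lemma autf_transport:
  assumes "finite S" "sorted_wrt (<) xs" "sorted_wrt (<) ys" "list_all2 (sametype S) xs ys"
  shows "\<exists>g\<in>autf S. map g xs = ys"
  using assms(2-4)
proof (induction xs arbitrary: ys rule: rev_induct)
  case Nil then show ?case using autf_id(1)[of S] by (simp, blast)
next
  case (snoc x xs)
  obtain y ys' where ys: "ys = ys' @ [y]" "list_all2 (sametype S) xs ys'" "sametype S x y"
    using snoc.prems(3) by (auto simp: list_all2_append1 list_all2_Cons1)
  obtain g where g: "g \<in> autf S" "map g xs = ys'"
    using snoc.IH[OF _ _ ys(2)] snoc.prems ys(1) by (auto simp: sorted_wrt_append)
  have "sametype S (g x) y"
    using ys(3) sametype_autf[OF g(1)] sametype_sym sametype_trans by blast
  moreover have "\<forall>f\<in>set ys'. f < g x \<and> f < y"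
  proof -
    have "\<forall>f\<in>set xs. f < x" "\<forall>f\<in>set ys'. f < y"
      using snoc.prems ys(1) by (auto simp: sorted_wrt_append)
    moreover have "set ys' = g ` set xs" using g(2) by auto
    ultimately show ?thesis by (simp add: autf_less[OF g(1)])
  qed
  ultimately obtain h where h: "h \<in> autf (S \<union> set ys')" "h (g x) = y"
    using sametype_move[of S "set ys'" "g x" y] assms(1) by auto
  have "map (h \<circ> g) xs = ys'"
    using autf_fix[OF h(1)] by (simp flip: map_map add: g(2) map_idI)
  then show ?case using h g(1) ys(1) autf_antimono[of S "S \<union> set ys'"] autf_comp[of h S g]
    by (intro bexI[of _ "h \<circ> g"]) auto
qed

lemma list_all2_sametype_empty: "list_all2 (sametype {}) xs ys \<longleftrightarrow> length xs = length ys"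
  by (auto simp: list_all2_conv_all_nth sametype_def)

lemma incr_map: "g \<in> autf S \<Longrightarrow> map g xs \<in> incr UNIV n \<longleftrightarrow> xs \<in> incr UNIV n"
  by (auto simp: incr_def sorted_wrt_map autf_less)

lemma incr_UNIV: "incr UNIV n = {xs. length xs = n \<and> sorted_wrt (<) xs}"
  by (auto simp: incr_def)

lemma incr_transitive:
  assumes "xs \<in> incr UNIV n" "ys \<in> incr UNIV n"
  shows "\<exists>g\<in>autf {}. map g xs = ys"
  using autf_transport[of "{}" xs ys] assms by (auto simp: incr_UNIV list_all2_sametype_empty)

lemma map_inv_autf: "g \<in> autf S \<Longrightarrow> map (finv g) (map g xs) = xs" "g \<in> autf S \<Longrightarrow> map g (map (finv g) xs) = xs"
  by (simp_all add: autf_inv_simps)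

section \<open>The integral in one variable\<close>

text \<open>These are the step functions with break points in \<open>S\<close>. Invariance is the
  form in which the property is inherited from matrices.\<close>

definition tame :: "real set \<Rightarrow> (real \<Rightarrow> 'k) \<Rightarrow> bool" where
  "tame S \<phi> \<longleftrightarrow> finite S \<and> (\<forall>g\<in>autf S. \<forall>t. \<phi> (g t) = \<phi> t)"

definition leftlim :: "(real \<Rightarrow> 'k) \<Rightarrow> real \<Rightarrow> 'k" where
  "leftlim \<phi> a = (SOME c. \<exists>b<a. \<forall>t. b < t \<and> t < a \<longrightarrow> \<phi> t = c)"

definition jump :: "(real \<Rightarrow> 'k::field) \<Rightarrow> real \<Rightarrow> 'k" where
  "jump \<phi> a = \<phi> a - leftlim \<phi> a"

text \<open>Summing over the points with a non-zero jump keeps \<open>S\<close> out of the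
  definition, so independence of \<open>S\<close> is automatic. The resulting measure is 1 on
  points, -1 on open intervals bounded above and 0 on open intervals unbounded above, as for
  \<open>mu2\<close>.\<close>

definition euler1 :: "(real \<Rightarrow> 'k::field) \<Rightarrow> 'k" where
  "euler1 \<phi> = sum (jump \<phi>) {a. jump \<phi> a \<noteq> 0}"

lemma tame_mono: "tame S \<phi> \<Longrightarrow> S \<subseteq> T \<Longrightarrow> finite T \<Longrightarrow> tame T \<phi>"
  using autf_antimono[of S T] by (auto simp: tame_def)

lemma tame_const [simp]: "finite S \<Longrightarrow> tame S (\<lambda>_. c)"
  by (simp add: tame_def)

lemma tame_of_bool: "finite S \<Longrightarrow> (\<And>g t. g \<in> autf S \<Longrightarrow> P (g t) \<longleftrightarrow> P t) \<Longrightarrow> tame S (\<lambda>t. of_bool (P t))"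
  by (simp add: tame_def)

lemma tame_mult: "tame S \<phi> \<Longrightarrow> tame S \<psi> \<Longrightarrow> tame S (\<lambda>t. \<phi> t * \<psi> t)"
  by (simp add: tame_def)

lemma tame_linear: "tame S \<phi> \<Longrightarrow> tame S \<psi> \<Longrightarrow> tame S (\<lambda>t. c * \<phi> t + \<psi> t)"
  by (simp add: tame_def)

lemma tame_constant_on:
  assumes "tame S \<phi>" "p \<le> q" "S \<inter> {p..q} = {}"
  shows "\<phi> p = \<phi> q"
  using assms autf_move[of S p q] by (auto simp: tame_def)

lemma leftlim_eq:
  assumes "b < a" "\<And>t. b < t \<Longrightarrow> t < a \<Longrightarrow> \<phi> t = c"
  shows "leftlim \<phi> a = c"
  unfolding leftlim_def
proof (rule some_equality)
  fix c' assume "\<exists>b<a. \<forall>t. b < t \<and> t < a \<longrightarrow> \<phi> t = c'"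
  then obtain b' where b': "b' < a" "\<And>t. b' < t \<Longrightarrow> t < a \<Longrightarrow> \<phi> t = c'" by blast
  obtain t where "max b b' < t" "t < a" using dense[of "max b b'" a] assms(1) b'(1) by auto
  then show "c' = c" using assms(2)[of t] b'(2)[of t] by auto
qed (use assms in blast)

lemma tame_leftlim:
  assumes "tame S \<phi>" "b < a" "S \<inter> {b..<a} = {}"
  shows "leftlim \<phi> a = \<phi> b"
proof (rule leftlim_eq[OF assms(2)])
  fix t assume "b < t" "t < a"
  then have "S \<inter> {b..t} = {}" using assms(3) by (auto simp: disjoint_iff)
  then show "\<phi> t = \<phi> b" using tame_constant_on[OF assms(1), of b t] \<open>b < t\<close> by auto
qed

lemma finite_gap_left:
  fixes a :: real
  assumes "finite S"
  shows "\<exists>b<a. S \<inter> {b..<a} = {}"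
proof -
  obtain c where c: "c < a" "(S - {a}) \<inter> {c<..a} = {}" using finite_gap_below[of "S - {a}" a] assms by auto
  obtain b where "c < b" "b < a" using dense c(1) by blast
  then show ?thesis using c(2) by (intro exI[of _ b]) (auto simp: disjoint_iff)
qed

lemma jump_tame:
  assumes "tame S \<phi>" "b < a" "S \<inter> {b..<a} = {}"
  shows "jump \<phi> a = \<phi> a - \<phi> b"
  by (simp add: jump_def tame_leftlim[OF assms])

lemma jump_eq_0:
  assumes "tame S \<phi>" "a \<notin> S"
  shows "jump \<phi> a = 0"
proof -
  obtain b where b: "b < a" "S \<inter> {b..<a} = {}" using finite_gap_left[of S a] assms(1) by (auto simp: tame_def)
  then have "S \<inter> {b..a} = {}" using assms(2) by (auto simp: disjoint_iff order_le_less)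
  then have "\<phi> b = \<phi> a" using tame_constant_on[OF assms(1), of b a] b(1) by simp
  then show ?thesis using jump_tame[OF assms(1) b] by simp
qed

lemma euler1_sum:
  assumes "tame S \<phi>" "finite T" "S \<subseteq> T"
  shows "euler1 \<phi> = sum (jump \<phi>) T"
  unfolding euler1_def
  using assms jump_eq_0[OF assms(1)] by (intro sum.mono_neutral_left) auto

text \<open>Any \<open>l a\<close> close enough to \<open>a\<close> on its left serves as sample
  point for the left limit; the freedom in choosing it is used for the double integral.\<close>

lemma euler1_left:
  assumes "tame S \<phi>" "\<And>a. a \<in> S \<Longrightarrow> l a < a \<and> S \<inter> {l a..<a} = {}"
  shows "euler1 \<phi> = (\<Sum>a\<in>S. \<phi> a - \<phi> (l a))"
  using euler1_sum[OF assms(1), of S] assms(1) jump_tame[OF assms(1)] assms(2)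
  by (auto simp: tame_def intro: sum.cong)

lemma jump_linear:
  assumes "tame S \<phi>" "tame S \<psi>"
  shows "jump (\<lambda>t. c * \<phi> t + \<psi> t) a = c * jump \<phi> a + jump \<psi> a"
proof -
  have f: "finite S" using assms by (simp add: tame_def)
  obtain b where b: "b < a" "S \<inter> {b..<a} = {}" using finite_gap_left[OF f] by blast
  show ?thesis
    unfolding jump_tame[OF tame_linear[OF assms] b] jump_tame[OF assms(1) b] jump_tame[OF assms(2) b]
    by (simp add: algebra_simps)
qed

lemma euler1_linear:
  assumes "tame S \<phi>" "tame S \<psi>"
  shows "euler1 (\<lambda>t. c * \<phi> t + \<psi> t) = c * euler1 \<phi> + euler1 \<psi>"
proof -
  have f: "finite S" using assms by (simp add: tame_def)
  then show ?thesis
    using euler1_sum[OF tame_linear[OF assms] f] euler1_sum[OF assms(1) f] euler1_sum[OF assms(2) f]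
    by (simp add: jump_linear[OF assms] sum.distrib sum_distrib_left)
qed

lemma euler1_diff:
  "tame S \<phi> \<Longrightarrow> tame S \<psi> \<Longrightarrow> euler1 (\<lambda>t. \<phi> t - \<psi> t) = euler1 \<phi> - euler1 \<psi>"
  using euler1_linear[of S \<psi> \<phi> "- 1"] by simp

lemma euler1_const [simp]: "euler1 (\<lambda>t. c) = 0"
  using euler1_left[of "{}" "\<lambda>t. c"] by simp

lemma euler1_scale: "tame S \<phi> \<Longrightarrow> euler1 (\<lambda>t. c * \<phi> t) = c * euler1 \<phi>"
  using euler1_linear[of S \<phi> "\<lambda>_. 0" c] by (simp add: tame_def)

lemma leftlim_comp:
  assumes "g \<in> autf S"
  shows "leftlim (\<lambda>t. \<phi> (g t)) a = leftlim \<phi> (g a)"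
proof -
  have "(\<exists>b<a. \<forall>t. b < t \<and> t < a \<longrightarrow> \<phi> (g t) = c) \<longleftrightarrow> (\<exists>b<g a. \<forall>t. b < t \<and> t < g a \<longrightarrow> \<phi> t = c)" (is "?L \<longleftrightarrow> ?R") for c
  proof
    assume ?L
    then obtain b where b: "b < a" "\<And>t. b < t \<Longrightarrow> t < a \<Longrightarrow> \<phi> (g t) = c" by blast
    have "\<phi> t = c" if "g b < t" "t < g a" for t
      using b(2)[of "finv g t"] that autf_less[OF assms, of _ "finv g t"] autf_less[OF assms, of "finv g t"] autf_inv_simps(2)[OF assms]
      by simp
    then show ?R using b(1) by (intro exI[of _ "g b"]) (simp add: autf_less[OF assms])
  next
    assume ?R
    then obtain b where b: "b < g a" "\<And>t. b < t \<Longrightarrow> t < g a \<Longrightarrow> \<phi> t = c" by blast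
    have e: "g (finv g b) = b" by (rule autf_inv_simps(2)[OF assms])
    have "\<phi> (g t) = c" if "finv g b < t" "t < a" for t
      using b(2)[of "g t"] that autf_less[OF assms, of "finv g b" t] autf_less[OF assms, of t a] e by simp
    then show ?L using b(1) autf_less[OF assms, of "finv g b" a] e by (intro exI[of _ "finv g b"]) simp
  qed
  then show ?thesis by (simp add: leftlim_def)
qed

lemma euler1_comp:
  assumes "g \<in> autf S"
  shows "euler1 (\<lambda>t. \<phi> (g t)) = euler1 \<phi>"
proof -
  have j: "jump (\<lambda>t. \<phi> (g t)) a = jump \<phi> (g a)" for a
    by (simp add: jump_def leftlim_comp[OF assms])
  have "bij_betw g {a. jump \<phi> (g a) \<noteq> 0} {a. jump \<phi> a \<noteq> 0}"
    using autf_bij[OF assms] autf_inv_simps(2)[OF assms]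
    by (auto simp: bij_betw_def inj_on_def autf_eq[OF assms] image_iff intro!: exI[of _ "finv g _"])
  from sum.reindex_bij_betw[OF this, of "jump \<phi>"] show ?thesis
    by (simp add: euler1_def j)
qed

lemma euler1_atLeast: "euler1 (\<lambda>t. of_bool (a \<le> t)) = 1"
  using euler1_left[of "{a}" "\<lambda>t. of_bool (a \<le> t)" "\<lambda>_. a - 1"]
  by (simp add: tame_def autf_less_fix not_less[symmetric])

lemma euler1_greaterThan: "euler1 (\<lambda>t. of_bool (a < t)) = 0"
  using euler1_left[of "{a}" "\<lambda>t. of_bool (a < t)" "\<lambda>_. a - 1"]
  by (simp add: tame_def autf_less_fix)

lemma tame_atLeast: "finite S \<Longrightarrow> a \<in> S \<Longrightarrow> tame S (\<lambda>t. of_bool (a \<le> t))"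
  by (simp add: tame_def autf_less_fix not_less[symmetric])

lemma tame_greaterThan: "finite S \<Longrightarrow> a \<in> S \<Longrightarrow> tame S (\<lambda>t. of_bool (a < t))"
  by (simp add: tame_def autf_less_fix)

text \<open>Each interval is a difference of two rays to the right, of measure 1 if the ray contains
  its end point and 0 otherwise.\<close>

lemma euler1_interval:
  shows "a \<le> b \<Longrightarrow> euler1 (\<lambda>t. of_bool (a \<le> t \<and> t \<le> b)) = (1::'k::field)"
    and "a \<le> b \<Longrightarrow> euler1 (\<lambda>t. of_bool (a < t \<and> t \<le> b)) = (0::'k)"
    and "a \<le> b \<Longrightarrow> euler1 (\<lambda>t. of_bool (a \<le> t \<and> t < b)) = (0::'k)"
    and "a < b \<Longrightarrow> euler1 (\<lambda>t. of_bool (a < t \<and> t < b)) = (- 1::'k)"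
proof -
  have t: "tame {a, b} (\<lambda>t. of_bool (a \<le> t) :: 'k)" "tame {a, b} (\<lambda>t. of_bool (b \<le> t) :: 'k)"
    "tame {a, b} (\<lambda>t. of_bool (a < t) :: 'k)" "tame {a, b} (\<lambda>t. of_bool (b < t) :: 'k)"
    by (auto intro!: tame_atLeast tame_greaterThan)
  have e: "a \<le> b \<Longrightarrow> (\<lambda>t. of_bool (a \<le> t \<and> t \<le> b)) = (\<lambda>t. of_bool (a \<le> t) - (of_bool (b < t)::'k))"
    "a \<le> b \<Longrightarrow> (\<lambda>t. of_bool (a < t \<and> t \<le> b)) = (\<lambda>t. of_bool (a < t) - (of_bool (b < t)::'k))"
    "a \<le> b \<Longrightarrow> (\<lambda>t. of_bool (a \<le> t \<and> t < b)) = (\<lambda>t. of_bool (a \<le> t) - (of_bool (b \<le> t)::'k))"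
    "a < b \<Longrightarrow> (\<lambda>t. of_bool (a < t \<and> t < b)) = (\<lambda>t. of_bool (a < t) - (of_bool (b \<le> t)::'k))"
    by (auto simp: fun_eq_iff)
  show "a \<le> b \<Longrightarrow> euler1 (\<lambda>t. of_bool (a \<le> t \<and> t \<le> b)) = (1::'k)"
    by (subst e(1)) (simp_all add: euler1_diff[OF t(1) t(4)] euler1_atLeast euler1_greaterThan)
  show "a \<le> b \<Longrightarrow> euler1 (\<lambda>t. of_bool (a < t \<and> t \<le> b)) = (0::'k)"
    by (subst e(2)) (simp_all add: euler1_diff[OF t(3) t(4)] euler1_atLeast euler1_greaterThan)
  show "a \<le> b \<Longrightarrow> euler1 (\<lambda>t. of_bool (a \<le> t \<and> t < b)) = (0::'k)"
    by (subst e(3)) (simp_all add: euler1_diff[OF t(1) t(2)] euler1_atLeast euler1_greaterThan)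
  show "a < b \<Longrightarrow> euler1 (\<lambda>t. of_bool (a < t \<and> t < b)) = (- 1::'k)"
    by (subst e(4)) (simp_all add: euler1_diff[OF t(3) t(2)] euler1_atLeast euler1_greaterThan)
qed

lemma euler1_atMost: "euler1 (\<lambda>t. of_bool (t \<le> a)) = (0::'k::field)"
proof -
  have "euler1 (\<lambda>t. (1::'k) - of_bool (a < t)) = 0"
    using euler1_diff[of "{a}", OF tame_const tame_greaterThan, of a] by (simp add: euler1_greaterThan)
  moreover have "(\<lambda>t. (1::'k) - of_bool (a < t)) = (\<lambda>t. of_bool (t \<le> a))" by (auto simp: fun_eq_iff)
  ultimately show ?thesis by simp
qed

lemma euler1_lessThan: "euler1 (\<lambda>t. of_bool (t < a)) = (- 1::'k::field)"
proof -
  have "euler1 (\<lambda>t. (1::'k) - of_bool (a \<le> t)) = - 1"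
    using euler1_diff[of "{a}", OF tame_const tame_atLeast, of a] by (simp add: euler1_atLeast)
  moreover have "(\<lambda>t. (1::'k) - of_bool (a \<le> t)) = (\<lambda>t. of_bool (t < a))" by (auto simp: fun_eq_iff)
  ultimately show ?thesis by simp
qed

lemma euler1_point: "euler1 (\<lambda>t. of_bool (t = a)) = 1"
  using euler1_interval(1)[of a a] by (simp add: order_antisym_conv[symmetric] eq_iff conj_commute)

subsection \<open>Interchanging two integrals\<close>

text \<open>Choose \<open>d < b < c\<close> infinitesimally to the left of each point of \<open>S\<close>: then both iterated
  integrals are double differences over $S \times S$, up to a diagonal correction in which the two
  points of a pair lie in the same gap.\<close>

lemma euler1_euler1_diagonal:
  fixes F :: "real \<Rightarrow> real \<Rightarrow> 'k::field"
  assumes "finite S" and inv: "\<And>g t s. g \<in> autf S \<Longrightarrow> F (g t) (g s) = F t s"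
    and l: "\<And>a. a \<in> S \<Longrightarrow> d a < b a \<and> b a < c a \<and> c a < a \<and> S \<inter> {d a..<a} = {}"
  shows "euler1 (\<lambda>t. euler1 (F t)) =
    (\<Sum>a\<in>S. \<Sum>s\<in>S. F a s - F a (b s) - F (b a) s + F (b a) (b s)) +
    (\<Sum>a\<in>S. F (b a) (c a) + F (b a) (d a) - 2 * F (b a) (b a))"
proof -
  define H where "H t = euler1 (F t)" for t
  have tm: "tame S H"
    unfolding tame_def
  proof (intro conjI ballI allI)
    fix g t assume g: "g \<in> autf S"
    have "H t = euler1 (\<lambda>s. F (g t) (g s))" using inv[OF g] by (simp add: H_def)
    then show "H (g t) = H t" using euler1_comp[OF g, of "F (g t)"] by (simp add: H_def)
  qed fact
  have sub: "insert t S \<subseteq> S \<union> {t}" for t by auto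
  have tF: "tame (insert t S) (F t)" for t
    unfolding tame_def
  proof (intro conjI ballI allI)
    fix g s assume g: "g \<in> autf (insert t S)"
    then have "F (g t) (g s) = F t s" using inv autf_antimono[of S "insert t S"] by auto
    then show "F t (g s) = F t s" using autf_fix[OF g] by auto
  qed (use assms in auto)
  have bS: "b a \<notin> S" if "a \<in> S" for a using l[OF that] by (auto simp: disjoint_iff)
  have Ha: "H a = (\<Sum>s\<in>S. F a s - F a (b s))" if "a \<in> S" for a
    unfolding H_def
  proof (rule euler1_left)
    show "tame S (F a)" using tF[of a] that by (simp add: insert_absorb)
    show "b s < s \<and> S \<inter> {b s..<s} = {}" if "s \<in> S" for s
      using l[OF that] by (auto simp: disjoint_iff)
  qed
  have Hb: "H (b a) = (\<Sum>s\<in>S. F (b a) s - F (b a) (b s)) - (F (b a) (c a) - F (b a) (b a)) + (F (b a) (b a) - F (b a) (d a))"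
    if a: "a \<in> S" for a
  proof -
    \<comment> \<open>Sample points for the enlarged set: the new point \<open>b a\<close> needs one
      to its left, \<open>d a\<close>, and \<open>a\<close> now needs one between \<open>b a\<close>
      and \<open>a\<close>, which is \<open>c a\<close>. All others keep \<open>b s\<close>.\<close>
    define m where "m s = (if s = b a then d a else if s = a then c a else b s)" for s
    have "H (b a) = (\<Sum>s\<in>insert (b a) S. F (b a) s - F (b a) (m s))"
      unfolding H_def
    proof (rule euler1_left[OF tF])
      fix s assume s: "s \<in> insert (b a) S"
      consider "s = b a" | "s = a" | "s \<in> S" "s < a" "s \<noteq> b a" | "s \<in> S" "a < s" "s \<noteq> b a" using s by fastforce
      then show "m s < s \<and> insert (b a) S \<inter> {m s..<s} = {}"
      proof cases
        case 1 then show ?thesis using l[OF a] by (auto simp: m_def disjoint_iff)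
      next
        case 2 then show ?thesis using l[OF a] by (auto simp: m_def disjoint_iff)
      next
        case 3
        have "s \<notin> {d a..<a}" using l[OF a] 3 by auto
        then show ?thesis using 3 l[OF a] l[of s] by (auto simp: m_def disjoint_iff)
      next
        case 4
        have "a \<notin> {d s..<s}" using l[of s] 4 a by auto
        then show ?thesis using 4 l[OF a] l[of s] by (auto simp: m_def disjoint_iff)
      qed
    qed
    also have "\<dots> = (\<Sum>s\<in>S. F (b a) s - F (b a) (m s)) + (F (b a) (b a) - F (b a) (d a))"
      using bS[OF a] assms(1) by (simp add: m_def)
    also have "(\<Sum>s\<in>S. F (b a) s - F (b a) (m s)) =
       (\<Sum>s\<in>S. (F (b a) s - F (b a) (b s)) - (if s = a then F (b a) (c a) - F (b a) (b a) else 0))"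
      by (rule sum.cong) (use bS[OF a] in \<open>auto simp: m_def\<close>)
    also have "\<dots> = (\<Sum>s\<in>S. F (b a) s - F (b a) (b s)) - (F (b a) (c a) - F (b a) (b a))"
      using assms(1) a by (simp add: sum_subtractf)
    finally show ?thesis .
  qed
  have "euler1 H = (\<Sum>a\<in>S. H a - H (b a))"
    by (rule euler1_left[OF tm]) (use l in \<open>force simp: disjoint_iff\<close>)
  also have "\<dots> = (\<Sum>a\<in>S. (\<Sum>s\<in>S. F a s - F a (b s) - F (b a) s + F (b a) (b s)) +
     (F (b a) (c a) + F (b a) (d a) - 2 * F (b a) (b a)))"
    by (rule sum.cong) (auto simp: Ha Hb sum_subtractf sum.distrib)
  finally show ?thesis unfolding H_def by (simp only: sum.distrib)
qed

lemma euler1_swap: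
  fixes F :: "real \<Rightarrow> real \<Rightarrow> 'k::field"
  assumes "finite S" and inv: "\<And>g t s. g \<in> autf S \<Longrightarrow> F (g t) (g s) = F t s"
  shows "euler1 (\<lambda>t. euler1 (\<lambda>s. F t s)) = euler1 (\<lambda>s. euler1 (\<lambda>t. F t s))"
proof -
  have "\<exists>d b c. d < b \<and> b < c \<and> c < a \<and> S \<inter> {d..<a} = {}" for a
    using finite_gap_left[OF assms(1), of a] dense by metis
  then obtain d b c where l: "\<And>a. d a < b a \<and> b a < c a \<and> c a < a \<and> S \<inter> {d a..<a} = {}"
    by metis
  \<comment> \<open>An automorphism fixing \<open>S\<close> shifts the pair \<open>d a\<close>,
    \<open>b a\<close> to \<open>b a\<close>, \<open>c a\<close> inside one gap. This makes the
    diagonal correction symmetric in the two variables.\<close>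
  have eq: "F (b a) (c a) = F (d a) (b a)" "F (b a) (d a) = F (c a) (b a)" for a
  proof -
    have n: "\<forall>s\<in>S. s < d a \<or> a \<le> s" using l[of a] by (auto simp: disjoint_iff)
    have st: "sametype S (d a) (b a)" "sametype S (b a) (c a)"
      using n l[of a] unfolding sametype_def by force+
    have "\<exists>g\<in>autf S. map g [d a, b a] = [b a, c a]"
      by (rule autf_transport) (use assms(1) l[of a] st in auto)
    then obtain g where g: "g \<in> autf S" "g (d a) = b a" "g (b a) = c a" by auto
    show "F (b a) (c a) = F (d a) (b a)" using inv[OF g(1), of "d a" "b a"] g by simp
    show "F (b a) (d a) = F (c a) (b a)" using inv[OF g(1), of "b a" "d a"] g by simp
  qed
  show ?thesis
    using euler1_euler1_diagonal[where F=F and S=S and b=b and c=c and d=d, OF assms(1) inv l]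
      euler1_euler1_diagonal[where F="\<lambda>s t. F t s" and S=S and b=b and c=c and d=d, OF assms(1) inv l]
      sum.swap[of "\<lambda>a s. F a s - F a (b s) - F (b a) s + F (b a) (b s)" S S]
    by (simp add: eq algebra_simps)
qed

section \<open>Iterated integrals\<close>

definition ltame :: "real set \<Rightarrow> (real list \<Rightarrow> 'k) \<Rightarrow> bool" where
  "ltame S \<phi> \<longleftrightarrow> finite S \<and> (\<forall>g\<in>autf S. \<forall>ts. \<phi> (map g ts) = \<phi> ts)"

text \<open>Integration runs over all lists of length \<open>n\<close>, without an order condition;
  integrands coming from matrices are supported on increasing lists, so no domain has to be
  tracked.\<close>

fun euler :: "nat \<Rightarrow> (real list \<Rightarrow> 'k::field) \<Rightarrow> 'k" where
  "euler 0 \<phi> = \<phi> []"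
| "euler (Suc n) \<phi> = euler1 (\<lambda>t. euler n (\<lambda>ts. \<phi> (t # ts)))"

lemma ltameI: "finite S \<Longrightarrow> (\<And>g ts. g \<in> autf S \<Longrightarrow> \<phi> (map g ts) = \<phi> ts) \<Longrightarrow> ltame S \<phi>"
  by (simp add: ltame_def)

lemma ltame_sum: "finite S \<Longrightarrow> (\<And>i. i \<in> I \<Longrightarrow> ltame S (\<phi> i)) \<Longrightarrow> ltame S (\<lambda>ts. \<Sum>i\<in>I. c i * \<phi> i ts)"
  by (simp add: ltame_def)

lemma euler_cong: "(\<And>ts. length ts = n \<Longrightarrow> \<phi> ts = \<psi> ts) \<Longrightarrow> euler n \<phi> = euler n \<psi>"
proof (induction n arbitrary: \<phi> \<psi>)
  case (Suc n)
  have "euler n (\<lambda>ts. \<phi> (t # ts)) = euler n (\<lambda>ts. \<psi> (t # ts))" for t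
    by (rule Suc.IH) (simp add: Suc.prems)
  then show ?case by simp
qed simp

lemma euler_map: "g \<in> autf S \<Longrightarrow> euler n (\<lambda>ts. \<phi> (map g ts)) = euler n \<phi>"
proof (induction n arbitrary: \<phi>)
  case (Suc n)
  have "euler n (\<lambda>ts. \<phi> (g t # map g ts)) = euler n (\<lambda>ts. \<phi> (g t # ts))" for t
    using Suc.IH[OF Suc.prems, of "\<lambda>ts. \<phi> (g t # ts)"] .
  then show ?case using euler1_comp[OF Suc.prems, of "\<lambda>t. euler n (\<lambda>ts. \<phi> (t # ts))"] by simp
qed simp

lemma ltame_Cons: assumes "ltame S \<phi>" shows "ltame (insert t S) (\<lambda>ts. \<phi> (t # ts))"
proof (rule ltameI)
  fix g ts assume g: "g \<in> autf (insert t S)"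
  then have "\<phi> (map g (t # ts)) = \<phi> (t # ts)"
    using assms autf_antimono[of S "insert t S"] unfolding ltame_def by blast
  then show "\<phi> (t # map g ts) = \<phi> (t # ts)" using autf_fix[OF g, of t] by simp
qed (use assms in \<open>simp add: ltame_def\<close>)

text \<open>Moving the parameter by an automorphism is undone by substituting the same automorphism
  in the integration variables.\<close>

lemma euler_param:
  assumes "g \<in> autf S" "\<And>ts. F (h p) (map g ts) = F p ts"
  shows "euler n (F (h p)) = euler n (F p)"
  using euler_map[OF assms(1), of n "F (h p)"] assms(2) by simp

lemma tame_euler: assumes "ltame S \<phi>" shows "tame S (\<lambda>t. euler n (\<lambda>ts. \<phi> (t # ts)))"
  unfolding tame_def
proof (intro conjI ballI allI)
  fix g t assume g: "g \<in> autf S"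
  have "\<phi> (g t # map g ts) = \<phi> (t # ts)" for ts
  proof -
    have "\<phi> (map g (t # ts)) = \<phi> (t # ts)" using assms g unfolding ltame_def by blast
    then show ?thesis by simp
  qed
  then show "euler n (\<lambda>ts. \<phi> (g t # ts)) = euler n (\<lambda>ts. \<phi> (t # ts))"
    using euler_param[OF g, where F="\<lambda>t ts. \<phi> (t # ts)" and h=g] by simp
qed (use assms in \<open>simp add: ltame_def\<close>)

lemma euler_linear:
  "ltame S \<phi> \<Longrightarrow> ltame S \<psi> \<Longrightarrow> euler n (\<lambda>ts. c * \<phi> ts + \<psi> ts) = c * euler n \<phi> + euler n \<psi>"
proof (induction n arbitrary: \<phi> \<psi> S)
  case (Suc n)
  have "euler n (\<lambda>ts. c * \<phi> (t # ts) + \<psi> (t # ts)) = c * euler n (\<lambda>ts. \<phi> (t # ts)) + euler n (\<lambda>ts. \<psi> (t # ts))" for t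
    using Suc.prems by (intro Suc.IH[of "insert t S"] ltame_Cons)
  then show ?case
    using euler1_linear[OF tame_euler[OF Suc.prems(1)] tame_euler[OF Suc.prems(2)]] by simp
qed simp

lemma euler_zero [simp]: "euler n (\<lambda>_. 0) = 0"
  by (induction n) simp_all

lemma euler_scale: "ltame S \<phi> \<Longrightarrow> euler n (\<lambda>ts. c * \<phi> ts) = c * euler n \<phi>"
  using euler_linear[of S \<phi> "\<lambda>_. 0" n c] by (simp add: ltame_def)

lemma euler_sum:
  assumes "finite S" "\<And>i. i \<in> I \<Longrightarrow> ltame S (\<phi> i)"
  shows "euler n (\<lambda>ts. \<Sum>i\<in>I. c i * \<phi> i ts) = (\<Sum>i\<in>I. c i * euler n (\<phi> i))"
  using assms(2)
proof (induction I rule: infinite_finite_induct)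
  case (insert i I)
  then have "ltame S (\<phi> i)" "ltame S (\<lambda>ts. \<Sum>i\<in>I. c i * \<phi> i ts)"
    using assms(1) by (auto intro: ltame_sum)
  from euler_linear[OF this, of n "c i"] insert show ?case by simp
qed simp_all

text \<open>Freezing an integration variable \<open>s\<close> shrinks the symmetry to the stabilizer
  of \<open>insert s S\<close>, so the induction has to run over all finite \<open>S\<close> at
  once.\<close>

lemma euler1_euler_swap:
  assumes "finite S" "\<And>g t ts. g \<in> autf S \<Longrightarrow> F (g t) (map g ts) = F t ts"
  shows "euler1 (\<lambda>t. euler n (F t)) = euler n (\<lambda>ts. euler1 (\<lambda>t. F t ts))"
  using assms
proof (induction n arbitrary: F S)
  case (Suc n)
  have inv: "euler n (\<lambda>ts. F (g t) (g s # ts)) = euler n (\<lambda>ts. F t (s # ts))" if g: "g \<in> autf S" for g t s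
    using euler_param[OF g, where F="\<lambda>(t, s) ts. F t (s # ts)" and h="map_prod g g" and p="(t, s)"]
      Suc.prems(2)[OF g, of t "s # _"] by simp
  have "euler1 (\<lambda>t. euler n (\<lambda>ts. F t (s # ts))) = euler n (\<lambda>ts. euler1 (\<lambda>t. F t (s # ts)))" for s
  proof (rule Suc.IH[of "insert s S"])
    fix g t ts assume g: "g \<in> autf (insert s S)"
    then have "F (g t) (map g (s # ts)) = F t (s # ts)"
      using Suc.prems(2) autf_antimono[of S "insert s S"] by blast
    then show "F (g t) (s # map g ts) = F t (s # ts)" using autf_fix[OF g, of s] by simp
  qed (use Suc.prems(1) in simp)
  then show ?case using euler1_swap[OF Suc.prems(1), of "\<lambda>t s. euler n (\<lambda>ts. F t (s # ts))"] inv by simp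
qed simp

lemma euler_swap:
  assumes "finite S" "\<And>g xs ys. g \<in> autf S \<Longrightarrow> F (map g xs) (map g ys) = F xs ys"
  shows "euler m (\<lambda>xs. euler n (F xs)) = euler n (\<lambda>ys. euler m (\<lambda>xs. F xs ys))"
  using assms
proof (induction m arbitrary: F S)
  case (Suc m)
  have "euler m (\<lambda>xs. euler n (F (t # xs))) = euler n (\<lambda>ys. euler m (\<lambda>xs. F (t # xs) ys))" for t
  proof (rule Suc.IH[of "insert t S"])
    fix g xs ys assume g: "g \<in> autf (insert t S)"
    then have "F (map g (t # xs)) (map g ys) = F (t # xs) ys"
      using Suc.prems(2) autf_antimono[of S "insert t S"] by blast
    then show "F (t # map g xs) (map g ys) = F (t # xs) ys" using autf_fix[OF g, of t] by simp
  qed (use Suc.prems(1) in simp)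
  moreover have "euler1 (\<lambda>t. euler n (\<lambda>ys. euler m (\<lambda>xs. F (t # xs) ys))) =
    euler n (\<lambda>ys. euler1 (\<lambda>t. euler m (\<lambda>xs. F (t # xs) ys)))"
  proof (rule euler1_euler_swap[OF Suc.prems(1)])
    fix g t ys assume g: "g \<in> autf S"
    show "euler m (\<lambda>xs. F (g t # xs) (map g ys)) = euler m (\<lambda>xs. F (t # xs) ys)"
      using euler_param[OF g, where F="\<lambda>(t, ys) xs. F (t # xs) ys" and h="map_prod g (map g)" and p="(t, ys)"]
        Suc.prems(2)[OF g, of "t # _" ys] by simp
  qed
  ultimately show ?case by simp
qed simp

lemma euler_append: "euler (m + n) \<phi> = euler m (\<lambda>xs. euler n (\<lambda>ys. \<phi> (xs @ ys)))"
  by (induction m arbitrary: \<phi>) simp_all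

lemma ltame_point: "finite S \<Longrightarrow> set ts \<subseteq> S \<Longrightarrow> ltame S (\<lambda>us. of_bool (us = ts))"
proof (rule ltameI)
  fix g us assume g: "g \<in> autf S" and s: "set ts \<subseteq> S"
  then have "map g ts = ts" using autf_fix[OF g] by (auto intro: map_idI)
  moreover have "inj (map g)" using autf_bij[OF g] by (simp add: bij_is_inj)
  ultimately have "map g us = ts \<longleftrightarrow> us = ts" by (metis inj_def)
  then show "of_bool (map g us = ts) = of_bool (us = ts)" by simp
qed

lemma euler_point: "length ts = n \<Longrightarrow> euler n (\<lambda>us. of_bool (us = ts)) = (1::'k::field)"
proof (induction n arbitrary: ts)
  case (Suc n)
  then obtain t ts' where ts: "ts = t # ts'" "length ts' = n" by (cases ts) auto
  have "euler n (\<lambda>us. of_bool (u # us = ts)) = (of_bool (u = t) :: 'k)" for u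
    using Suc.IH[OF ts(2)] by (cases "u = t") (simp_all add: ts(1))
  then show ?case by (simp add: euler1_point)
qed simp

lemma euler_delta:
  assumes "length ts = n"
  shows "euler n (\<lambda>us. of_bool (us = ts) * \<phi> us) = (\<phi> ts :: 'k::field)"
proof -
  have "(\<lambda>us. of_bool (us = ts) * \<phi> us) = (\<lambda>us. \<phi> ts * of_bool (us = ts))" by (auto simp: fun_eq_iff)
  then show ?thesis
    using euler_scale[OF ltame_point[of "set ts" ts], of n "\<phi> ts"] euler_point[OF assms, where 'k='k] by simp
qed

section \<open>The measure of an orbit\<close>

text \<open>The measure of the class of \<open>t\<close> under \<open>sametype S\<close>. The three
  cases are a point of \<open>S\<close>, a gap bounded above, and the last gap.\<close>

definition pmeas :: "real set \<Rightarrow> real \<Rightarrow> 'k::field" where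
  "pmeas S t = (if t \<in> S then 1 else if \<exists>s\<in>S. t < s then - 1 else 0)"

definition cls :: "real set \<Rightarrow> real list \<Rightarrow> real list set" where
  "cls S ts = {us. sorted_wrt (<) us \<and> list_all2 (sametype S) ts us}"

lemma tame_sametype: "finite S \<Longrightarrow> tame S (\<lambda>t. of_bool (sametype S a t))"
  using sametype_autf sametype_trans sametype_sym by (intro tame_of_bool) blast+

lemma euler1_sametype:
  assumes "finite S"
  shows "euler1 (\<lambda>t. of_bool (sametype S a t)) = (pmeas S a :: 'k::field)"
proof (cases "a \<in> S")
  case True
  then have "(\<lambda>t. of_bool (sametype S a t) :: 'k) = (\<lambda>t. of_bool (t = a))"
    by (auto simp: sametype_def fun_eq_iff)
  then show ?thesis using True by (simp add: pmeas_def euler1_point)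
next
  case False
  consider (both) "\<exists>s\<in>S. a < s" "\<exists>s\<in>S. s < a" | (hi) "\<exists>s\<in>S. a < s" "\<forall>s\<in>S. a < s"
    | (lo) "\<not> (\<exists>s\<in>S. a < s)" "\<exists>s\<in>S. s < a" | (none) "S = {}"
    using False by (metis linorder_neqE_linordered_idom equals0I)
  then show ?thesis
  proof cases
    case both
    define p q where "p = Max {s\<in>S. s < a}" and "q = Min {s\<in>S. a < s}"
    have "p \<in> {s\<in>S. s < a}" "q \<in> {s\<in>S. a < s}" using both assms unfolding p_def q_def
      by (intro Max_in Min_in; auto)+
    moreover have "\<And>s. s \<in> S \<Longrightarrow> s < a \<Longrightarrow> s \<le> p" "\<And>s. s \<in> S \<Longrightarrow> a < s \<Longrightarrow> q \<le> s"
      unfolding p_def q_def using assms by auto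
    ultimately have "sametype S a t \<longleftrightarrow> p < t \<and> t < q" for t
      using False unfolding sametype_def by (smt (verit) mem_Collect_eq)
    then show ?thesis using euler1_interval(4)[of p q] \<open>p \<in> _\<close> \<open>q \<in> _\<close> both False by (simp add: pmeas_def)
  next
    case hi
    define q where "q = Min {s\<in>S. a < s}"
    have "q \<in> {s\<in>S. a < s}" using hi assms unfolding q_def by (intro Min_in) auto
    moreover have "\<And>s. s \<in> S \<Longrightarrow> q \<le> s"
      unfolding q_def using assms hi by auto
    ultimately have "sametype S a t \<longleftrightarrow> t < q" for t
      using False hi unfolding sametype_def by (smt (verit) mem_Collect_eq)
    then show ?thesis using hi False by (simp add: pmeas_def euler1_lessThan)
  next
    case lo
    define p where "p = Max {s\<in>S. s < a}"
    have "p \<in> {s\<in>S. s < a}" using lo assms unfolding p_def by (intro Max_in) auto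
    moreover have "\<And>s. s \<in> S \<Longrightarrow> s \<le> p"
    proof -
      fix s assume "s \<in> S"
      then have "s < a" using lo(1) False by (metis linorder_neqE_linordered_idom)
      then show "s \<le> p" unfolding p_def using assms \<open>s \<in> S\<close> by auto
    qed
    ultimately have "sametype S a t \<longleftrightarrow> p < t" for t
      using False lo unfolding sametype_def by (smt (verit) mem_Collect_eq)
    then show ?thesis using lo False by (simp add: pmeas_def euler1_greaterThan)
  next
    case none then show ?thesis by (simp add: sametype_def pmeas_def)
  qed
qed

lemma cls_nonempty_head:
  assumes "finite S" "sorted_wrt (<) (t # ts)" "sametype S t u"
  shows "\<exists>vs. u # vs \<in> cls S (t # ts)"
proof -
  obtain g where g: "g \<in> autf S" "g t = u" using sametype_move[of S "{}" t u] assms by auto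
  have "u # map g ts \<in> cls S (t # ts)"
    using assms g sametype_autf[OF g(1)] by (auto simp: cls_def sorted_wrt_map autf_less list_all2_conv_all_nth nth_Cons split: nat.split)
  then show ?thesis by blast
qed

lemma pmeas_sametype: "sametype S t u \<Longrightarrow> pmeas S t = pmeas S u"
  using sametype_less[of S t u] by (auto simp: pmeas_def sametype_def)

lemma list_all2_sametype_trans:
  "list_all2 (sametype S) xs ys \<Longrightarrow> list_all2 (sametype S) ys zs \<Longrightarrow> list_all2 (sametype S) xs zs"
  by (rule list_all2_trans[of "sametype S"]) (blast intro: sametype_trans)+

lemma list_all2_sametype_sym:
  "list_all2 (sametype S) xs ys \<Longrightarrow> list_all2 (sametype S) ys xs"
  by (auto simp: list_all2_conv_all_nth intro: sametype_sym)

lemma cls_eq: "us \<in> cls S ts \<Longrightarrow> cls S us = cls S ts"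
  using list_all2_sametype_trans list_all2_sametype_sym unfolding cls_def by blast

text \<open>Once the first coordinate \<open>u\<close> is fixed, the remaining ones run over an orbit of the stabilizer
  of \<open>insert u S\<close>, and all of them lie to the right of \<open>u\<close>.\<close>

lemma euler_cls:
  assumes "finite S" "sorted_wrt (<) ts"
  shows "euler (length ts) (\<lambda>us. of_bool (us \<in> cls S ts)) = (\<Prod>t\<leftarrow>ts. pmeas S t :: 'a::field)"
  using assms
proof (induction "length ts" arbitrary: S ts)
  case 0 then show ?case by (simp add: cls_def)
next
  case (Suc n tts S)
  then obtain t ts where tts: "tts = t # ts" "length ts = n" by (cases tts) auto
  note prems = Suc.prems[unfolded tts(1)]
  have "euler (length ts) (\<lambda>us. of_bool (u # us \<in> cls S (t # ts))) = (\<Prod>t\<leftarrow>ts. pmeas S t) * (of_bool (sametype S t u) :: 'a)" for u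
  proof (cases "sametype S t u")
    case False then show ?thesis by (simp add: cls_def)
  next
    case True
    then obtain vs where vs: "u # vs \<in> cls S (t # ts)" using cls_nonempty_head[OF prems] by blast
    then have v: "list_all2 (sametype S) ts vs" "sorted_wrt (<) vs" "\<forall>v\<in>set vs. u < v"
      by (auto simp: cls_def)
    have "u # us \<in> cls S (t # ts) \<longleftrightarrow> us \<in> cls (insert u S) vs" for us
    proof -
      have gt: "\<forall>v\<in>set us. u < v" if "list_all2 (sametype (insert u S)) vs us"
        using that v(3) unfolding list_all2_conv_all_nth all_set_conv_all_nth by (auto simp: sametype_def)
      have "list_all2 (sametype (insert u S)) vs us \<longleftrightarrow> list_all2 (sametype S) vs us" if "\<forall>v\<in>set us. u < v"
        using that v(3) unfolding list_all2_conv_all_nth all_set_conv_all_nth by (auto simp: sametype_def)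
      moreover have "list_all2 (sametype S) vs us \<longleftrightarrow> list_all2 (sametype S) ts us"
        using v(1) list_all2_sametype_trans list_all2_sametype_sym by blast
      ultimately show ?thesis using True gt by (auto simp: cls_def)
    qed
    then have "euler (length ts) (\<lambda>us. of_bool (u # us \<in> cls S (t # ts))) = (\<Prod>t\<leftarrow>vs. pmeas (insert u S) t :: 'a)"
      using Suc.hyps(1)[of vs "insert u S"] prems(1) v(2) list_all2_lengthD[OF v(1)] tts(2) by simp
    \<comment> \<open>\<open>pmeas\<close> only asks for points of the set at or above its argument,
      and \<open>u\<close> lies below every entry of \<open>vs\<close>.\<close>
    also have "map (pmeas (insert u S)) vs = (map (pmeas S) ts :: 'a list)"
    proof (rule nth_equalityI)
      show "length (map (pmeas (insert u S)) vs) = length (map (pmeas S) ts)"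
        using list_all2_lengthD[OF v(1)] by simp
      fix i assume i: "i < length (map (pmeas (insert u S)) vs :: 'a list)"
      then have "u < vs ! i" "sametype S (ts ! i) (vs ! i)"
        using v by (auto simp: list_all2_conv_all_nth)
      then have "pmeas (insert u S) (vs ! i) = (pmeas S (ts ! i) :: 'a)"
        by (subst pmeas_sametype[of S "ts ! i" "vs ! i"]) (auto simp: pmeas_def)
      then show "map (pmeas (insert u S)) vs ! i = (map (pmeas S) ts ! i :: 'a)"
        using i list_all2_lengthD[OF v(1)] by simp
    qed
    finally show ?thesis using True by simp
  qed
  then show ?case
    by (simp add: tts euler1_scale[OF tame_sametype[OF prems(1)]] euler1_sametype[OF prems(1)])
qed

section \<open>Sets with an action of the automorphism group\<close>

lemma gset_act_closed: "gset X \<Longrightarrow> g \<in> autf {} \<Longrightarrow> x \<in> pts X \<Longrightarrow> act X g x \<in> pts X"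
  unfolding gset_def using group_action.element_image[of aut_R "pts X" "act X" g x] by (auto simp: carrier_aut_R)

lemma gset_act_comp:
  "gset X \<Longrightarrow> g \<in> autf {} \<Longrightarrow> h \<in> autf {} \<Longrightarrow> x \<in> pts X \<Longrightarrow> act X (g \<circ> h) x = act X g (act X h x)"
  unfolding gset_def using group_action.composition_rule[of aut_R "pts X" "act X" x g h]
  by (auto simp: carrier_aut_R mult_aut_R)

lemma gset_act_id: "gset X \<Longrightarrow> x \<in> pts X \<Longrightarrow> act X id x = x"
  unfolding gset_def using group_action.id_eq_one[of aut_R "pts X" "act X"]
  by (auto simp: one_aut_R fun_eq_iff restrict_def) metis

lemma gset_act_inv:
  assumes "gset X" "g \<in> autf {}" "x \<in> pts X"
  shows "act X (finv g) (act X g x) = x" "act X g (act X (finv g) x) = x"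
  using gset_act_comp[OF assms(1) autf_inv[OF assms(2)] assms(2,3)]
    gset_act_comp[OF assms(1,2) autf_inv[OF assms(2)] assms(3)]
    gset_act_id[OF assms(1,3)] by (simp_all add: autf_inv_simps[OF assms(2)])

lemma gset_stabilizer:
  assumes "gset X" "x \<in> pts X"
  obtains S where "finite S" "\<And>g. g \<in> autf S \<Longrightarrow> act X g x = x"
proof -
  obtain S where "finite S" "carrier (aut_R_fix S) \<subseteq> stabilizer aut_R (act X) x"
    using assms unfolding gset_def by blast
  then show ?thesis using that[of S] by (auto simp: carrier_aut_R_fix stabilizer_def)
qed

lemma orbit_aut_R_fix: "orbit (aut_R_fix S) \<phi> x = {\<phi> g x | g. g \<in> autf S}"
  by (simp add: orbit_def carrier_aut_R_fix)

lemma orbit_aut_R: "orbit aut_R \<phi> x = {\<phi> g x | g. g \<in> autf {}}"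
  by (simp add: orbit_def carrier_aut_R)

subsection \<open>Open subgroups are pointwise stabilizers\<close>

text \<open>Conjugation by \<open>k\<close> shows that \<open>H\<close> contains the stabilizer of
  the image of \<open>S\<close> under \<open>k\<close>, and \<open>s\<close> is not in that image.
  So \<open>s\<close> can be nudged inside \<open>H\<close> while the rest of \<open>S\<close> stays
  put, and from its new position the stabilizer of \<open>S\<close> carries it on to
  \<open>g s\<close>. What remains of \<open>g\<close> then fixes \<open>S\<close>.\<close>

lemma autf_remove_point:
  assumes H: "H \<subseteq> autf {}" "\<And>g h. g \<in> H \<Longrightarrow> h \<in> H \<Longrightarrow> g \<circ> h \<in> H" "\<And>g. g \<in> H \<Longrightarrow> finv g \<in> H"
    and S: "finite S" "autf S \<subseteq> H" and k: "k \<in> H" and s: "s \<in> S" "s \<notin> k ` S"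
  shows "autf (S - {s}) \<subseteq> H"
proof
  fix g assume g: "g \<in> autf (S - {s})"
  have kk: "k \<in> autf {}" using H(1) k by blast
  define B where "B = k ` S \<union> (S - {s})"
  have B: "finite B" "s \<notin> B" using S(1) s(2) by (auto simp: B_def)
  have BH: "h \<in> H" if "h \<in> autf B" for h
  proof -
    have "finv k \<circ> (h \<circ> k) \<in> autf {}"
      using kk autf_empty[OF that] autf_inv[OF kk] autf_comp by blast
    moreover have "(finv k \<circ> (h \<circ> k)) a = a" if "a \<in> S" for a
      using autf_fix[OF \<open>h \<in> autf B\<close>, of "k a"] that autf_inv_simps(1)[OF kk] by (simp add: B_def)
    ultimately have "finv k \<circ> (h \<circ> k) \<in> H" using S(2) by (auto simp: autf_def)
    then have "k \<circ> (finv k \<circ> (h \<circ> k)) \<circ> finv k \<in> H" using H k by blast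
    moreover have "k \<circ> (finv k \<circ> (h \<circ> k)) \<circ> finv k = h"
      by (auto simp: fun_eq_iff autf_inv_simps[OF kk])
    ultimately show ?thesis by simp
  qed
  have move: "\<exists>m\<in>H. m \<in> autf (S - {s}) \<and> m s = g s"
  proof (cases "g s" s rule: linorder_cases)
    case equal
    then have "g \<in> autf S" using g by (auto simp: autf_def)
    then show ?thesis using S(2) g by auto
  next
    case greater
    \<comment> \<open>Two moves are needed: points of \<open>B\<close> may lie between
      \<open>s\<close> and \<open>g s\<close>, and the stabilizer of \<open>S\<close> cannot move
      \<open>s\<close> itself. The first move only goes to a nearby \<open>p\<close>, the second
      covers the remaining distance.\<close>
    obtain d where d: "s < d" "B \<inter> {s..<d} = {}" using finite_gap_above[OF B] by blast
    obtain p where p: "s < p" "p < min d (g s)" using dense[of s "min d (g s)"] d(1) greater by auto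
    have "S \<inter> {p..g s} = {}"
    proof (rule ccontr)
      assume "S \<inter> {p..g s} \<noteq> {}"
      then obtain a where a: "a \<in> S" "p \<le> a" "a \<le> g s" by auto
      then show False using autf_less_fix(2)[OF g, of a s] p(1) by auto
    qed
    then obtain m2 where m2: "m2 \<in> autf S" "m2 p = g s" using autf_move(1)[OF S(1), of p "g s"] p by auto
    have "B \<inter> {s..p} = {}" using d p by (auto simp: disjoint_iff)
    then obtain m1 where m1: "m1 \<in> autf B" "m1 s = p" using autf_move(1)[OF B(1), of s p] p by auto
    have "m1 \<in> autf (S - {s})" using autf_antimono[of "S - {s}" B] m1(1) by (auto simp: B_def)
    moreover have "m2 \<in> autf (S - {s})" using autf_antimono[of "S - {s}" S] m2(1) by auto
    ultimately show ?thesis using m1 m2 H(2) BH S(2) by (intro bexI[of _ "m2 \<circ> m1"]) (auto intro: autf_comp)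
  next
    case less
    obtain d where d: "d < s" "B \<inter> {d<..s} = {}" using finite_gap_below[OF B] by blast
    obtain p where p: "p < s" "max d (g s) < p" using dense[of "max d (g s)" s] d(1) less by auto
    have "S \<inter> {g s..p} = {}"
    proof (rule ccontr)
      assume "S \<inter> {g s..p} \<noteq> {}"
      then obtain a where a: "a \<in> S" "a \<le> p" "g s \<le> a" by auto
      then show False using autf_less_fix(1)[OF g, of a s] autf_less_fix(3)[OF g, of a s] p(1) by auto
    qed
    then obtain m2 where m2: "m2 \<in> autf S" "m2 p = g s" using autf_move(2)[OF S(1), of "g s" p] p by auto
    have "B \<inter> {p..s} = {}" using d p by (auto simp: disjoint_iff)
    then obtain m1 where m1: "m1 \<in> autf B" "m1 s = p" using autf_move(2)[OF B(1), of p s] p by auto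
    have "m1 \<in> autf (S - {s})" using autf_antimono[of "S - {s}" B] m1(1) by (auto simp: B_def)
    moreover have "m2 \<in> autf (S - {s})" using autf_antimono[of "S - {s}" S] m2(1) by auto
    ultimately show ?thesis using m1 m2 H(2) BH S(2) by (intro bexI[of _ "m2 \<circ> m1"]) (auto intro: autf_comp)
  qed
  then obtain m where m: "m \<in> H" "m \<in> autf (S - {s})" "m s = g s" by blast
  have "finv m \<circ> g \<in> autf (S - {s})" using autf_comp[OF autf_inv[OF m(2)] g] .
  moreover have "(finv m \<circ> g) s = s" using autf_inv_simps(1)[OF m(2), of s] m(3) by simp
  ultimately have "finv m \<circ> g \<in> autf S" unfolding autf_def by auto
  then have "finv m \<circ> g \<in> H" using S(2) by blast
  then have "m \<circ> (finv m \<circ> g) \<in> H" using H(2) m(1) by blast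
  moreover have "m \<circ> (finv m \<circ> g) = g" by (auto simp: fun_eq_iff autf_inv_simps[OF m(2)])
  ultimately show "g \<in> H" by simp
qed

text \<open>A set \<open>S\<close> of minimal size with \<open>autf S \<subseteq> H\<close> is fixed by \<open>H\<close>: if \<open>k \<in> H\<close> moves its
  smallest non-fixed point \<open>s\<close> upwards, then \<open>s \<notin> k ` S\<close> and \<open>s\<close> can be dropped.\<close>

lemma open_subgroup_eq_autf:
  assumes H: "H \<subseteq> autf {}" "\<And>g h. g \<in> H \<Longrightarrow> h \<in> H \<Longrightarrow> g \<circ> h \<in> H" "\<And>g. g \<in> H \<Longrightarrow> finv g \<in> H"
    and S: "finite S" "autf S \<subseteq> H"
  shows "\<exists>T. finite T \<and> H = autf T"
proof -
  have "\<exists>T. (finite T \<and> autf T \<subseteq> H) \<and> (\<forall>U. finite U \<and> autf U \<subseteq> H \<longrightarrow> card T \<le> card U)"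
    by (rule ex_has_least_nat) (use S in simp)
  then obtain T where T: "finite T" "autf T \<subseteq> H" and least: "\<And>U. finite U \<Longrightarrow> autf U \<subseteq> H \<Longrightarrow> card T \<le> card U"
    by auto
  have "h s = s" if h: "h \<in> H" and "s \<in> T" for h s
  proof (rule ccontr)
    assume "h s \<noteq> s"
    define a where "a = Min {s\<in>T. h s \<noteq> s}"
    have "a \<in> {s\<in>T. h s \<noteq> s}" unfolding a_def using T(1) \<open>h s \<noteq> s\<close> \<open>s \<in> T\<close> by (intro Min_in) auto
    then have a: "a \<in> T" "h a \<noteq> a" by auto
    have below: "h b = b" if "b \<in> T" "b < a" for b
    proof (rule ccontr)
      assume "h b \<noteq> b"
      then have "a \<le> b" unfolding a_def using that(1) T(1) by (intro Min_le) auto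
      then show False using that(2) by simp
    qed
    have hh: "h \<in> autf {}" using h H(1) by blast
    obtain k where k: "k \<in> H" "a < k a" "\<And>b. b \<in> T \<Longrightarrow> b < a \<Longrightarrow> k b = b"
    proof (cases "a < h a")
      case True then show ?thesis using that[of h] h below by auto
    next
      case False
      then have "finv h (h a) < finv h a" using a(2) autf_less[OF autf_inv[OF hh], of "h a" a] by auto
      then have "a < finv h a" by (simp add: autf_inv_simps[OF hh])
      moreover have "finv h b = b" if "b \<in> T" "b < a" for b
        using below[OF that] autf_inv_simps(1)[OF hh, of b] by simp
      ultimately show ?thesis using that[of "finv h"] H(3) h by auto
    qed
    have kk: "k \<in> autf {}" using k(1) H(1) by blast
    have "a \<notin> k ` T"
    proof
      assume "a \<in> k ` T"
      then obtain b where b: "b \<in> T" "a = k b" by blast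
      then show False using k autf_le[OF kk, of a b] by (cases "b < a") auto
    qed
    then have "autf (T - {a}) \<subseteq> H" using autf_remove_point[OF H T k(1) a(1)] by blast
    then have "card T \<le> card (T - {a})" using least T(1) by simp
    then show False using a(1) T(1) card_Diff1_less[of T a] by simp
  qed
  then have "H = autf T" using T(2) H(1) by (auto simp: autf_def)
  then show ?thesis using T(1) by blast
qed

subsection \<open>Charts of orbits\<close>

definition chart :: "'x gset \<Rightarrow> 'x set \<Rightarrow> nat \<Rightarrow> (real list \<Rightarrow> 'x) \<Rightarrow> bool" where
  "chart X Q n f \<longleftrightarrow> bij_betw f (incr UNIV n) Q \<and>
     (\<forall>g\<in>autf {}. \<forall>ts\<in>incr UNIV n. f (map g ts) = act X g (f ts))"

text \<open>The stabilizer of a point \<open>x\<close> is \<open>autf T\<close> for a finite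
  \<open>T\<close>, and this is also the stabilizer of the increasing list \<open>t0\<close> of the
  elements of \<open>T\<close>. Both orbits are therefore the same coset space, and
  \<open>map g t0\<close> is matched with \<open>act X g x\<close>.\<close>

lemma chart_exists:
  assumes X: "gset X" and Q: "Q \<in> orbits aut_R (pts X) (act X)"
  shows "\<exists>n f. chart X Q n f"
proof -
  obtain x where x: "x \<in> pts X" "Q = {act X g x | g. g \<in> autf {}}"
    using Q unfolding orbits_def orbit_aut_R by blast
  define H where "H = {g \<in> autf {}. act X g x = x}"
  obtain S where S: "finite S" "\<And>g. g \<in> autf S \<Longrightarrow> act X g x = x" using gset_stabilizer[OF X x(1)] by blast
  have "\<exists>T. finite T \<and> H = autf T"
  proof (rule open_subgroup_eq_autf)
    show "g \<circ> h \<in> H" if "g \<in> H" "h \<in> H" for g h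
      using that gset_act_comp[OF X _ _ x(1)] autf_comp by (auto simp: H_def)
    show "finv g \<in> H" if "g \<in> H" for g
      using that gset_act_inv(1)[OF X _ x(1), of g] autf_inv by (auto simp: H_def)
    show "autf S \<subseteq> H" using S(2) autf_empty by (auto simp: H_def)
  qed (use S in \<open>auto simp: H_def\<close>)
  then obtain T where T: "finite T" "H = autf T" by blast
  have mem: "g \<in> autf T \<longleftrightarrow> g \<in> autf {} \<and> act X g x = x" for g
    using T(2) unfolding H_def by blast
  define t0 where "t0 = sorted_list_of_set T"
  define n where "n = card T"
  have t0: "t0 \<in> incr UNIV n" "set t0 = T"
    using T(1) by (auto simp: t0_def n_def incr_UNIV)
  have same: "map g t0 = map h t0 \<longleftrightarrow> act X g x = act X h x" if g: "g \<in> autf {}" and h: "h \<in> autf {}" for g h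
  proof -
    have hg: "finv h \<circ> g \<in> autf {}" using autf_comp[OF autf_inv[OF h] g] .
    have "map g t0 = map h t0 \<longleftrightarrow> (\<forall>t\<in>T. g t = h t)" using t0(2) by auto
    also have "\<dots> \<longleftrightarrow> (\<forall>t\<in>T. finv h (g t) = t)"
      by (metis autf_inv_simps(1,2)[OF h])
    also have "\<dots> \<longleftrightarrow> finv h \<circ> g \<in> autf T" using hg by (auto simp: autf_def)
    also have "\<dots> \<longleftrightarrow> act X (finv h) (act X g x) = x"
      using hg mem[of "finv h \<circ> g"] gset_act_comp[OF X autf_inv[OF h] g x(1)] by simp
    also have "\<dots> \<longleftrightarrow> act X g x = act X h x"
      using gset_act_inv[OF X h] gset_act_closed[OF X g x(1)] x(1) by metis
    finally show ?thesis .
  qed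
  define f where "f ts = act X (SOME g. g \<in> autf {} \<and> map g t0 = ts) x" for ts
  have f: "f (map g t0) = act X g x" if g: "g \<in> autf {}" for g
  proof -
    define h where "h = (SOME h. h \<in> autf {} \<and> map h t0 = map g t0)"
    have "h \<in> autf {} \<and> map h t0 = map g t0" unfolding h_def by (rule someI[of _ g]) (use g in simp)
    then show ?thesis using same[of h g] g unfolding f_def h_def by blast
  qed
  have surj: "\<exists>g\<in>autf {}. map g t0 = ts" if "ts \<in> incr UNIV n" for ts
    using incr_transitive[OF t0(1) that] .
  have "inj_on f (incr UNIV n)"
  proof (rule inj_onI)
    fix ts us assume ts: "ts \<in> incr UNIV n" and us: "us \<in> incr UNIV n" and eq: "f ts = f us"
    obtain g h where g: "g \<in> autf {}" "map g t0 = ts" and h: "h \<in> autf {}" "map h t0 = us"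
      using surj[OF ts] surj[OF us] by blast
    have "act X g x = act X h x" using f[OF g(1)] f[OF h(1)] eq g(2) h(2) by simp
    then show "ts = us" using same[OF g(1) h(1)] g(2) h(2) by simp
  qed
  moreover have "f ` incr UNIV n = Q"
  proof
    show "f ` incr UNIV n \<subseteq> Q"
    proof
      fix y assume "y \<in> f ` incr UNIV n"
      then obtain ts where ts: "ts \<in> incr UNIV n" "y = f ts" by blast
      obtain g where "g \<in> autf {}" "map g t0 = ts" using surj[OF ts(1)] by blast
      then show "y \<in> Q" using f[of g] ts(2) x(2) by blast
    qed
    show "Q \<subseteq> f ` incr UNIV n"
    proof
      fix y assume "y \<in> Q"
      then obtain g where "g \<in> autf {}" "y = act X g x" using x(2) by auto
      then show "y \<in> f ` incr UNIV n" using f[of g] incr_map[of g "{}" t0 n] t0(1) by (metis imageI)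
    qed
  qed
  moreover have "f (map g ts) = act X g (f ts)" if g: "g \<in> autf {}" and ts: "ts \<in> incr UNIV n" for g ts
  proof -
    obtain h where h: "h \<in> autf {}" "map h t0 = ts" using surj[OF ts] by blast
    have "f (map (g \<circ> h) t0) = act X (g \<circ> h) x" using f autf_comp[OF g h(1)] by blast
    then show ?thesis using h f[OF h(1)] gset_act_comp[OF X g h(1) x(1)] by auto
  qed
  ultimately show ?thesis by (auto simp: chart_def bij_betw_def)
qed

lemma charts_exist:
  assumes "gset X"
  obtains N f where "\<And>Q. Q \<in> orbits aut_R (pts X) (act X) \<Longrightarrow> chart X Q (N Q) (f Q)"
  using chart_exists[OF assms] by metis

section \<open>The exponents of an orbit\<close>

lemma gap_properties:
  assumes S: "finite S" and j: "j \<le> card S" and u: "u \<in> gap S j"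
  shows "u \<notin> S" "card {s\<in>S. s < u} = j"
proof -
  define l where "l = sorted_list_of_set S"
  have l: "length l = card S" "set l = S" "distinct l" "sorted_wrt (<) l"
    using S by (auto simp: l_def)
  have lo: "l ! i < u" if "i < j" for i
  proof -
    have "l ! (j - 1) < u" using u that by (auto simp: gap_def l_def)
    moreover have "l ! i \<le> l ! (j - 1)" using sorted_wrt_nth_less[OF l(4), of i "j - 1"] that j l(1)
      by (cases "i = j - 1") (auto simp: order_le_less)
    ultimately show ?thesis by simp
  qed
  have hi: "u < l ! i" if "j \<le> i" "i < card S" for i
  proof -
    have "u < l ! j" using u that by (auto simp: gap_def l_def)
    moreover have "l ! j \<le> l ! i" using sorted_wrt_nth_less[OF l(4), of j i] that l(1)
      by (cases "i = j") (auto simp: order_le_less)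
    ultimately show ?thesis by simp
  qed
  show "u \<notin> S"
  proof
    assume "u \<in> S"
    then obtain i where "i < card S" "l ! i = u" using l by (metis in_set_conv_nth)
    then show False using lo[of i] hi[of i] by (cases "i < j") auto
  qed
  have "{s\<in>S. s < u} = (!) l ` {..<j}"
  proof
    show "{s\<in>S. s < u} \<subseteq> (!) l ` {..<j}"
    proof
      fix s assume s: "s \<in> {s\<in>S. s < u}"
      then obtain i where i: "i < card S" "l ! i = s" using l by (metis (lifting) in_set_conv_nth mem_Collect_eq)
      then have "i < j" using hi[of i] s by (cases "i < j") auto
      then show "s \<in> (!) l ` {..<j}" using i by auto
    qed
    show "(!) l ` {..<j} \<subseteq> {s\<in>S. s < u}" using lo l j by (auto intro: nth_mem)
  qed
  moreover have "inj_on ((!) l) {..<j}"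
    using l j by (auto simp: inj_on_def nth_eq_iff_index_eq)
  ultimately show "card {s\<in>S. s < u} = j" by (simp add: card_image)
qed

text \<open>The index of a gap is recovered by counting the points of \<open>S\<close> below. From
  here on this count, which is monotone and visibly invariant, replaces list indices.\<close>

lemma in_gap_iff:
  assumes S: "finite S" and j: "j \<le> card S"
  shows "u \<in> gap S j \<longleftrightarrow> u \<notin> S \<and> card {s\<in>S. s < u} = j"
proof
  assume u: "u \<notin> S \<and> card {s\<in>S. s < u} = j"
  define l where "l = sorted_list_of_set S"
  have l: "length l = card S" "set l = S" using S by (auto simp: l_def)
  \<comment> \<open>The alternative \<open>i = card S\<close> provides the value when
    \<open>u\<close> lies above all of \<open>S\<close>.\<close>
  define i where "i = (LEAST i. i = card S \<or> u < l ! i)"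
  have i: "i = card S \<or> u < l ! i" unfolding i_def by (rule LeastI) blast
  have i_le: "i \<le> card S" unfolding i_def by (rule Least_le) blast
  have "l ! (i - 1) < u" if "0 < i"
  proof -
    have "i - 1 < card S" using that i_le by simp
    then have "l ! (i - 1) \<in> S" using l by (metis nth_mem)
    moreover have "\<not> u < l ! (i - 1)" using that not_less_Least[of "i - 1" "\<lambda>i. i = card S \<or> u < l ! i"]
      by (auto simp: i_def)
    ultimately show ?thesis using u by (metis linorder_neqE_linordered_idom)
  qed
  then have "u \<in> gap S i" using i by (auto simp: gap_def l_def)
  with gap_properties(2)[OF S i_le this] u show "u \<in> gap S j" by simp
qed (use gap_properties[OF S j] in blast)

lemma card_below_le: "finite S \<Longrightarrow> card {s\<in>S. s < u} \<le> card S"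
  by (rule card_mono) auto

lemma gap_less:
  assumes "finite S" "i < j" "j \<le> card S" "x \<in> gap S i" "y \<in> gap S j"
  shows "x < y"
proof (rule ccontr)
  assume "\<not> x < y"
  then have "card {s\<in>S. s < y} \<le> card {s\<in>S. s < x}" using assms(1) by (intro card_mono) auto
  then show False using assms by (simp add: in_gap_iff)
qed

lemma gap_sametype:
  assumes "finite S" "j \<le> card S" "x \<in> gap S j" "y \<in> gap S j"
  shows "sametype S x y"
proof -
  have *: "False" if "x \<in> gap S j" "y \<in> gap S j" "s \<in> S" "s < x" "\<not> s < y" for s x y
  proof -
    have "{s\<in>S. s < y} \<subset> {s\<in>S. s < x}" using that by auto
    then have "card {s\<in>S. s < y} < card {s\<in>S. s < x}" using assms(1) by (intro psubset_card_mono) auto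
    then show False using that assms by (simp add: in_gap_iff)
  qed
  then show ?thesis using assms *[of x y] *[of y x] by (auto simp: sametype_def in_gap_iff)
qed

lemma gap_autf: "finite S \<Longrightarrow> j \<le> card S \<Longrightarrow> g \<in> autf S \<Longrightarrow> g u \<in> gap S j \<longleftrightarrow> u \<in> gap S j"
proof -
  assume *: "finite S" "j \<le> card S" "g \<in> autf S"
  have "g u \<in> S \<longleftrightarrow> u \<in> S" using autf_less_fix(3)[OF *(3)] by metis
  moreover have "{s\<in>S. s < g u} = {s\<in>S. s < u}" using autf_less_fix(1)[OF *(3)] by auto
  ultimately show ?thesis using * by (simp add: in_gap_iff)
qed

section \<open>Orbits of stabilizers on tuples as products over the gaps\<close>

lemma sorted_wrt_concat:
  "(\<And>p. p \<in> set ps \<Longrightarrow> sorted_wrt R p) \<Longrightarrow> sorted_wrt (\<lambda>p q. \<forall>x\<in>set p. \<forall>y\<in>set q. R x y) ps \<Longrightarrow>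
    sorted_wrt R (concat ps)"
  by (induction ps) (auto simp: sorted_wrt_append)

lemma cell_sorted:
  assumes S: "finite S" and n: "length ns = Suc (card S)" and ps: "ps \<in> cell S ns"
  shows "sorted_wrt (<) (concat ps)"
proof (rule sorted_wrt_concat)
  show "sorted_wrt (<) p" if "p \<in> set ps" for p
    using that ps by (auto simp: cell_def incr_def in_set_conv_nth)
  show "sorted_wrt (\<lambda>p q. \<forall>x\<in>set p. \<forall>y\<in>set q. x < y) ps"
    unfolding sorted_wrt_iff_nth_less
  proof (intro allI impI ballI)
    fix i j x y assume ij: "i < j" "j < length ps" and xy: "x \<in> set (ps ! i)" "y \<in> set (ps ! j)"
    have "i < length ns" "j < length ns" using ij ps by (auto simp: cell_def)
    then have "set (ps ! i) \<subseteq> gap S i" "set (ps ! j) \<subseteq> gap S j" "j \<le> card S"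
      using ps n by (auto simp: cell_def incr_def)
    then have "x \<in> gap S i" "y \<in> gap S j" "j \<le> card S" using xy by auto
    then show "x < y" using gap_less[OF S ij(1)] by blast
  qed
qed

lemma list_all2_concat: "list_all2 (list_all2 R) xs ys \<Longrightarrow> list_all2 R (concat xs) (concat ys)"
  by (induction rule: list_all2_induct) (auto intro: list_all2_appendI)

text \<open>The gaps are ordered, so the concatenated components form an increasing tuple, and a
  single automorphism transports one such tuple to the other.\<close>

lemma cell_transitive:
  assumes S: "finite S" and n: "length ns = Suc (card S)" and ps: "ps \<in> cell S ns" and qs: "qs \<in> cell S ns"
  shows "\<exists>g\<in>autf S. map (map g) ps = qs"
proof -
  have "list_all2 (list_all2 (sametype S)) ps qs"
    unfolding list_all2_conv_all_nth
  proof (intro conjI allI impI)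
    fix j i assume ji: "j < length ps" "i < length (ps ! j)"
    then have "ps ! j ! i \<in> gap S j" "qs ! j ! i \<in> gap S j" "j \<le> card S"
      using ps qs n by (auto simp: cell_def incr_def subset_iff)
    then show "sametype S (ps ! j ! i) (qs ! j ! i)" using gap_sametype[OF S] by blast
  qed (use ps qs in \<open>auto simp: cell_def incr_def\<close>)
  then obtain g where g: "g \<in> autf S" "map g (concat ps) = concat qs"
    using autf_transport[OF S cell_sorted[OF S n ps] cell_sorted[OF S n qs]] list_all2_concat by blast
  have "map (map g) ps = qs"
  proof (rule concat_injective)
    show "concat (map (map g) ps) = concat qs" using g(2) by (simp add: map_concat)
  qed (use ps qs in \<open>auto simp: cell_def incr_def set_zip\<close>)
  then show ?thesis using g(1) by blast
qed

text \<open>Coordinates in \<open>S\<close> are dropped: they are fixed by the stabilizer of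
  \<open>S\<close>, hence constant along an orbit. The others are distributed over all
  \<open>card S + 1\<close> gaps, empty ones included.\<close>

definition gap_parts :: "real set \<Rightarrow> real list \<Rightarrow> real list list" where
  "gap_parts S ts = map (\<lambda>j. filter (\<lambda>u. u \<in> gap S j) ts) [0..<Suc (card S)]"

lemma gap_parts_map:
  assumes "finite S" "g \<in> autf S"
  shows "gap_parts S (map g ts) = map (map g) (gap_parts S ts)"
  unfolding gap_parts_def using gap_autf[OF assms(1) _ assms(2)]
  by (auto simp: filter_map o_def simp del: upt_Suc intro!: arg_cong[of _ _ "map g"] filter_cong)

lemma gap_parts_cell:
  "sorted_wrt (<) ts \<Longrightarrow> gap_parts S ts \<in> cell S (map length (gap_parts S ts))"
  by (auto simp: gap_parts_def cell_def incr_def sorted_wrt_filter simp del: upt_Suc)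

lemma cls_eq_image:
  assumes "finite S" "sorted_wrt (<) ts"
  shows "cls S ts = {map g ts | g. g \<in> autf S}"
proof
  show "cls S ts \<subseteq> {map g ts | g. g \<in> autf S}"
    using autf_transport[OF assms] by (fastforce simp: cls_def)
  show "{map g ts | g. g \<in> autf S} \<subseteq> cls S ts"
    using assms(2) sametype_autf by (auto simp: cls_def sorted_wrt_map autf_less list_all2_conv_all_nth)
qed

lemma gap_parts_bij:
  assumes S: "finite S" and ts: "sorted_wrt (<) ts"
  shows "bij_betw (gap_parts S) (cls S ts) (cell S (map length (gap_parts S ts)))"
  unfolding bij_betw_def
proof
  show "inj_on (gap_parts S) (cls S ts)"
  proof (rule inj_onI)
    fix us vs assume u: "us \<in> cls S ts" and v: "vs \<in> cls S ts" and eq: "gap_parts S us = gap_parts S vs"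
    have "sorted_wrt (<) us" using u by (simp add: cls_def)
    \<comment> \<open>Two tuples of one orbit differ by some \<open>g\<close>; equal parts force
      \<open>g\<close> to fix every coordinate outside \<open>S\<close>, and those in
      \<open>S\<close> are fixed anyway.\<close>
    then obtain g where g: "g \<in> autf S" "vs = map g us"
      using v cls_eq[OF u] cls_eq_image[OF S, of us] by auto
    have "g w = w" if w: "w \<in> set us" for w
    proof (cases "w \<in> S")
      case True then show ?thesis using autf_fix[OF g(1)] by blast
    next
      case False
      define j where "j = card {s\<in>S. s < w}"
      have j: "j \<le> card S" "w \<in> gap S j" using False S by (auto simp: in_gap_iff card_below_le j_def)
      have "map g (gap_parts S us ! j) = gap_parts S us ! j"
        using eq g gap_parts_map[OF S g(1), of us] j(1)
        by (metis (no_types, lifting) gap_parts_def diff_zero le_imp_less_Suc length_map length_upt nth_map)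
      then have "map g (filter (\<lambda>u. u \<in> gap S j) us) = filter (\<lambda>u. u \<in> gap S j) us"
        using j(1) by (simp add: gap_parts_def del: upt_Suc)
      then show ?thesis using w j(2) by (auto simp: map_eq_conv[of g _ id, simplified])
    qed
    then show "us = vs" using g(2) by (simp add: map_idI)
  qed
  show "gap_parts S ` cls S ts = cell S (map length (gap_parts S ts))"
  proof
    show "gap_parts S ` cls S ts \<subseteq> cell S (map length (gap_parts S ts))"
    proof
      fix ps assume "ps \<in> gap_parts S ` cls S ts"
      then obtain g where g: "g \<in> autf S" "ps = gap_parts S (map g ts)" using cls_eq_image[OF assms] by auto
      have "map length (gap_parts S (map g ts)) = map length (gap_parts S ts)"
        using gap_parts_map[OF S g(1)] by simp
      then show "ps \<in> cell S (map length (gap_parts S ts))"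
        using gap_parts_cell[of "map g ts" S] g ts by (simp add: sorted_wrt_map autf_less)
    qed
    show "cell S (map length (gap_parts S ts)) \<subseteq> gap_parts S ` cls S ts"
    proof
      fix ps assume ps: "ps \<in> cell S (map length (gap_parts S ts))"
      have "length (map length (gap_parts S ts)) = Suc (card S)" by (simp add: gap_parts_def)
      from cell_transitive[OF S this gap_parts_cell[OF ts] ps] obtain g
        where "g \<in> autf S" "map (map g) (gap_parts S ts) = ps" by blast
      then show "ps \<in> gap_parts S ` cls S ts"
        using gap_parts_map[OF S, of g ts] cls_eq_image[OF assms] by (auto intro!: image_eqI[of _ _ "map g ts"])
    qed
  qed
qed

text \<open>A coordinate of \<open>ps\<close> missing from \<open>qs\<close> could be moved while
  \<open>S\<close> and all of \<open>qs\<close> stay fixed. Stabilizers thus determine the set of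
  coordinates.\<close>

lemma cell_fixed_subset:
  assumes S: "finite S" and n: "length ns = Suc (card S)" "length ms = Suc (card S)"
    and ps: "ps \<in> cell S ns" and qs: "qs \<in> cell S ms"
    and fix_imp: "\<And>g. g \<in> autf S \<Longrightarrow> map (map g) qs = qs \<Longrightarrow> map (map g) ps = ps"
  shows "set (concat ps) \<subseteq> set (concat qs)"
proof (rule ccontr)
  assume "\<not> set (concat ps) \<subseteq> set (concat qs)"
  then obtain p u where u: "p \<in> set ps" "u \<in> set p" "u \<notin> set (concat qs)" by auto
  have "u \<notin> S"
  proof -
    obtain j where "j < length ps" "p = ps ! j" using u(1) by (metis in_set_conv_nth)
    then have "u \<in> gap S j" "j \<le> card S" using u(2) ps n by (auto simp: cell_def incr_def)
    then show ?thesis using in_gap_iff[OF S] by blast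
  qed
  define F where "F = S \<union> set (concat qs)"
  have F: "finite F" "u \<notin> F" using S u(3) \<open>u \<notin> S\<close> by (auto simp: F_def)
  obtain d where d: "u < d" "F \<inter> {u..<d} = {}" using finite_gap_above[OF F] by blast
  obtain v where v: "u < v" "v < d" using dense d(1) by blast
  have "F \<inter> {u..v} = {}" using d v by (auto simp: disjoint_iff)
  then obtain g where g: "g \<in> autf F" "g u = v"
    using autf_move(1)[OF F(1), of u v] v by auto
  have "map (map g) qs = qs" using autf_fix[OF g(1)] by (auto simp: F_def intro!: map_idI)
  moreover have "g \<in> autf S" using g(1) autf_antimono[of S F] by (auto simp: F_def)
  ultimately have "map (map g) ps = ps" using fix_imp by blast
  then have "map g p = p" using u(1) by (simp add: map_eq_conv[of "map g" _ id, simplified])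
  then have "g u = u" using u(2) by (simp add: map_eq_conv[of g _ id, simplified])
  then show False using g v by simp
qed

text \<open>The two images of a point of \<open>Q\<close> have the same stabilizer, hence the same
  set of coordinates, and each exponent counts the coordinates in one gap.\<close>

lemma exponents_unique:
  assumes S: "finite S" and n: "length ns = Suc (card S)" "length ms = Suc (card S)" and Q: "Q \<noteq> {}"
    and cl: "\<And>g x. g \<in> autf S \<Longrightarrow> x \<in> Q \<Longrightarrow> act X g x \<in> Q"
    and i: "iso_to_cell X S Q ns" "iso_to_cell X S Q ms"
  shows "ns = ms"
proof -
  obtain x where x: "x \<in> Q" using Q by blast
  obtain f where f: "bij_betw f Q (cell S ns)" "\<And>g x. g \<in> autf S \<Longrightarrow> x \<in> Q \<Longrightarrow> f (act X g x) = map (map g) (f x)"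
    using i(1) by (auto simp: iso_to_cell_def carrier_aut_R_fix)
  obtain h where h: "bij_betw h Q (cell S ms)" "\<And>g x. g \<in> autf S \<Longrightarrow> x \<in> Q \<Longrightarrow> h (act X g x) = map (map g) (h x)"
    using i(2) by (auto simp: iso_to_cell_def carrier_aut_R_fix)
  have fx: "f x \<in> cell S ns" and hx: "h x \<in> cell S ms"
    using f(1) h(1) x by (auto simp: bij_betw_def)
  have ff: "map (map g) (f x) = f x \<longleftrightarrow> act X g x = x" if "g \<in> autf S" for g
    using f(2)[OF that x] cl[OF that x] x bij_betw_imp_inj_on[OF f(1)] by (metis inj_onD)
  have hh: "map (map g) (h x) = h x \<longleftrightarrow> act X g x = x" if "g \<in> autf S" for g
    using h(2)[OF that x] cl[OF that x] x bij_betw_imp_inj_on[OF h(1)] by (metis inj_onD)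
  have eq: "set (concat (f x)) = set (concat (h x))"
    using cell_fixed_subset[OF S n fx hx] cell_fixed_subset[OF S n(2,1) hx fx] ff hh by blast
  have part: "ns ! j = card (set (concat ps) \<inter> gap S j)" if "ps \<in> cell S ns" "length ns = Suc (card S)" "j < Suc (card S)" for ps ns j
  proof -
    have "set (concat ps) \<inter> gap S j = set (ps ! j)"
    proof
      show "set (concat ps) \<inter> gap S j \<subseteq> set (ps ! j)"
      proof
        fix u assume u: "u \<in> set (concat ps) \<inter> gap S j"
        then obtain p where "p \<in> set ps" "u \<in> set p" by auto
        then obtain k where k: "k < length ps" "u \<in> set (ps ! k)" by (metis in_set_conv_nth)
        then have "u \<in> gap S k" using that(1) by (auto simp: cell_def incr_def)
        then have "k = j" using u k that in_gap_iff[OF S] by (auto simp: cell_def)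
        then show "u \<in> set (ps ! j)" using k by simp
      qed
      show "set (ps ! j) \<subseteq> set (concat ps) \<inter> gap S j"
      proof -
        have "ps ! j \<in> set ps" "set (ps ! j) \<subseteq> gap S j" using that by (auto simp: cell_def incr_def)
        then show ?thesis by auto
      qed
    qed
    moreover have "distinct (ps ! j)" "length (ps ! j) = ns ! j"
      using that by (auto simp: cell_def incr_def strict_sorted_iff)
    ultimately show ?thesis by (simp add: distinct_card)
  qed
  show ?thesis
    by (rule nth_equalityI) (use n part[OF fx n(1)] part[OF hx n(2)] eq in auto)
qed

section \<open>The measure of an orbit as a product over the coordinates\<close>

lemma sum_length_gap_parts:
  assumes "finite S"
  shows "sum_list (map length (gap_parts S ts)) = length (filter (\<lambda>u. u \<notin> S) ts)"
proof (induction ts)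
  case Nil then show ?case by (simp add: gap_parts_def o_def sum_list_triv del: upt_Suc)
next
  case (Cons t ts)
  have e: "sum_list (map length (gap_parts S us)) = (\<Sum>j\<in>{0..<Suc (card S)}. length (filter (\<lambda>u. u \<in> gap S j) us))" for us
    by (simp add: gap_parts_def o_def interv_sum_list_conv_sum_set_nat del: upt_Suc)
  have "(\<Sum>j\<in>{0..<Suc (card S)}. length (filter (\<lambda>u. u \<in> gap S j) (t # ts))) =
     (\<Sum>j\<in>{0..<Suc (card S)}. (if card {s\<in>S. s < t} = j then of_bool (t \<notin> S) else 0) + length (filter (\<lambda>u. u \<in> gap S j) ts))"
    by (rule sum.cong) (use assms in \<open>auto simp: in_gap_iff\<close>)
  also have "\<dots> = of_bool (t \<notin> S) + (\<Sum>j\<in>{0..<Suc (card S)}. length (filter (\<lambda>u. u \<in> gap S j) ts))"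
    using card_below_le[OF assms, of t] by (simp only: sum.distrib sum.delta' finite_atLeastLessThan) auto
  finally show ?case using Cons e by simp
qed

lemma pmeas_prod:
  assumes "finite S"
  shows "(\<Prod>t\<leftarrow>ts. pmeas S t) = (if filter (\<lambda>u. u \<in> gap S (card S)) ts = [] then (- 1) ^ length (filter (\<lambda>u. u \<notin> S) ts) else (0::'k::field))"
proof (induction ts)
  case (Cons t ts)
  have "t \<in> gap S (card S) \<longleftrightarrow> t \<notin> S \<and> \<not> (\<exists>s\<in>S. t < s)"
  proof -
    have "card {s\<in>S. s < t} = card S \<longleftrightarrow> {s\<in>S. s < t} = S"
    proof
      show "{s\<in>S. s < t} = S" if "card {s\<in>S. s < t} = card S"
        by (rule card_subset_eq[OF assms _ that]) blast
    qed (rule arg_cong[of _ _ card])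
    moreover have "{s\<in>S. s < t} = S \<longleftrightarrow> (\<forall>s\<in>S. s < t)" by auto
    ultimately have "t \<in> gap S (card S) \<longleftrightarrow> t \<notin> S \<and> (\<forall>s\<in>S. s < t)"
      by (simp add: in_gap_iff[OF assms order_refl])
    moreover have "s < t \<longleftrightarrow> \<not> t < s" if "t \<notin> S" "s \<in> S" for s
      using that by (cases s t rule: linorder_cases) auto
    ultimately show ?thesis by blast
  qed
  then show ?case using Cons by (auto simp: pmeas_def)
qed simp

text \<open>The inverse chart followed by \<open>gap_parts\<close> is an isomorphism of the kind
  required in \<open>exponents\<close>, and uniqueness evaluates the definite description
  there.\<close>

lemma mu2_chart:
  assumes c: "chart X Q n f" and S: "finite S" and ts: "ts \<in> incr UNIV n"
  shows "mu2 X S (f ` cls S ts) = (\<Prod>t\<leftarrow>ts. pmeas S t)"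
proof -
  have st: "sorted_wrt (<) ts" "length ts = n" using ts by (auto simp: incr_UNIV)
  have sub: "cls S ts \<subseteq> incr UNIV n" using st by (auto simp: cls_def incr_UNIV dest: list_all2_lengthD)
  have inj: "inj_on f (incr UNIV n)" using c by (auto simp: chart_def bij_betw_def)
  define ns where "ns = map length (gap_parts S ts)"
  define h where "h = gap_parts S \<circ> the_inv_into (incr UNIV n) f"
  have hf: "h (f us) = gap_parts S us" if "us \<in> incr UNIV n" for us
    using the_inv_into_f_f[OF inj that] by (simp add: h_def)
  have eqv: "act X g (f us) = f (map g us)" if "g \<in> autf S" "us \<in> incr UNIV n" for g us
    using c that autf_empty by (auto simp: chart_def)
  have clm: "map g us \<in> cls S ts" if "g \<in> autf S" "us \<in> cls S ts" for g us
    using that cls_eq_image[OF S, of us] cls_eq[OF that(2)] by (auto simp: cls_def)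
  have "bij_betw h (f ` cls S ts) (cell S ns)"
    unfolding bij_betw_def
  proof
    show "inj_on h (f ` cls S ts)"
      using hf sub bij_betw_imp_inj_on[OF gap_parts_bij[OF S st(1)]]
      by (intro inj_onI) (auto dest: inj_onD simp: subset_iff)
    have "h ` f ` cls S ts = gap_parts S ` cls S ts" using hf sub by (force simp: image_iff)
    then show "h ` f ` cls S ts = cell S ns" using gap_parts_bij[OF S st(1)] by (simp add: bij_betw_def ns_def)
  qed
  moreover have "h (act X g x) = map (map g) (h x)" if "g \<in> autf S" "x \<in> f ` cls S ts" for g x
    using that eqv hf sub gap_parts_map[OF S that(1)] incr_map[OF that(1)] by (auto simp: subset_iff)
  ultimately have iso: "iso_to_cell X S (f ` cls S ts) ns"
    unfolding iso_to_cell_def carrier_aut_R_fix by blast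
  have len: "length ns = Suc (card S)" by (simp add: ns_def gap_parts_def)
  have ne: "f ` cls S ts \<noteq> {}" using st by (auto simp: cls_def list_all2_refl)
  have "exponents X S (f ` cls S ts) = ns"
    unfolding exponents_def
  proof (rule the_equality)
    fix ms assume "length ms = Suc (card S) \<and> iso_to_cell X S (f ` cls S ts) ms"
    moreover have "act X g x \<in> f ` cls S ts" if "g \<in> autf S" "x \<in> f ` cls S ts" for g x
      using that eqv clm sub by auto
    ultimately show "ms = ns" using exponents_unique[OF S _ len ne _ _ iso] by blast
  qed (use iso len in blast)
  moreover have "last ns = 0 \<longleftrightarrow> filter (\<lambda>u. u \<in> gap S (card S)) ts = []"
    by (simp add: ns_def gap_parts_def)
  moreover have "sum_list ns = length (filter (\<lambda>u. u \<notin> S) ts)"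
    using sum_length_gap_parts[OF S] by (simp add: ns_def)
  ultimately show ?thesis by (simp add: mu2_def Let_def pmeas_prod[OF S])
qed

section \<open>The integral over a set with action\<close>

text \<open>A class is determined by finitely many data: for each coordinate, the set of points of
  \<open>S\<close> below it and the set of those equal to it.\<close>

lemma finite_cls: assumes "finite S" shows "finite (cls S ` incr UNIV n)"
proof -
  define ty where "ty ts = map (\<lambda>u. ({s\<in>S. s < u}, {s\<in>S. s = u})) ts" for ts
  define rep where "rep q = (SOME t. t \<in> incr UNIV n \<and> cls S t = q)" for q
  have rep: "rep q \<in> incr UNIV n \<and> cls S (rep q) = q" if "q \<in> cls S ` incr UNIV n" for q
    unfolding rep_def by (rule someI_ex) (use that in blast)
  have "ty ts \<in> {xs. set xs \<subseteq> Pow S \<times> Pow S \<and> length xs = n}" if "ts \<in> incr UNIV n" for ts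
    using that by (auto simp: ty_def incr_UNIV)
  moreover have "finite {xs. set xs \<subseteq> Pow S \<times> Pow S \<and> length xs = n}"
    using assms by (intro finite_lists_length_eq) simp
  moreover have "inj_on (\<lambda>q. ty (rep q)) (cls S ` incr UNIV n)"
  proof (rule inj_onI)
    fix q r assume q: "q \<in> cls S ` incr UNIV n" and r: "r \<in> cls S ` incr UNIV n" and eq: "ty (rep q) = ty (rep r)"
    have len: "length (rep q) = length (rep r)" using rep[OF q] rep[OF r] by (simp add: incr_UNIV)
    have "sametype S (rep q ! i) (rep r ! i)" if "i < length (rep q)" for i
    proof -
      have "ty (rep q) ! i = ty (rep r) ! i" using eq by simp
      then show ?thesis using that len by (auto simp: ty_def sametype_def)
    qed
    then have "rep r \<in> cls S (rep q)"
      using len rep[OF r] by (auto simp: cls_def incr_UNIV list_all2_conv_all_nth)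
    then show "q = r" using cls_eq rep[OF q] rep[OF r] by metis
  qed
  moreover from calculation(1) have "(\<lambda>q. ty (rep q)) ` cls S ` incr UNIV n \<subseteq> {xs. set xs \<subseteq> Pow S \<times> Pow S \<and> length xs = n}"
    using rep by blast
  ultimately show ?thesis by (meson finite_imageD finite_subset)
qed

lemma in_cls_self: "ts \<in> incr UNIV n \<Longrightarrow> ts \<in> cls S ts"
  by (simp add: cls_def incr_UNIV list_all2_refl)

lemma cls_subset_incr: "ts \<in> incr UNIV n \<Longrightarrow> cls S ts \<subseteq> incr UNIV n"
  by (auto simp: cls_def incr_UNIV dest: list_all2_lengthD)

lemma ltame_cls: "finite S \<Longrightarrow> ltame S (\<lambda>us. of_bool (us \<in> cls S ts))"
proof (rule ltameI)
  fix g us assume g: "g \<in> autf S"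
  have "list_all2 (sametype S) us (map g us)"
    using sametype_autf[OF g] by (simp add: list_all2_conv_all_nth)
  then have "list_all2 (sametype S) ts (map g us) \<longleftrightarrow> list_all2 (sametype S) ts us"
    using list_all2_sametype_trans list_all2_sametype_sym by blast
  then show "of_bool (map g us \<in> cls S ts) = of_bool (us \<in> cls S ts)"
    using g by (simp add: cls_def sorted_wrt_map autf_less)
qed

lemma ltame_cls_const:
  assumes "ltame S \<phi>" "sorted_wrt (<) ts" "us \<in> cls S ts"
  shows "\<phi> us = \<phi> ts"
  using assms cls_eq_image[of S ts] by (auto simp: ltame_def)

text \<open>A function with this symmetry is a finite combination of indicators of orbits, whose
  integrals are given by \<open>euler_cls\<close>.\<close>

lemma euler_as_sum:
  assumes t: "ltame S \<phi>" and supp: "\<And>ts. ts \<notin> incr UNIV n \<Longrightarrow> \<phi> ts = 0"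
    and rep: "\<And>q. q \<in> cls S ` incr UNIV n \<Longrightarrow> rep q \<in> q"
  shows "euler n \<phi> = (\<Sum>q\<in>cls S ` incr UNIV n. \<phi> (rep q) * (\<Prod>t\<leftarrow>rep q. pmeas S t))"
proof -
  define C where "C = cls S ` incr UNIV n"
  have fS: "finite S" using t by (simp add: ltame_def)
  have fC: "finite C" unfolding C_def using finite_cls[OF fS] .
  have C: "\<exists>ts\<in>incr UNIV n. q = cls S ts" if "q \<in> C" for q using that by (auto simp: C_def)
  have rp: "rep q \<in> incr UNIV n" "q = cls S (rep q)" if q: "q \<in> C" for q
  proof -
    obtain ts where ts: "ts \<in> incr UNIV n" "q = cls S ts" using C[OF q] by blast
    show "rep q \<in> incr UNIV n" "q = cls S (rep q)"
      using rep[of q] q ts cls_eq[of "rep q" S ts] cls_subset_incr[OF ts(1)] by (auto simp: C_def)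
  qed
  have e: "\<phi> us = (\<Sum>q\<in>C. \<phi> (rep q) * of_bool (us \<in> q))" for us
  proof (cases "us \<in> incr UNIV n")
    case True
    have "us \<in> q \<longleftrightarrow> q = cls S us" if "q \<in> C" for q
      using rp[OF that] cls_eq[of us S "rep q"] in_cls_self[OF True] by metis
    then have "(\<Sum>q\<in>C. \<phi> (rep q) * of_bool (us \<in> q)) = (\<Sum>q\<in>C. if q = cls S us then \<phi> (rep q) else 0)"
      by (intro sum.cong) auto
    also have "\<dots> = \<phi> (rep (cls S us))"
      using fC True by (simp add: C_def)
    also have "\<dots> = \<phi> us"
      using ltame_cls_const[OF t] rep[of "cls S us"] True by (auto simp: incr_UNIV)
    finally show ?thesis by simp
  next
    case False
    then have "us \<notin> q" if "q \<in> C" for q using C[OF that] cls_subset_incr by blast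
    then have "(\<Sum>q\<in>C. \<phi> (rep q) * of_bool (us \<in> q)) = 0" by (intro sum.neutral) auto
    then show ?thesis using supp[OF False] by simp
  qed
  have "euler n \<phi> = euler n (\<lambda>us. \<Sum>q\<in>C. \<phi> (rep q) * of_bool (us \<in> q))"
    by (rule euler_cong) (rule e)
  also have "\<dots> = (\<Sum>q\<in>C. \<phi> (rep q) * euler n (\<lambda>us. of_bool (us \<in> q)))"
    using C ltame_cls[OF fS] by (intro euler_sum[OF fS]) auto
  also have "\<dots> = (\<Sum>q\<in>C. \<phi> (rep q) * (\<Prod>t\<leftarrow>rep q. pmeas S t))"
  proof (rule sum.cong)
    fix q assume q: "q \<in> C"
    have "length (rep q) = n" "sorted_wrt (<) (rep q)" using rp(1)[OF q] by (auto simp: incr_UNIV)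
    then have "euler n (\<lambda>us. of_bool (us \<in> cls S (rep q))) = (\<Prod>t\<leftarrow>rep q. pmeas S t :: 'a)"
      using euler_cls[OF fS] by blast
    then show "\<phi> (rep q) * euler n (\<lambda>us. of_bool (us \<in> q)) = \<phi> (rep q) * (\<Prod>t\<leftarrow>rep q. pmeas S t)"
      using rp(2)[OF q] by simp
  qed simp
  finally show ?thesis by (simp add: C_def)
qed

definition in_chart :: "nat \<Rightarrow> (real list \<Rightarrow> 'x) \<Rightarrow> ('x \<Rightarrow> 'k::field) \<Rightarrow> real list \<Rightarrow> 'k" where
  "in_chart n f \<phi> ts = (if ts \<in> incr UNIV n then \<phi> (f ts) else 0)"

definition charts :: "'x gset \<Rightarrow> ('x set \<Rightarrow> nat) \<Rightarrow> ('x set \<Rightarrow> real list \<Rightarrow> 'x) \<Rightarrow> bool" where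
  "charts X N f \<longleftrightarrow> gset X \<and> (\<forall>Q\<in>orbits aut_R (pts X) (act X). chart X Q (N Q) (f Q))"

lemma chart_in: "chart X Q n f \<Longrightarrow> ts \<in> incr UNIV n \<Longrightarrow> f ts \<in> Q"
  by (auto simp: chart_def bij_betw_def)

lemma chart_surj:
  assumes "chart X Q n f" "y \<in> Q"
  obtains ts where "ts \<in> incr UNIV n" "f ts = y"
proof -
  have "y \<in> f ` incr UNIV n" using assms by (simp add: chart_def bij_betw_def)
  then show ?thesis using that by blast
qed

lemma chart_inj: "chart X Q n f \<Longrightarrow> inj_on f (incr UNIV n)"
  by (auto simp: chart_def bij_betw_def)

abbreviation aut_orbits :: "'x gset \<Rightarrow> 'x set set" where
  "aut_orbits X \<equiv> orbits aut_R (pts X) (act X)"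

lemma aut_orbit_subset: assumes "gset X" "Q \<in> aut_orbits X" shows "Q \<subseteq> pts X"
proof -
  obtain x where "x \<in> pts X" "Q = {act X g x | g. g \<in> autf {}}"
    using assms(2) unfolding orbits_def orbit_aut_R by blast
  then show ?thesis using gset_act_closed[OF assms(1)] by blast
qed

lemma aut_orbits_cover: assumes "gset X" "x \<in> pts X" shows "\<exists>Q\<in>aut_orbits X. x \<in> Q"
proof -
  have "act X id x = x" using gset_act_id[OF assms] .
  then have "x \<in> orbit aut_R (act X) x" unfolding orbit_aut_R using autf_id(1)[of "{}"] by (auto intro!: exI[of _ id])
  then show ?thesis using assms(2) unfolding orbits_def by blast
qed

lemma aut_orbits_disjoint:
  assumes "gset X" "Q \<in> aut_orbits X" "R \<in> aut_orbits X" "x \<in> Q" "x \<in> R"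
  shows "Q = R"
proof -
  have "group_action aut_R (pts X) (act X)" using assms(1) by (simp add: gset_def)
  then have "partition (pts X) (aut_orbits X)" by (rule group_action.orbit_partition)
  moreover have "x \<in> pts X" using aut_orbit_subset[OF assms(1,2)] assms(4) by blast
  ultimately show ?thesis using partition.unique_class[of "pts X" "aut_orbits X" x] assms by auto
qed

lemma ltame_in_chart:
  assumes "chart X Q n f" "finite S" "invariant_fun X S \<phi>" "Q \<subseteq> pts X"
  shows "ltame S (in_chart n f \<phi>)"
proof (rule ltameI[OF assms(2)])
  fix g ts assume g: "g \<in> autf S"
  show "in_chart n f \<phi> (map g ts) = in_chart n f \<phi> ts"
  proof (cases "ts \<in> incr UNIV n")
    case True
    then have "f ts \<in> pts X" using assms(1,4) by (auto simp: chart_def bij_betw_def)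
    moreover have "f (map g ts) = act X g (f ts)" using assms(1) True autf_empty[OF g] by (simp add: chart_def)
    ultimately show ?thesis using assms(3) g incr_map[OF g]
      by (simp add: in_chart_def invariant_fun_def carrier_aut_R_fix)
  qed (use incr_map[OF g] in \<open>simp add: in_chart_def\<close>)
qed

lemma fix_orbits_eq:
  assumes ch: "charts X N f" and S: "finite S"
  shows "orbits (aut_R_fix S) (pts X) (act X) = (\<lambda>(Q, q). f Q ` q) ` (SIGMA Q:aut_orbits X. cls S ` incr UNIV (N Q))"
proof -
  have X: "gset X" using ch by (simp add: charts_def)
  have img: "orbit (aut_R_fix S) (act X) (f Q ts) = f Q ` cls S ts" if "Q \<in> aut_orbits X" "ts \<in> incr UNIV (N Q)" for Q ts
  proof -
    have "chart X Q (N Q) (f Q)" using ch that(1) by (simp add: charts_def)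
    then have eqv: "act X g (f Q ts) = f Q (map g ts)" if "g \<in> autf S" for g
      using that \<open>ts \<in> _\<close> autf_empty by (simp add: chart_def)
    have "cls S ts = {map g ts | g. g \<in> autf S}" using cls_eq_image[OF S] that(2) by (simp add: incr_UNIV)
    then have "f Q ` cls S ts = (\<lambda>g. f Q (map g ts)) ` autf S" by auto
    also have "\<dots> = (\<lambda>g. act X g (f Q ts)) ` autf S" using eqv by (intro image_cong) auto
    finally show ?thesis by (auto simp: orbit_aut_R_fix)
  qed
  show ?thesis
  proof (intro equalityI subsetI)
    fix q assume "q \<in> orbits (aut_R_fix S) (pts X) (act X)"
    then obtain x where x: "x \<in> pts X" "q = orbit (aut_R_fix S) (act X) x" by (auto simp: orbits_def)
    obtain Q where Q: "Q \<in> aut_orbits X" "x \<in> Q" using aut_orbits_cover[OF X x(1)] by blast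
    then have "chart X Q (N Q) (f Q)" using ch by (simp add: charts_def)
    then obtain ts where "ts \<in> incr UNIV (N Q)" "f Q ts = x" using Q(2) by (rule chart_surj)
    then show "q \<in> (\<lambda>(Q, q). f Q ` q) ` (SIGMA Q:aut_orbits X. cls S ` incr UNIV (N Q))"
      using img Q(1) x(2) by (auto intro!: image_eqI[of _ _ "(Q, cls S ts)"])
  next
    fix q assume "q \<in> (\<lambda>(Q, q). f Q ` q) ` (SIGMA Q:aut_orbits X. cls S ` incr UNIV (N Q))"
    then obtain Q ts where Q: "Q \<in> aut_orbits X" "ts \<in> incr UNIV (N Q)" "q = f Q ` cls S ts" by auto
    then have "chart X Q (N Q) (f Q)" using ch by (simp add: charts_def)
    then have "f Q ts \<in> pts X" using Q aut_orbit_subset[OF X Q(1)] by (auto simp: chart_def bij_betw_def)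
    then show "q \<in> orbits (aut_R_fix S) (pts X) (act X)" using img[OF Q(1,2)] Q(3) unfolding orbits_def by blast
  qed
qed

text \<open>The right-hand side does not mention \<open>S\<close>. This is the independence of the
  choice of \<open>S\<close>, and it allows the arbitrary set chosen in \<open>gset_integral\<close>
  to be forgotten.\<close>

lemma integral_over_charts:
  assumes ch: "charts X N f" and S: "finite S" and inv: "invariant_fun X S \<phi>"
  shows "integral_over X S \<phi> = (\<Sum>Q\<in>aut_orbits X. euler (N Q) (in_chart (N Q) (f Q) \<phi>))"
proof -
  have X: "gset X" using ch by (simp add: charts_def)
  let ?C = "\<lambda>Q. cls S ` incr UNIV (N Q)"
  have c: "chart X Q (N Q) (f Q)" if "Q \<in> aut_orbits X" for Q using ch that by (simp add: charts_def)
  have bij: "bij_betw (f Q) (incr UNIV (N Q)) Q" if "Q \<in> aut_orbits X" for Q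
    using c[OF that] by (simp add: chart_def)
  have Csub: "q \<subseteq> incr UNIV (N Q)" "q \<noteq> {}" if "q \<in> ?C Q" for q Q
    using that cls_subset_incr in_cls_self by blast+
  have inj: "inj_on (\<lambda>(Q, q). f Q ` q) (SIGMA Q:aut_orbits X. ?C Q)"
  proof (rule inj_onI, clarify)
    fix Q us R vs assume Q: "Q \<in> aut_orbits X" and R: "R \<in> aut_orbits X"
      and u: "us \<in> incr UNIV (N Q)" and v: "vs \<in> incr UNIV (N R)" and eq: "f Q ` cls S us = f R ` cls S vs"
    have us: "f Q us \<in> f Q ` cls S us" using in_cls_self[OF u] by blast
    have "f Q ` cls S us \<subseteq> Q" "f R ` cls S vs \<subseteq> R"
      using chart_in[OF c[OF Q]] chart_in[OF c[OF R]] cls_subset_incr[OF u, of S] cls_subset_incr[OF v, of S] by blast+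
    then have "Q = R" using aut_orbits_disjoint[OF X Q R, of "f Q us"] us eq by blast
    moreover have "cls S us = cls S vs"
      using eq cls_subset_incr[OF u] cls_subset_incr[OF v] chart_inj[OF c[OF Q]] \<open>Q = R\<close>
      by (simp add: inj_on_image_eq_iff)
    ultimately show "Q = R \<and> cls S us = cls S vs" by blast
  qed
  have "integral_over X S \<phi> = (\<Sum>(Q, q)\<in>(SIGMA Q:aut_orbits X. ?C Q). \<phi> (SOME x. x \<in> f Q ` q) * mu2 X S (f Q ` q))"
    unfolding integral_over_def fix_orbits_eq[OF ch S] by (subst sum.reindex[OF inj]) (auto intro!: sum.cong)
  also have "\<dots> = (\<Sum>Q\<in>aut_orbits X. \<Sum>q\<in>?C Q. \<phi> (SOME x. x \<in> f Q ` q) * mu2 X S (f Q ` q))"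
    using X finite_cls[OF S] by (intro sum.Sigma[symmetric]) (auto simp: gset_def)
  also have "\<dots> = (\<Sum>Q\<in>aut_orbits X. euler (N Q) (in_chart (N Q) (f Q) \<phi>))"
  proof (rule sum.cong)
    fix Q assume Q: "Q \<in> aut_orbits X"
    define rep where "rep q = (SOME t. t \<in> q)" for q :: "real list set"
    have rep: "rep q \<in> q" if "q \<in> ?C Q" for q
      unfolding rep_def using Csub(2)[OF that] by (simp add: some_in_eq)
    have t: "ltame S (in_chart (N Q) (f Q) \<phi>)"
      using ltame_in_chart[OF c[OF Q] S inv aut_orbit_subset[OF X Q]] .
    have "\<phi> (SOME x. x \<in> f Q ` q) * mu2 X S (f Q ` q) = in_chart (N Q) (f Q) \<phi> (rep q) * (\<Prod>t\<leftarrow>rep q. pmeas S t)"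
      if q: "q \<in> ?C Q" for q
    proof -
      have r: "rep q \<in> incr UNIV (N Q)" using rep[OF q] Csub(1)[OF q] by blast
      have qr: "q = cls S (rep q)" using q rep[OF q] cls_eq by auto
      have "(SOME x. x \<in> f Q ` q) \<in> f Q ` q" using Csub(2)[OF q] by (simp add: some_in_eq)
      then obtain us where us: "us \<in> q" "(SOME x. x \<in> f Q ` q) = f Q us" by blast
      have "in_chart (N Q) (f Q) \<phi> us = in_chart (N Q) (f Q) \<phi> (rep q)"
        using ltame_cls_const[OF t, of "rep q" us] r us(1) qr by (simp add: incr_UNIV)
      moreover have "us \<in> incr UNIV (N Q)" using us(1) Csub(1)[OF q] by blast
      moreover have "mu2 X S (f Q ` cls S (rep q)) = (\<Prod>t\<leftarrow>rep q. pmeas S t :: 'b)"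
        by (rule mu2_chart[OF c[OF Q] S r])
      ultimately show ?thesis using us(2) qr by (simp add: in_chart_def)
    qed
    then show "(\<Sum>q\<in>?C Q. \<phi> (SOME x. x \<in> f Q ` q) * mu2 X S (f Q ` q)) = euler (N Q) (in_chart (N Q) (f Q) \<phi>)"
      using rep by (subst euler_as_sum[OF t, where rep=rep]) (auto simp: in_chart_def intro!: sum.cong)
  qed simp
  finally show ?thesis .
qed

definition integrable :: "'x gset \<Rightarrow> ('x \<Rightarrow> 'k) \<Rightarrow> bool" where
  "integrable X \<phi> \<longleftrightarrow> (\<exists>S. finite S \<and> invariant_fun X S \<phi>)"

lemma gset_integral_charts:
  assumes ch: "charts X N f" and inv: "integrable X \<phi>"
  shows "gset_integral X \<phi> = (\<Sum>Q\<in>aut_orbits X. euler (N Q) (in_chart (N Q) (f Q) \<phi>))"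
proof -
  have "finite (SOME S. finite S \<and> invariant_fun X S \<phi>) \<and> invariant_fun X (SOME S. finite S \<and> invariant_fun X S \<phi>) \<phi>"
    by (rule someI_ex) (use inv in \<open>simp add: integrable_def\<close>)
  then show ?thesis unfolding gset_integral_def by (intro integral_over_charts[OF ch]) auto
qed

lemma charts_obtain: assumes "gset X" obtains N f where "charts X N f"
  using charts_exist[OF assms] assms unfolding charts_def by metis

lemma invariant_fun_mono: "invariant_fun X S \<phi> \<Longrightarrow> S \<subseteq> T \<Longrightarrow> invariant_fun X T \<phi>"
  using autf_antimono[of S T] by (auto simp: invariant_fun_def carrier_aut_R_fix)

lemma integrable_common:
  assumes "integrable X \<phi>" "integrable X \<psi>"
  obtains S where "finite S" "invariant_fun X S \<phi>" "invariant_fun X S \<psi>"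
proof -
  obtain S T where "finite S" "invariant_fun X S \<phi>" "finite T" "invariant_fun X T \<psi>"
    using assms by (auto simp: integrable_def)
  then show ?thesis using that[of "S \<union> T"] invariant_fun_mono[of X S \<phi> "S \<union> T"] invariant_fun_mono[of X T \<psi> "S \<union> T"] by auto
qed

section \<open>Linearity, invariance and interchange for the integral over a set with action\<close>

lemma gset_integral_linear:
  assumes X: "gset X" and i: "integrable X \<phi>" "integrable X \<psi>"
  shows "gset_integral X (\<lambda>x. c * \<phi> x + \<psi> x) = c * gset_integral X \<phi> + gset_integral X \<psi>"
    "integrable X (\<lambda>x. c * \<phi> x + \<psi> x)"
proof -
  obtain N f where ch: "charts X N f" using charts_obtain[OF X] .
  obtain S where S: "finite S" "invariant_fun X S \<phi>" "invariant_fun X S \<psi>" using integrable_common[OF i] .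
  then have S': "invariant_fun X S (\<lambda>x. c * \<phi> x + \<psi> x)" by (simp add: invariant_fun_def)
  then show int: "integrable X (\<lambda>x. c * \<phi> x + \<psi> x)" using S(1) by (auto simp: integrable_def)
  have "euler (N Q) (in_chart (N Q) (f Q) (\<lambda>x. c * \<phi> x + \<psi> x)) =
    c * euler (N Q) (in_chart (N Q) (f Q) \<phi>) + euler (N Q) (in_chart (N Q) (f Q) \<psi>)" if "Q \<in> aut_orbits X" for Q
  proof -
    have "chart X Q (N Q) (f Q)" "Q \<subseteq> pts X" using ch that aut_orbit_subset[OF X that] by (auto simp: charts_def)
    then have "ltame S (in_chart (N Q) (f Q) \<phi>)" "ltame S (in_chart (N Q) (f Q) \<psi>)"
      using ltame_in_chart S by metis+
    from euler_linear[OF this, of "N Q" c] show ?thesis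
      by (simp add: in_chart_def[abs_def] if_distrib cong: if_cong)
  qed
  then show "gset_integral X (\<lambda>x. c * \<phi> x + \<psi> x) = c * gset_integral X \<phi> + gset_integral X \<psi>"
    unfolding gset_integral_charts[OF ch i(1)] gset_integral_charts[OF ch i(2)] gset_integral_charts[OF ch int]
    by (simp add: sum.distrib sum_distrib_left)
qed

lemma integrable_zero [simp]: "integrable X (\<lambda>_. c)"
  by (auto simp: integrable_def invariant_fun_def)

lemma gset_integral_zero: assumes "gset (X :: 'a gset)" shows "gset_integral X (\<lambda>_. 0) = (0 :: 'b::field)"
proof -
  obtain N f where ch: "charts X N f" using charts_obtain[OF assms] .
  have e: "in_chart n f (\<lambda>_. 0) = (\<lambda>_. 0 :: 'b)" for n and f :: "real list \<Rightarrow> 'a" by (simp add: in_chart_def fun_eq_iff)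
  show ?thesis by (simp add: gset_integral_charts[OF ch integrable_zero] e)
qed

lemma gset_integral_cong: "gset X \<Longrightarrow> (\<And>x. x \<in> pts X \<Longrightarrow> \<phi> x = \<psi> x) \<Longrightarrow> integrable X \<phi> \<Longrightarrow> gset_integral X \<phi> = gset_integral X \<psi>"
proof -
  assume X: "gset X" and eq: "\<And>x. x \<in> pts X \<Longrightarrow> \<phi> x = \<psi> x" and i: "integrable X \<phi>"
  then have i': "integrable X \<psi>"
    using gset_act_closed[OF X] autf_empty by (fastforce simp: integrable_def invariant_fun_def carrier_aut_R_fix)
  obtain N f where ch: "charts X N f" using charts_obtain[OF X] .
  have "in_chart (N Q) (f Q) \<phi> = in_chart (N Q) (f Q) \<psi>" if "Q \<in> aut_orbits X" for Q
    using ch that aut_orbit_subset[OF X that] eq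
    by (fastforce simp: in_chart_def fun_eq_iff charts_def chart_def bij_betw_def)
  then show "gset_integral X \<phi> = gset_integral X \<psi>"
    unfolding gset_integral_charts[OF ch i] gset_integral_charts[OF ch i'] by simp
qed

lemma gset_integral_act:
  assumes X: "gset X" and g: "g \<in> autf {}" and i: "integrable X \<phi>"
  shows "gset_integral X (\<lambda>x. \<phi> (act X g x)) = gset_integral X \<phi>"
proof -
  obtain N f where ch: "charts X N f" using charts_obtain[OF X] .
  obtain S where S: "finite S" "invariant_fun X S \<phi>" using i by (auto simp: integrable_def)
  \<comment> \<open>Composition with \<open>g\<close> conjugates the symmetry, so the preimage of
    \<open>S\<close> under \<open>g\<close> takes the place of \<open>S\<close>.\<close>
  have "invariant_fun X (finv g ` S) (\<lambda>x. \<phi> (act X g x))"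
    unfolding invariant_fun_def carrier_aut_R_fix
  proof (intro ballI)
    fix h x assume h: "h \<in> autf (finv g ` S)" and x: "x \<in> pts X"
    have hh: "h \<in> autf {}" using autf_empty[OF h] .
    define k where "k = g \<circ> (h \<circ> finv g)"
    have k: "k \<in> autf {}" using g hh autf_inv[OF g] autf_comp by (simp add: k_def)
    moreover have "k s = s" if "s \<in> S" for s
      using autf_fix[OF h, of "finv g s"] that autf_inv_simps(2)[OF g] by (simp add: k_def)
    ultimately have kS: "k \<in> autf S" by (auto simp: autf_def)
    have "g \<circ> h = k \<circ> g" by (auto simp: k_def fun_eq_iff autf_inv_simps[OF g])
    then have "act X g (act X h x) = act X k (act X g x)"
      using gset_act_comp[OF X g hh x] gset_act_comp[OF X k g x] by simp
    then show "\<phi> (act X g (act X h x)) = \<phi> (act X g x)"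
      using S(2) kS gset_act_closed[OF X g x] by (simp add: invariant_fun_def carrier_aut_R_fix)
  qed
  then have i': "integrable X (\<lambda>x. \<phi> (act X g x))" using S(1) by (auto simp: integrable_def)
  have "euler (N Q) (in_chart (N Q) (f Q) (\<lambda>x. \<phi> (act X g x))) = euler (N Q) (in_chart (N Q) (f Q) \<phi>)" if "Q \<in> aut_orbits X" for Q
  proof -
    have "in_chart (N Q) (f Q) (\<lambda>x. \<phi> (act X g x)) = (\<lambda>ts. in_chart (N Q) (f Q) \<phi> (map g ts))"
      using ch that g incr_map[OF g] by (auto simp: in_chart_def fun_eq_iff charts_def chart_def)
    then show ?thesis using euler_map[OF g] by simp
  qed
  then show ?thesis unfolding gset_integral_charts[OF ch i] gset_integral_charts[OF ch i'] by simp
qed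

lemma gset_integral_delta:
  assumes X: "gset X" and y: "y \<in> pts X" and i: "integrable X (\<lambda>x. of_bool (x = y) * \<phi> x)"
  shows "gset_integral X (\<lambda>x. of_bool (x = y) * \<phi> x) = \<phi> y"
proof -
  obtain N f where ch: "charts X N f" using charts_obtain[OF X] .
  obtain R where R: "R \<in> aut_orbits X" "y \<in> R" using aut_orbits_cover[OF X y] by blast
  have c: "chart X R (N R) (f R)" using ch R(1) by (simp add: charts_def)
  then obtain us where us: "us \<in> incr UNIV (N R)" "f R us = y"
    using R(2) by (rule chart_surj)
  note inj = chart_inj[OF c]
  have "euler (N Q) (in_chart (N Q) (f Q) (\<lambda>x. of_bool (x = y) * \<phi> x)) = (if Q = R then \<phi> y else 0)" if Q: "Q \<in> aut_orbits X" for Q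
  proof (cases "Q = R")
    case True
    have "in_chart (N R) (f R) (\<lambda>x. of_bool (x = y) * \<phi> x) = (\<lambda>ts. of_bool (ts = us) * \<phi> (f R ts))"
      using us inj by (auto simp: in_chart_def fun_eq_iff inj_on_def)
    then show ?thesis using True euler_delta[of us "N R" "\<lambda>ts. \<phi> (f R ts)"] us by (simp add: incr_UNIV)
  next
    case False
    then have "y \<notin> Q" using aut_orbits_disjoint[OF X Q R(1)] R(2) by blast
    then have "in_chart (N Q) (f Q) (\<lambda>x. of_bool (x = y) * \<phi> x) = (\<lambda>_. 0)"
      using ch Q by (fastforce simp: in_chart_def fun_eq_iff charts_def chart_def bij_betw_def)
    then show ?thesis using False by simp
  qed
  then show ?thesis using X R(1) unfolding gset_integral_charts[OF ch i] by (simp add: gset_def)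
qed

text \<open>Those symmetries of \<open>F\<close> that also fix \<open>x\<close> are symmetries of
  \<open>F x\<close>, and they contain the stabilizer of a finite set because the point stabilizer
  of \<open>x\<close> does.\<close>

lemma integrable_partial:
  assumes "finite S" and inv: "\<And>g x y. g \<in> autf S \<Longrightarrow> x \<in> pts X \<Longrightarrow> y \<in> pts Y \<Longrightarrow> F (act X g x) (act Y g y) = F x y"
    and X: "gset X" and Y: "gset Y" and x: "x \<in> pts X"
  shows "integrable Y (F x)"
proof -
  obtain T where T: "finite T" "\<And>g. g \<in> autf T \<Longrightarrow> act X g x = x" using gset_stabilizer[OF X x] by blast
  have "invariant_fun Y (S \<union> T) (F x)"
    unfolding invariant_fun_def carrier_aut_R_fix
  proof (intro ballI)
    fix g y assume g: "g \<in> autf (S \<union> T)" and y: "y \<in> pts Y"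
    have "g \<in> autf S" "g \<in> autf T" using g by (auto simp: autf_def)
    then show "F x (act Y g y) = F x y" using inv[of g x y] x y T(2) by simp
  qed
  then show ?thesis using T(1) assms(1) unfolding integrable_def by blast
qed

text \<open>The guarded integrand on the right is defined on all lists and treats the two sets
  alike, so the interchange reduces to \<open>euler_swap\<close> for each pair of orbits.\<close>

lemma gset_integral_iterated:
  fixes F :: "'x \<Rightarrow> 'y \<Rightarrow> 'k::field"
  assumes S: "finite S" and inv: "\<And>g x y. g \<in> autf S \<Longrightarrow> x \<in> pts X \<Longrightarrow> y \<in> pts Y \<Longrightarrow> F (act X g x) (act Y g y) = F x y"
    and cX: "charts X N f" and cY: "charts Y M h"
  shows "gset_integral X (\<lambda>x. gset_integral Y (F x)) =
     (\<Sum>Q\<in>aut_orbits X. \<Sum>R\<in>aut_orbits Y. euler (N Q) (\<lambda>ts. euler (M R) (\<lambda>us.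
        if ts \<in> incr UNIV (N Q) \<and> us \<in> incr UNIV (M R) then F (f Q ts) (h R us) else 0)))"
proof -
  have X: "gset X" and Y: "gset Y" using cX cY by (auto simp: charts_def)
  have iY: "integrable Y (F x)" if "x \<in> pts X" for x
    by (rule integrable_partial[of S X Y F]) (use S inv X Y that in auto)
  have "invariant_fun X S (\<lambda>x. gset_integral Y (F x))"
    unfolding invariant_fun_def carrier_aut_R_fix
  proof (intro ballI)
    fix g x assume g: "g \<in> autf S" and x: "x \<in> pts X"
    have gx: "act X g x \<in> pts X" using gset_act_closed[OF X autf_empty[OF g] x] .
    have "gset_integral Y (F x) = gset_integral Y (\<lambda>y. F (act X g x) (act Y g y))"
      by (rule gset_integral_cong[OF Y _ iY[OF x]]) (use inv g x in auto)
    also have "\<dots> = gset_integral Y (F (act X g x))"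
      using gset_integral_act[OF Y autf_empty[OF g] iY[OF gx]] .
    finally show "gset_integral Y (F (act X g x)) = gset_integral Y (F x)" by simp
  qed
  then have "integrable X (\<lambda>x. gset_integral Y (F x))" using S by (auto simp: integrable_def)
  note gset_integral_charts[OF cX this]
  also have "(\<Sum>Q\<in>aut_orbits X. euler (N Q) (in_chart (N Q) (f Q) (\<lambda>x. gset_integral Y (F x)))) =
    (\<Sum>Q\<in>aut_orbits X. \<Sum>R\<in>aut_orbits Y. euler (N Q) (\<lambda>ts. euler (M R) (\<lambda>us.
      if ts \<in> incr UNIV (N Q) \<and> us \<in> incr UNIV (M R) then F (f Q ts) (h R us) else 0)))"
  proof (rule sum.cong[OF refl])
    fix Q assume Q: "Q \<in> aut_orbits X"
    have cQ: "chart X Q (N Q) (f Q)" "Q \<subseteq> pts X" using cX Q aut_orbit_subset[OF X Q] by (auto simp: charts_def)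
    have fQ: "f Q ts \<in> pts X" if "ts \<in> incr UNIV (N Q)" for ts
      using that cQ by (auto simp: chart_def bij_betw_def)
    define G where "G R ts us = (if ts \<in> incr UNIV (N Q) \<and> us \<in> incr UNIV (M R) then F (f Q ts) (h R us) else 0)" for R ts us
    have e: "in_chart (N Q) (f Q) (\<lambda>x. gset_integral Y (F x)) ts = (\<Sum>R\<in>aut_orbits Y. 1 * euler (M R) (G R ts))" for ts
      using gset_integral_charts[OF cY iY[OF fQ]] by (simp add: in_chart_def[abs_def] G_def[abs_def])
    have lt: "ltame S (\<lambda>ts. euler (M R) (G R ts))" if R: "R \<in> aut_orbits Y" for R
    proof (rule ltameI[OF S])
      fix g ts assume g: "g \<in> autf S"
      have cR: "chart Y R (M R) (h R)" "R \<subseteq> pts Y" using cY R aut_orbit_subset[OF Y R] by (auto simp: charts_def)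
      have hR: "h R us \<in> pts Y" if "us \<in> incr UNIV (M R)" for us
        using that cR by (auto simp: chart_def bij_betw_def)
      have "G R (map g ts) (map g us) = G R ts us" for us
        using inv[OF g] fQ hR cQ(1) cR(1) autf_empty[OF g] by (auto simp: G_def incr_map[OF g] chart_def)
      then show "euler (M R) (G R (map g ts)) = euler (M R) (G R ts)"
        using euler_param[OF g, where F="G R" and h="map g" and p=ts] by blast
    qed
    have "euler (N Q) (\<lambda>ts. \<Sum>R\<in>aut_orbits Y. 1 * euler (M R) (G R ts)) = (\<Sum>R\<in>aut_orbits Y. 1 * euler (N Q) (\<lambda>ts. euler (M R) (G R ts)))"
      by (rule euler_sum[OF S lt])
    then show "euler (N Q) (in_chart (N Q) (f Q) (\<lambda>x. gset_integral Y (F x))) =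
     (\<Sum>R\<in>aut_orbits Y. euler (N Q) (\<lambda>ts. euler (M R) (\<lambda>us.
      if ts \<in> incr UNIV (N Q) \<and> us \<in> incr UNIV (M R) then F (f Q ts) (h R us) else 0)))"
      unfolding e by (simp add: G_def[abs_def])
  qed
  finally show ?thesis .
qed

lemma gset_integral_swap:
  fixes F :: "'x \<Rightarrow> 'y \<Rightarrow> 'k::field"
  assumes S: "finite S" and inv: "\<And>g x y. g \<in> autf S \<Longrightarrow> x \<in> pts X \<Longrightarrow> y \<in> pts Y \<Longrightarrow> F (act X g x) (act Y g y) = F x y"
    and X: "gset X" and Y: "gset Y"
  shows "gset_integral X (\<lambda>x. gset_integral Y (F x)) = gset_integral Y (\<lambda>y. gset_integral X (\<lambda>x. F x y))"
proof -
  obtain N f where cX: "charts X N f" using charts_obtain[OF X] .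
  obtain M h where cY: "charts Y M h" using charts_obtain[OF Y] .
  have swap: "euler (N Q) (\<lambda>ts. euler (M R) (\<lambda>us.
        if ts \<in> incr UNIV (N Q) \<and> us \<in> incr UNIV (M R) then F (f Q ts) (h R us) else 0)) =
    euler (M R) (\<lambda>us. euler (N Q) (\<lambda>ts.
        if us \<in> incr UNIV (M R) \<and> ts \<in> incr UNIV (N Q) then F (f Q ts) (h R us) else 0))"
    if Q: "Q \<in> aut_orbits X" and R: "R \<in> aut_orbits Y" for Q R
  proof -
    have c: "chart X Q (N Q) (f Q)" "Q \<subseteq> pts X" "chart Y R (M R) (h R)" "R \<subseteq> pts Y"
      using cX cY Q R aut_orbit_subset[OF X Q] aut_orbit_subset[OF Y R] by (auto simp: charts_def)
    have p: "ts \<in> incr UNIV (N Q) \<Longrightarrow> f Q ts \<in> pts X" "us \<in> incr UNIV (M R) \<Longrightarrow> h R us \<in> pts Y" for ts us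
      using c by (auto simp: chart_def bij_betw_def)
    show ?thesis
      unfolding conj_commute[of "_ \<in> incr UNIV (M R)"]
    proof (rule euler_swap[OF S])
      fix g ts us assume g: "g \<in> autf S"
      show "(if map g ts \<in> incr UNIV (N Q) \<and> map g us \<in> incr UNIV (M R) then F (f Q (map g ts)) (h R (map g us)) else 0) =
        (if ts \<in> incr UNIV (N Q) \<and> us \<in> incr UNIV (M R) then F (f Q ts) (h R us) else 0)"
        using inv[OF g] p c autf_empty[OF g] by (auto simp: incr_map[OF g] chart_def)
    qed
  qed
  note 1 = gset_integral_iterated[where X=X and Y=Y and F=F, OF S inv cX cY]
  note 2 = gset_integral_iterated[where X=Y and Y=X and F="\<lambda>y x. F x y", OF S inv cY cX]
  show ?thesis
    by (subst 1, assumption+, subst 2, assumption+, subst sum.swap) (simp add: swap)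
qed

section \<open>Composition of matrices\<close>

lemma matrices_inv:
  "A \<in> matrices X Y \<Longrightarrow> g \<in> autf {} \<Longrightarrow> y \<in> pts Y \<Longrightarrow> x \<in> pts X \<Longrightarrow> A (act Y g y) (act X g x) = A y x"
  by (simp add: matrices_def carrier_aut_R)

lemma matrices_supp: "A \<in> matrices X Y \<Longrightarrow> y \<notin> pts Y \<or> x \<notin> pts X \<Longrightarrow> A y x = 0"
  by (auto simp: matrices_def)

lemma matrices_linear:
  assumes "A \<in> matrices X Y" "B \<in> matrices X Y"
  shows "mscale c A + B \<in> matrices X Y"
proof -
  have "(mscale c A + B) y x = 0" if "y \<notin> pts Y \<or> x \<notin> pts X" for y x
    using that matrices_supp[OF assms(1)] matrices_supp[OF assms(2)] by (auto simp: mscale_def)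
  then show ?thesis using assms by (auto simp: matrices_def mscale_def)
qed

lemma matrices_zero: "0 \<in> matrices X Y"
  by (simp add: matrices_def)

lemma matrices_add: "A \<in> matrices X Y \<Longrightarrow> B \<in> matrices X Y \<Longrightarrow> A + B \<in> matrices X Y"
  using matrices_linear[of A X Y B 1] by (simp add: mscale_def)

lemma matrices_scale: "A \<in> matrices X Y \<Longrightarrow> mscale c A \<in> matrices X Y"
  by (auto simp: matrices_def mscale_def)

lemma integrable_mcomp:
  assumes "gset X" "gset Y" "gset Z" "A \<in> matrices X Y" "B \<in> matrices Y Z"
  shows "integrable Y (\<lambda>y. B z y * A y x)"
proof (cases "x \<in> pts X \<and> z \<in> pts Z")
  case True
  obtain S where S: "finite S" "\<And>g. g \<in> autf S \<Longrightarrow> act X g x = x" using gset_stabilizer[OF assms(1)] True by blast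
  obtain T where T: "finite T" "\<And>g. g \<in> autf T \<Longrightarrow> act Z g z = z" using gset_stabilizer[OF assms(3)] True by blast
  have "invariant_fun Y (S \<union> T) (\<lambda>y. B z y * A y x)"
    unfolding invariant_fun_def carrier_aut_R_fix
  proof (intro ballI)
    fix g y assume g: "g \<in> autf (S \<union> T)" and y: "y \<in> pts Y"
    have "act X g x = x" "act Z g z = z" using S(2) T(2) g by (auto simp: autf_def)
    then show "B z (act Y g y) * A (act Y g y) x = B z y * A y x"
      using matrices_inv[OF assms(4) autf_empty[OF g] y, of x] matrices_inv[OF assms(5) autf_empty[OF g] _ y, of z] True
      by simp
  qed
  then show ?thesis using S(1) T(1) unfolding integrable_def by blast
next
  case False
  then have "(\<lambda>y. B z y * A y x) = (\<lambda>_. 0)"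
    using matrices_supp[OF assms(4)] matrices_supp[OF assms(5)] by (auto simp: fun_eq_iff)
  then show ?thesis by simp
qed

lemma mcomp_closed:
  assumes "gset X" "gset Y" "gset Z" "A \<in> matrices X Y" "B \<in> matrices Y Z"
  shows "mcomp Y B A \<in> matrices X Z"
proof -
  have "mcomp Y B A z x = 0" if "z \<notin> pts Z \<or> x \<notin> pts X" for z x
  proof -
    have "(\<lambda>y. B z y * A y x) = (\<lambda>_. 0)"
      using that matrices_supp[OF assms(4)] matrices_supp[OF assms(5)] by (auto simp: fun_eq_iff)
    then show ?thesis by (simp add: mcomp_def gset_integral_zero[OF assms(2)])
  qed
  moreover have "mcomp Y B A (act Z g z) (act X g x) = mcomp Y B A z x"
    if g: "g \<in> autf {}" and z: "z \<in> pts Z" and x: "x \<in> pts X" for g z x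
  proof -
    have "mcomp Y B A (act Z g z) (act X g x) =
      gset_integral Y (\<lambda>y. B (act Z g z) (act Y g y) * A (act Y g y) (act X g x))"
      unfolding mcomp_def using gset_integral_act[OF assms(2) g integrable_mcomp[OF assms], symmetric] .
    also have "\<dots> = gset_integral Y (\<lambda>y. B z y * A y x)"
      by (rule gset_integral_cong[OF assms(2) _ integrable_mcomp[OF assms], symmetric])
        (use matrices_inv[OF assms(4) g] matrices_inv[OF assms(5) g] x z in simp)
    finally show ?thesis by (simp add: mcomp_def)
  qed
  ultimately show ?thesis by (auto simp: matrices_def carrier_aut_R)
qed

lemma gset_integral_scale:
  assumes "gset X" "integrable X \<phi>"
  shows "gset_integral X (\<lambda>x. c * \<phi> x) = c * gset_integral X \<phi>"
  using gset_integral_linear(1)[OF assms(1,2) integrable_zero[of _ 0], of c] by (simp add: gset_integral_zero[OF assms(1)])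

lemma mcomp_linear:
  assumes "gset X" "gset Y" "gset Z" "A \<in> matrices X Y" "A' \<in> matrices X Y" "B \<in> matrices Y Z" "B' \<in> matrices Y Z"
  shows "mcomp Y (mscale c B + B') A = mscale c (mcomp Y B A) + mcomp Y B' A"
    and "mcomp Y B (mscale c A + A') = mscale c (mcomp Y B A) + mcomp Y B A'"
  using gset_integral_linear(1)[OF assms(2) integrable_mcomp[OF assms(1-3,4,6)] integrable_mcomp[OF assms(1-3,4,7)], of c]
    gset_integral_linear(1)[OF assms(2) integrable_mcomp[OF assms(1-3,4,6)] integrable_mcomp[OF assms(1-3,5,6)], of c]
  by (simp_all add: mcomp_def mscale_def fun_eq_iff distrib_left distrib_right mult.assoc mult.left_commute)

lemma mcomp_zero: "gset Y \<Longrightarrow> mcomp Y 0 A = 0" "gset Y \<Longrightarrow> mcomp Y B 0 = 0"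
  by (simp_all add: mcomp_def fun_eq_iff gset_integral_zero)

lemma mcomp_add:
  assumes "gset X" "gset Y" "gset Z" "A \<in> matrices X Y" "A' \<in> matrices X Y" "B \<in> matrices Y Z" "B' \<in> matrices Y Z"
  shows "mcomp Y (B + B') A = mcomp Y B A + mcomp Y B' A"
    and "mcomp Y B (A + A') = mcomp Y B A + mcomp Y B A'"
  using mcomp_linear[OF assms, of 1] by (simp_all add: mscale_def)

lemma mcomp_scale:
  assumes "gset X" "gset Y" "gset Z" "A \<in> matrices X Y" "B \<in> matrices Y Z"
  shows "mcomp Y (mscale c B) A = mscale c (mcomp Y B A)" "mcomp Y B (mscale c A) = mscale c (mcomp Y B A)"
  using mcomp_linear[OF assms(1-4) matrices_zero assms(5) matrices_zero, of c] by (simp_all add: mcomp_zero assms)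

text \<open>For fixed outer indices both sides are iterated integrals of one function of
  \<open>z\<close> and \<open>y\<close>, which is invariant under a stabilizer fixing
  \<open>w\<close> and \<open>x\<close>.\<close>

lemma mcomp_assoc:
  fixes A :: "'y \<Rightarrow> 'x \<Rightarrow> 'k::field"
  assumes X: "gset X" and Y: "gset Y" and Z: "gset Z" and W: "gset W"
    and A: "A \<in> matrices X Y" and B: "B \<in> matrices Y Z" and C: "C \<in> matrices Z W"
  shows "mcomp Z C (mcomp Y B A) = mcomp Y (mcomp Z C B) A"
proof (intro ext)
  fix w x
  show "mcomp Z C (mcomp Y B A) w x = mcomp Y (mcomp Z C B) A w x"
  proof (cases "x \<in> pts X \<and> w \<in> pts W")
    case False
    then show ?thesis
      using matrices_supp[OF mcomp_closed[OF X Z W mcomp_closed[OF X Y Z A B] C], of w x]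
        matrices_supp[OF mcomp_closed[OF X Y W A mcomp_closed[OF Y Z W B C]], of w x] by auto
  next
    case True
    obtain S where S: "finite S" "\<And>g. g \<in> autf S \<Longrightarrow> act X g x = x" using gset_stabilizer[OF X] True by blast
    obtain T where T: "finite T" "\<And>g. g \<in> autf T \<Longrightarrow> act W g w = w" using gset_stabilizer[OF W] True by blast
    define F where "F z y = C w z * (B z y * A y x)" for z y
    have inv: "F (act Z g z) (act Y g y) = F z y" if g: "g \<in> autf (S \<union> T)" and "z \<in> pts Z" "y \<in> pts Y" for g z y
    proof -
      have "act X g x = x" "act W g w = w" using S(2) T(2) g by (auto simp: autf_def)
      then show ?thesis
        using matrices_inv[OF A autf_empty[OF g], of y x] matrices_inv[OF B autf_empty[OF g], of z y]
          matrices_inv[OF C autf_empty[OF g], of w z] that True by (simp add: F_def)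
    qed
    have "mcomp Z C (mcomp Y B A) w x = gset_integral Z (\<lambda>z. gset_integral Y (F z))"
      unfolding mcomp_def F_def gset_integral_scale[OF Y integrable_mcomp[OF X Y Z A B]] ..
    also have "\<dots> = gset_integral Y (\<lambda>y. gset_integral Z (\<lambda>z. F z y))"
      by (rule gset_integral_swap[OF _ inv Z Y]) (use S T in auto)
    also have "(\<lambda>y. gset_integral Z (\<lambda>z. F z y)) = (\<lambda>y. mcomp Z C B w y * A y x)"
      using gset_integral_scale[OF Z integrable_mcomp[OF Y Z W B C], of "A _ x"]
      by (simp add: fun_eq_iff F_def mcomp_def mult_ac)
    finally show ?thesis by (simp add: mcomp_def)
  qed
qed

definition idmat :: "'x gset \<Rightarrow> 'x \<Rightarrow> 'x \<Rightarrow> 'k::field" where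
  "idmat X = (\<lambda>x y. of_bool (x = y \<and> x \<in> pts X))"

lemma act_eq_iff: "gset X \<Longrightarrow> g \<in> autf {} \<Longrightarrow> x \<in> pts X \<Longrightarrow> y \<in> pts X \<Longrightarrow> act X g x = act X g y \<longleftrightarrow> x = y"
  by (metis gset_act_inv(1))

lemma idmat_matrices: "gset X \<Longrightarrow> idmat X \<in> matrices X X"
  by (auto simp: matrices_def idmat_def carrier_aut_R act_eq_iff gset_act_closed)

lemma mcomp_idmat:
  assumes X: "gset X" and Y: "gset Y" and A: "A \<in> matrices X Y"
  shows "mcomp Y (idmat Y) A = A" "mcomp X A (idmat X) = A"
proof -
  have i1: "integrable Y (\<lambda>y. idmat Y z y * A y x)" for z x
    by (rule integrable_mcomp[OF X Y Y A idmat_matrices[OF Y]])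
  have i2: "integrable X (\<lambda>y. A z y * idmat X y x)" for z x
    by (rule integrable_mcomp[OF X X Y idmat_matrices[OF X] A])
  have "mcomp Y (idmat Y) A z x = A z x" for z x
  proof (cases "z \<in> pts Y")
    case True
    then have e: "(\<lambda>y. idmat Y z y * A y x) = (\<lambda>y. of_bool (y = z) * A y x)" by (auto simp: idmat_def fun_eq_iff)
    show ?thesis using gset_integral_delta[OF Y True, of "\<lambda>y. A y x"] i1[of z x] unfolding mcomp_def e by simp
  qed (simp add: mcomp_def idmat_def gset_integral_zero[OF Y] matrices_supp[OF A])
  then show "mcomp Y (idmat Y) A = A" by blast
  have "mcomp X A (idmat X) z x = A z x" for z x
  proof (cases "x \<in> pts X")
    case True
    then have e: "(\<lambda>y. A z y * idmat X y x) = (\<lambda>y. of_bool (y = x) * A z y)" by (auto simp: idmat_def fun_eq_iff)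
    show ?thesis using gset_integral_delta[OF X True, of "\<lambda>y. A z y"] i2[of z x] unfolding mcomp_def e by simp
  next
    case False
    then have "(\<lambda>y. A z y * idmat X y x) = (\<lambda>_. 0)" by (auto simp: idmat_def fun_eq_iff)
    then show ?thesis using False by (simp add: mcomp_def gset_integral_zero[OF X] matrices_supp[OF A])
  qed
  then show "mcomp X A (idmat X) = A" by blast
qed

section \<open>The sets of increasing tuples\<close>

lemma pts_RR: "pts (RR n) = incr UNIV n"
  by (simp add: RR_def)

lemma act_RR: "xs \<in> incr UNIV n \<Longrightarrow> act (RR n) g xs = map g xs"
  by (simp add: RR_def)

lemma incr_UNIV_nonempty: "map real [0..<n] \<in> incr UNIV n"
  by (simp add: incr_UNIV sorted_wrt_map strict_sorted_iff[symmetric] sorted_wrt_upt[simplified])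

lemma restrict_map_Bij: assumes "g \<in> autf {}" shows "restrict (map g) (incr UNIV n) \<in> Bij (incr UNIV n)"
proof -
  have "bij_betw (restrict (map g) (incr UNIV n)) (incr UNIV n) (incr UNIV n)"
    unfolding bij_betw_def
  proof
    show "inj_on (restrict (map g) (incr UNIV n)) (incr UNIV n)"
      using map_inv_autf(1)[OF assms] by (intro inj_onI) (metis restrict_apply')
    have "xs \<in> map g ` incr UNIV n" if "xs \<in> incr UNIV n" for xs
      using that map_inv_autf(2)[OF assms, of xs] incr_map[OF autf_inv[OF assms], of xs n] by (metis image_eqI)
    then show "restrict (map g) (incr UNIV n) ` incr UNIV n = incr UNIV n"
      using incr_map[OF assms] by auto
  qed
  then show ?thesis by (simp add: Bij_def)
qed

lemma gset_RR: "gset (RR n)"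
proof -
  define \<phi> where "\<phi> = (\<lambda>g::real\<Rightarrow>real. restrict (map g) (incr UNIV n))"
  have "\<phi> \<in> hom aut_R (BijGroup (incr UNIV n))"
  proof (rule homI)
    fix g assume "g \<in> carrier aut_R"
    then show "\<phi> g \<in> carrier (BijGroup (incr UNIV n))"
      using restrict_map_Bij by (simp add: BijGroup_def carrier_aut_R \<phi>_def)
  next
    fix g h assume "g \<in> carrier aut_R" "h \<in> carrier aut_R"
    then have "g \<in> autf {}" "h \<in> autf {}" by (auto simp: carrier_aut_R)
    then show "\<phi> (g \<otimes>\<^bsub>aut_R\<^esub> h) = \<phi> g \<otimes>\<^bsub>BijGroup (incr UNIV n)\<^esub> \<phi> h"
      using restrict_map_Bij incr_map
      by (auto simp: BijGroup_def \<phi>_def mult_aut_R compose_def fun_eq_iff restrict_def)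
  qed
  then have "group_action aut_R (incr UNIV n) \<phi>"
    using group_aut_R group_BijGroup
    by (auto simp: group_action_def group_hom_def group_hom_axioms_def)
  moreover have "orbits aut_R (incr UNIV n) \<phi> \<subseteq> {incr UNIV n}"
  proof -
    have "orbit aut_R \<phi> xs = incr UNIV n" if xs: "xs \<in> incr UNIV n" for xs
    proof
      show "orbit aut_R \<phi> xs \<subseteq> incr UNIV n" using xs incr_map by (auto simp: orbit_aut_R \<phi>_def)
      show "incr UNIV n \<subseteq> orbit aut_R \<phi> xs"
      proof
        fix ys assume ys: "ys \<in> incr UNIV n"
        obtain g where "g \<in> autf {}" "map g xs = ys" using incr_transitive[OF xs ys] by blast
        then show "ys \<in> orbit aut_R \<phi> xs" using xs by (auto simp: orbit_aut_R \<phi>_def)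
      qed
    qed
    then show ?thesis by (auto simp: orbits_def)
  qed
  then have "finite (orbits aut_R (incr UNIV n) \<phi>)" by (rule finite_subset) simp
  moreover have "\<exists>S. finite S \<and> carrier (aut_R_fix S) \<subseteq> stabilizer aut_R \<phi> xs" if "xs \<in> incr UNIV n" for xs
    using that autf_empty autf_fix
    by (intro exI[of _ "set xs"]) (auto simp: carrier_aut_R_fix stabilizer_def carrier_aut_R \<phi>_def intro!: map_idI)
  ultimately show ?thesis by (simp add: gset_def RR_def \<phi>_def)
qed

lemma orbits_RR: "aut_orbits (RR n) = {incr UNIV n}"
proof -
  have "orbit aut_R (act (RR n)) xs = incr UNIV n" if xs: "xs \<in> incr UNIV n" for xs
  proof
    show "orbit aut_R (act (RR n)) xs \<subseteq> incr UNIV n" using xs incr_map by (auto simp: orbit_aut_R act_RR)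
    show "incr UNIV n \<subseteq> orbit aut_R (act (RR n)) xs"
    proof
      fix ys assume ys: "ys \<in> incr UNIV n"
      obtain g where "g \<in> autf {}" "map g xs = ys" using incr_transitive[OF xs ys] by blast
      then show "ys \<in> orbit aut_R (act (RR n)) xs" using xs by (auto simp: orbit_aut_R act_RR)
    qed
  qed
  then show ?thesis using incr_UNIV_nonempty[of n] by (auto simp: orbits_def pts_RR)
qed

lemma charts_RR: "charts (RR n) (\<lambda>_. n) (\<lambda>_ ts. ts)"
  using gset_RR by (auto simp: charts_def orbits_RR chart_def act_RR bij_betw_def)

lemma gset_integral_RR:
  assumes "integrable (RR n) \<phi>" "\<And>ts. ts \<notin> incr UNIV n \<Longrightarrow> \<phi> ts = 0"
  shows "gset_integral (RR n) \<phi> = euler n \<phi>"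
proof -
  have "in_chart n (\<lambda>ts. ts) \<phi> = \<phi>" using assms(2) by (auto simp: in_chart_def fun_eq_iff)
  then show ?thesis using gset_integral_charts[OF charts_RR assms(1)] by (simp add: orbits_RR)
qed

lemma mcomp_RR:
  assumes "gset X" "gset Z" "A \<in> matrices X (RR n)" "B \<in> matrices (RR n) Z"
  shows "mcomp (RR n) B A z x = euler n (\<lambda>y. B z y * A y x)"
  unfolding mcomp_def
  by (rule gset_integral_RR[OF integrable_mcomp[OF assms(1) gset_RR assms(2-4)]])
    (use matrices_supp[OF assms(3)] in \<open>simp add: pts_RR\<close>)

text \<open>The extension by zero is itself invariant, because automorphisms preserve increasing
  lists in both directions; so invariance may be asked for all lists.\<close>

lemma matrices_RR_iff:
  "A \<in> matrices (RR m) (RR n) \<longleftrightarrow> (\<forall>y x. A y x \<noteq> 0 \<longrightarrow> y \<in> incr UNIV n \<and> x \<in> incr UNIV m) \<and>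
     (\<forall>g\<in>autf {}. \<forall>y x. A (map g y) (map g x) = A y x)" (is "?L \<longleftrightarrow> ?R")
proof
  assume L: ?L
  have "A (map g y) (map g x) = A y x" if g: "g \<in> autf {}" for g y x
  proof (cases "y \<in> incr UNIV n \<and> x \<in> incr UNIV m")
    case True
    then show ?thesis using matrices_inv[OF L g] by (simp add: pts_RR act_RR)
  next
    case False
    then have "A y x = 0" using matrices_supp[OF L] by (auto simp: pts_RR)
    moreover have "A (map g y) (map g x) = 0"
      using False incr_map[OF g] by (intro matrices_supp[OF L]) (auto simp: pts_RR)
    ultimately show ?thesis by simp
  qed
  then show ?R using L by (auto simp: matrices_def pts_RR)
next
  assume ?R
  then show ?L by (auto simp: matrices_def pts_RR act_RR carrier_aut_R)
qed

lemma matrices_RR_ltame: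
  assumes "A \<in> matrices (RR m) (RR n)"
  shows "ltame (set x) (\<lambda>y. A y x)" "ltame (set y) (A y)"
proof -
  have i: "A (map g y) (map g x) = A y x" if "g \<in> autf {}" for g x y using assms that matrices_RR_iff by blast
  have "A (map g y) x = A y x" if "g \<in> autf (set x)" for g y
    using i[OF autf_empty[OF that], of y x] autf_fix[OF that] by (simp add: map_idI)
  then show "ltame (set x) (\<lambda>y. A y x)" by (intro ltameI) auto
  have "A y (map g x) = A y x" if "g \<in> autf (set y)" for g x
    using i[OF autf_empty[OF that], of y x] autf_fix[OF that] by (simp add: map_idI)
  then show "ltame (set y) (A y)" by (intro ltameI) auto
qed

section \<open>Kernels attached to pairs of words\<close>

text \<open>Left and right multiplication by \<open>E_mat\<close> are put on the same footing: a map from \<open>M_obj \<alpha>\<close> to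
  \<open>M_obj \<beta>\<close> is a kernel for the pair of words \<open>\<beta>\<close>, \<open>dual \<alpha>\<close>, since the transpose of \<open>E_mat \<alpha>\<close> is
  \<open>E_mat (dual \<alpha>)\<close>.\<close>

fun dual_letter :: "letter \<Rightarrow> letter" where
  "dual_letter Bullet = Circ"
| "dual_letter Circ = Bullet"

abbreviation dual :: "weight \<Rightarrow> weight" where
  "dual \<equiv> map dual_letter"

fun rel :: "letter \<Rightarrow> real \<Rightarrow> real \<Rightarrow> bool" where
  "rel Bullet y x \<longleftrightarrow> y \<le> x"
| "rel Circ y x \<longleftrightarrow> x \<le> y"

text \<open>In pairs of words that satisfy \<open>fits\<close> below, equal letters only occur in the last position,
  where the kernel imposes no relation between the two coordinates.\<close>

fun ker :: "weight \<Rightarrow> weight \<Rightarrow> real list \<Rightarrow> real list \<Rightarrow> bool" where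
  "ker (b # \<beta>) (g # \<gamma>) (y # ys) (x # xs) \<longleftrightarrow>
     b = g \<or> rel b y x \<and> (\<forall>t\<in>set ys \<union> set xs. y < t \<and> x < t) \<and> ker \<beta> \<gamma> ys xs"
| "ker _ _ _ _ \<longleftrightarrow> True"

text \<open>The words are dual to each other except that either may carry one further
  \<open>Bullet\<close> at the end. With the dual of a weight as second word these are the four
  kinds of pairs in the theorem, see \<open>fits_dual_iff\<close>.\<close>

fun fits :: "weight \<Rightarrow> weight \<Rightarrow> bool" where
  "fits (b # \<beta>) (g # \<gamma>) \<longleftrightarrow> (if b = g then b = Bullet \<and> \<beta> = [] \<and> \<gamma> = [] else fits \<beta> \<gamma>)"
| "fits [] \<gamma> \<longleftrightarrow> \<gamma> = [] \<or> \<gamma> = [Bullet]"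
| "fits \<beta> [] \<longleftrightarrow> \<beta> = [Bullet]"

lemma dual_letter_invol [simp]: "dual_letter (dual_letter l) = l"
  by (cases l) auto

lemma dual_letter_comp [simp]: "dual_letter \<circ> dual_letter = id"
  by (simp add: fun_eq_iff)

lemma dual_dual: "dual (dual w) = w"
  by simp

lemma dual_letter_neq [simp]: "l \<noteq> dual_letter l" "dual_letter l \<noteq> l"
  by (cases l; simp)+

lemma letter_neq: "b \<noteq> g \<longleftrightarrow> g = dual_letter b"
  by (cases b; cases g) auto

lemma rel_sym: "b \<noteq> g \<Longrightarrow> rel b y x \<longleftrightarrow> rel g x y"
  by (cases b; cases g) auto

lemma ker_sym: "ker \<beta> \<gamma> ys xs \<longleftrightarrow> ker \<gamma> \<beta> xs ys"
proof (induction \<beta> \<gamma> ys xs rule: ker.induct)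
  case (1 b \<beta> g \<gamma> y ys x xs)
  then show ?case using rel_sym[of b g y x] by auto
qed auto

lemma fits_sym: "fits \<beta> \<gamma> \<longleftrightarrow> fits \<gamma> \<beta>"
proof (induction \<beta> \<gamma> rule: fits.induct)
  case (2 \<gamma>) then show ?case by (cases \<gamma>) auto
qed auto

lemma fits_dual: "fits w (dual w)"
  by (induction w) auto

lemma ker_map: "g \<in> autf {} \<Longrightarrow> ker \<beta> \<gamma> (map g ys) (map g xs) \<longleftrightarrow> ker \<beta> \<gamma> ys xs"
proof (induction \<beta> \<gamma> ys xs rule: ker.induct)
  case (1 b \<beta> g' \<gamma> y ys x xs)
  then show ?case by (cases b) (auto simp: autf_less autf_le ball_Un)
qed auto

lemma incr_Cons: "y # ys \<in> incr U n \<longleftrightarrow> (\<exists>m. n = Suc m \<and> y \<in> U \<and> (\<forall>t\<in>set ys. y < t) \<and> ys \<in> incr U m)"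
  by (auto simp: incr_def)

lemma incr_0 [simp]: "xs \<in> incr U 0 \<longleftrightarrow> xs = []"
  by (auto simp: incr_def)

lemma incr_Suc: "xs \<in> incr U (Suc n) \<longleftrightarrow> (\<exists>y ys. xs = y # ys \<and> y \<in> U \<and> (\<forall>t\<in>set ys. y < t) \<and> ys \<in> incr U n)"
  by (cases xs) (auto simp: incr_Cons, simp add: incr_def)

text \<open>The ranges left for the remaining coordinates when leading ones are split off. Such a
  set has no least element, so there is always room to move left.\<close>

definition up :: "real set \<Rightarrow> bool" where
  "up U \<longleftrightarrow> U = UNIV \<or> (\<exists>m. U = {m<..})"

lemma up_UNIV [simp]: "up UNIV" and up_greaterThan [simp]: "up {m<..}"
  by (auto simp: up_def)

lemma up_mem: "up U \<Longrightarrow> s \<in> U \<Longrightarrow> s \<le> t \<Longrightarrow> t \<in> U"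
  by (auto simp: up_def)

lemma up_below: assumes "up U" "s \<in> U" shows "\<exists>t<s. t \<in> U"
proof (cases "U = UNIV")
  case True then show ?thesis using lt_ex by blast
next
  case False
  then obtain m where "U = {m<..}" using assms(1) by (auto simp: up_def)
  then show ?thesis using dense[of m s] assms(2) by auto
qed

definition kmat_on :: "real set \<Rightarrow> weight \<Rightarrow> weight \<Rightarrow> real list \<Rightarrow> real list \<Rightarrow> 'k::field" where
  "kmat_on U \<beta> \<gamma> y x = of_bool (y \<in> incr U (length \<beta>) \<and> x \<in> incr U (length \<gamma>) \<and> ker \<beta> \<gamma> y x)"

abbreviation kmat :: "weight \<Rightarrow> weight \<Rightarrow> real list \<Rightarrow> real list \<Rightarrow> 'k::field" where
  "kmat \<equiv> kmat_on UNIV"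

lemma kmat_sym: "kmat_on U \<beta> \<gamma> y x = kmat_on U \<gamma> \<beta> x y"
  unfolding kmat_on_def using ker_sym[of \<beta> \<gamma> y x] by (simp add: conj_ac)

lemma kmat_map: "g \<in> autf {} \<Longrightarrow> kmat \<beta> \<gamma> (map g y) (map g x) = kmat \<beta> \<gamma> y x"
  by (simp add: kmat_on_def incr_map ker_map)

lemma kmat_matrices: "kmat \<beta> \<gamma> \<in> matrices (RR (length \<gamma>)) (RR (length \<beta>))"
  unfolding matrices_RR_iff by (simp add: kmat_map) (simp add: kmat_on_def)

lemma kmat_Cons:
  assumes "b \<noteq> g" "up U"
  shows "kmat_on U (b # \<beta>) (g # \<gamma>) (y # ys) (x # xs) =
    of_bool (y \<in> U \<and> x \<in> U \<and> rel b y x) * (kmat_on {max y x<..} \<beta> \<gamma> ys xs :: 'k::field)"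
proof -
  have E: "us \<in> incr {max y x<..} n \<longleftrightarrow> us \<in> incr U n \<and> (\<forall>t\<in>set us. y < t) \<and> (\<forall>t\<in>set us. x < t)" if "y \<in> U" for us n
    using up_mem[OF assms(2) that] by (auto simp: incr_def subset_iff less_imp_le)
  show ?thesis
  proof (cases "y \<in> U")
    case True
    then show ?thesis
      unfolding kmat_on_def E[OF True] using assms(1) by (simp add: incr_Cons ball_Un) blast
  qed (simp add: kmat_on_def incr_Cons)
qed

section \<open>One-variable conditions\<close>

text \<open>A single factor of the idempotent kernel: integration over the closed ray to the right
  of \<open>s\<close> for \<open>Bullet\<close> and to the left of \<open>s\<close> for
  \<open>Circ\<close>.\<close>

definition proj :: "letter \<Rightarrow> real \<Rightarrow> (real \<Rightarrow> 'k::field) \<Rightarrow> 'k" where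
  "proj l s \<phi> = euler1 (\<lambda>t. of_bool (rel l s t) * \<phi> t)"

lemma proj_zero [simp]: "proj l s (\<lambda>_. 0) = 0"
  by (simp add: proj_def)

definition proj_fixed :: "real set \<Rightarrow> weight \<Rightarrow> (real list \<Rightarrow> 'k::field) \<Rightarrow> bool" where
  "proj_fixed U w f \<longleftrightarrow>
     (\<forall>z\<in>incr U (length w). \<forall>i<length w. proj (w ! i) (z ! i) (\<lambda>t. f (z[i := t])) = f z)"

lemma proj_fixedD:
  "proj_fixed U w f \<Longrightarrow> z \<in> incr U (length w) \<Longrightarrow> i < length w \<Longrightarrow> proj (w ! i) (z ! i) (\<lambda>t. f (z[i := t])) = f z"
  unfolding proj_fixed_def by blast

lemma proj_up: assumes "up U" shows "proj Bullet s (\<lambda>t. of_bool (t \<in> U)) = (of_bool (s \<in> U) :: 'k::field)"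
proof (cases "U = UNIV")
  case True then show ?thesis by (simp add: proj_def euler1_atLeast)
next
  case False
  then obtain m where m: "U = {m<..}" using assms by (auto simp: up_def)
  show ?thesis
  proof (cases "m < s")
    case True
    then have "(\<lambda>t. of_bool (s \<le> t) * of_bool (m < t)) = (\<lambda>t. of_bool (s \<le> t) :: 'k)" by (auto simp: fun_eq_iff)
    then show ?thesis using True by (simp add: proj_def m euler1_atLeast)
  next
    case False
    then have "(\<lambda>t. of_bool (s \<le> t) * of_bool (m < t)) = (\<lambda>t. of_bool (m < t) :: 'k)" by (auto simp: fun_eq_iff)
    then show ?thesis using False by (simp add: proj_def m euler1_greaterThan)
  qed
qed

text \<open>The set of integration is a closed interval if \<open>s\<close> lies in \<open>U\<close>
  and \<open>s \<le> y\<close>; otherwise it is left-open, cut off by the end of \<open>U\<close>,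
  or empty. The measures are 1, 0 and 0.\<close>

lemma proj_Bullet: assumes "up U" "y \<in> U"
  shows "proj Bullet s (\<lambda>t. of_bool (t \<in> U \<and> t \<le> y)) = (of_bool (s \<in> U \<and> s \<le> y) :: 'k::field)"
proof -
  consider "U = UNIV" "s \<le> y" | m where "U = {m<..}" "m < s" "s \<le> y" | m where "U = {m<..}" "s \<le> m" | "y < s"
  proof (cases "y < s")
    case False
    then have "s \<le> y" by simp
    from assms(1) consider "U = UNIV" | m where "U = {m<..}" by (auto simp: up_def)
    then show thesis
    proof cases
      case (2 m)
      then show thesis using that(2,3)[of m] \<open>s \<le> y\<close> by (cases "m < s") auto
    qed (use that(1) \<open>s \<le> y\<close> in blast)
  qed (use that(4) in blast)
  then show ?thesis
  proof cases
    case 1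
    then have "(\<lambda>t. of_bool (s \<le> t) * of_bool (t \<in> U \<and> t \<le> y)) = (\<lambda>t. of_bool (s \<le> t \<and> t \<le> y) :: 'k)" by (auto simp: fun_eq_iff)
    then show ?thesis using 1 euler1_interval(1)[of s y] by (simp add: proj_def)
  next
    case 2
    then have "(\<lambda>t. of_bool (s \<le> t) * of_bool (t \<in> U \<and> t \<le> y)) = (\<lambda>t. of_bool (s \<le> t \<and> t \<le> y) :: 'k)" by (auto simp: fun_eq_iff)
    then have "proj Bullet s (\<lambda>t. of_bool (t \<in> U \<and> t \<le> y)) = (1 :: 'k)" using euler1_interval(1)[OF 2(3)] by (simp add: proj_def)
    then show ?thesis using 2 by simp
  next
    case 3
    then have "(\<lambda>t. of_bool (s \<le> t) * of_bool (t \<in> U \<and> t \<le> y)) = (\<lambda>t. of_bool (m < t \<and> t \<le> y) :: 'k)" by (auto simp: fun_eq_iff)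
    moreover have "m \<le> y" using assms(2) 3 by auto
    ultimately have "proj Bullet s (\<lambda>t. of_bool (t \<in> U \<and> t \<le> y)) = (0 :: 'k)"
      using euler1_interval(2)[of m y] by (simp add: proj_def)
    then show ?thesis using 3 by simp
  next
    case 4
    then have e: "(\<lambda>t. of_bool (s \<le> t) * of_bool (t \<in> U \<and> t \<le> y)) = (\<lambda>t. 0 :: 'k)" by (auto simp: fun_eq_iff)
    show ?thesis unfolding proj_def rel.simps e using 4 by simp
  qed
qed

text \<open>The closed interval from \<open>y\<close> to \<open>s\<close> has measure 1. If an
  element of \<open>T\<close> cuts it off, what is left is right-open and has measure 0.\<close>

lemma proj_Circ: assumes "finite T" "\<And>u. u \<in> T \<Longrightarrow> y < u"
  shows "proj Circ s (\<lambda>t. of_bool (y \<le> t \<and> (\<forall>u\<in>T. t < u))) = (of_bool (y \<le> s \<and> (\<forall>u\<in>T. s < u)) :: 'k::field)"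
proof -
  consider "y \<le> s" "\<forall>u\<in>T. s < u" | "s < y" | u where "u \<in> T" "u \<le> s" by (meson not_le)
  then show ?thesis
  proof cases
    case 1
    then have "(\<lambda>t. of_bool (t \<le> s) * of_bool (y \<le> t \<and> (\<forall>u\<in>T. t < u))) = (\<lambda>t. of_bool (y \<le> t \<and> t \<le> s) :: 'k)"
      by (force simp: fun_eq_iff)
    then show ?thesis using 1 euler1_interval(1)[of y s] by (simp add: proj_def)
  next
    case 2
    then have e: "(\<lambda>t. of_bool (t \<le> s) * of_bool (y \<le> t \<and> (\<forall>u\<in>T. t < u))) = (\<lambda>t. 0 :: 'k)" by (auto simp: fun_eq_iff)
    show ?thesis unfolding proj_def rel.simps e using 2 by simp
  next
    case 3
    define h where "h = Min T"
    have h: "h \<in> T" "h \<le> s" "\<And>u. u \<in> T \<Longrightarrow> h \<le> u" using 3 assms(1) unfolding h_def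
      by (auto intro: Min_in Min_le order_trans)
    have "(\<forall>u\<in>T. t < u) \<longleftrightarrow> t < h" for t using h by force
    then have "(\<lambda>t. of_bool (t \<le> s) * of_bool (y \<le> t \<and> (\<forall>u\<in>T. t < u))) = (\<lambda>t. of_bool (y \<le> t \<and> t < h) :: 'k)"
      using h(2) by (auto simp: fun_eq_iff)
    moreover have "y \<le> h" using assms(2)[OF h(1)] by simp
    ultimately have "proj Circ s (\<lambda>t. of_bool (y \<le> t \<and> (\<forall>u\<in>T. t < u))) = (0 :: 'k)"
      using euler1_interval(3)[of y h] by (simp add: proj_def)
    moreover have "\<not> (\<forall>u\<in>T. s < u)" using 3 by (meson not_le)
    ultimately show ?thesis by simp
  qed
qed

lemma proj_guard: "proj l s (\<lambda>t. of_bool (P t \<and> C)) = (if C then proj l s (\<lambda>t. of_bool (P t)) else 0)"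
  by simp

text \<open>As a function of its first coordinate the kernel is, up to a factor independent of it,
  one of the indicators in \<open>proj_up\<close>, \<open>proj_Bullet\<close> and
  \<open>proj_Circ\<close>. Later coordinates are reached by peeling off the leading pair, which
  shrinks \<open>U\<close>.\<close>

lemma kmat_proj:
  assumes "fits \<beta> \<gamma>" "up U" "z \<in> incr UNIV (length \<beta>)" "i < length \<beta>"
  shows "proj (\<beta> ! i) (z ! i) (\<lambda>t. kmat_on U \<beta> \<gamma> (z[i := t]) y) = (kmat_on U \<beta> \<gamma> z y :: 'k::field)"
  using assms
proof (induction \<beta> \<gamma> arbitrary: U z y i rule: fits.induct)
  case (1 b \<beta> g \<gamma>)
  obtain z0 zs where z: "z = z0 # zs" "\<forall>t\<in>set zs. z0 < t" "zs \<in> incr UNIV (length \<beta>)"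
    using "1.prems"(3) by (auto simp: incr_Suc)
  show ?case
  proof (cases "b = g")
    case True
    then have b: "b = Bullet" "g = Bullet" "\<beta> = []" "\<gamma> = []" using "1.prems"(1) by (auto split: if_splits)
    have "kmat_on U (b # \<beta>) (g # \<gamma>) [t] y = (of_bool (t \<in> U \<and> y \<in> incr U (Suc 0)) :: 'k)" for t
      using b by (auto simp: kmat_on_def incr_Suc)
    then show ?thesis using proj_up[OF "1.prems"(2), of z0] "1.prems"(4) z b by (cases "y \<in> incr U (Suc 0)") auto
  next
    case False
    show ?thesis
    proof (cases "y \<in> incr U (Suc (length \<gamma>))")
      case no: False
      then show ?thesis by (simp add: kmat_on_def)
    next
      case True
      then obtain y0 ys where y: "y = y0 # ys" "y0 \<in> U" "\<forall>t\<in>set ys. y0 < t" "ys \<in> incr U (length \<gamma>)"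
        by (auto simp: incr_Suc)
      show ?thesis
      proof (cases i)
        case (Suc j)
        have "proj (\<beta> ! j) (zs ! j) (\<lambda>t. kmat_on {max z0 y0<..} \<beta> \<gamma> (zs[j := t]) ys) = (kmat_on {max z0 y0<..} \<beta> \<gamma> zs ys :: 'k)"
          using "1.IH"[OF False] "1.prems" False Suc z by auto
        then show ?thesis
          using Suc z y by (cases "z0 \<in> U \<and> y0 \<in> U \<and> rel b z0 y0") (auto simp: kmat_Cons[OF False "1.prems"(2)])
      next
        case 0
        show ?thesis
        proof (cases b)
          case Bullet
          then have g: "g = Circ" using False by (cases g) auto
          \<comment> \<open>\<open>C\<close> collects the conditions free of the first coordinate
            \<open>t\<close>. That \<open>t\<close> lies below the later coordinates follows from
            \<open>t \<le> y0\<close>.\<close>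
          define C where "C \<longleftrightarrow> (\<forall>u\<in>set zs. y0 < u) \<and> zs \<in> incr U (length \<beta>) \<and> ker \<beta> \<gamma> zs ys"
          have e: "kmat_on U (b # \<beta>) (g # \<gamma>) (t # zs) y = (of_bool ((t \<in> U \<and> t \<le> y0) \<and> C) :: 'k)" for t
            using y Bullet g by (auto simp: kmat_on_def incr_Cons C_def)
          show ?thesis using Bullet unfolding z(1) 0 list_update_code nth_Cons_0 e proj_guard
            by (simp add: proj_Bullet[OF "1.prems"(2) y(2)])
        next
          case Circ
          then have g: "g = Bullet" using False by (cases g) auto
          define C where "C \<longleftrightarrow> (\<forall>u\<in>set zs. y0 < u) \<and> zs \<in> incr U (length \<beta>) \<and> ker \<beta> \<gamma> zs ys"
          have e: "kmat_on U (b # \<beta>) (g # \<gamma>) (t # zs) y = (of_bool ((y0 \<le> t \<and> (\<forall>u\<in>set ys \<union> set zs. t < u)) \<and> C) :: 'k)" for t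
            using y Circ g up_mem[OF "1.prems"(2) y(2)] by (auto simp: kmat_on_def incr_Cons C_def ball_Un intro: order_le_less_trans)
          have "proj Circ z0 (\<lambda>t. of_bool (y0 \<le> t \<and> (\<forall>u\<in>set ys \<union> set zs. t < u))) = (of_bool (y0 \<le> z0 \<and> (\<forall>u\<in>set ys \<union> set zs. z0 < u)) :: 'k)" if C
            by (rule proj_Circ) (use that y in \<open>auto simp: C_def\<close>)
          then show ?thesis using Circ unfolding z(1) 0 list_update_code nth_Cons_0 e proj_guard
            by auto
        qed
      qed
    qed
  qed
next
  case (2 \<gamma>) then show ?case by simp
next
  case (3 b \<beta>)
  then have b: "b = Bullet" "\<beta> = []" by auto
  obtain z0 where z: "z = [z0]" using "3.prems"(3) b by (auto simp: incr_Suc)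
  have "kmat_on U (b # \<beta>) [] [t] y = (of_bool (t \<in> U \<and> y = []) :: 'k)" for t
    using b by (auto simp: kmat_on_def incr_Suc)
  then show ?case using proj_up[OF "3.prems"(2), of z0] "3.prems"(4) z b by (cases "y = []") auto
qed

text \<open>The first integration variable can be eliminated at once if the first letter is \<open>Bullet\<close>, but only
  after interchanging it with the others if it is \<open>Circ\<close>.\<close>

lemma proj_fixed_imp_fixed:
  assumes "up U" "ltame S f" "\<And>y. y \<notin> incr UNIV (length w) \<Longrightarrow> f y = 0" "proj_fixed U w f" "z \<in> incr U (length w)"
  shows "euler (length w) (\<lambda>y. kmat w (dual w) z y * f y) = (f z :: 'k::field)"
  using assms
proof (induction w arbitrary: S f U z)
  case Nil
  then show ?case by (simp add: kmat_on_def)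
next
  case (Cons l w)
  obtain z0 zs where z: "z = z0 # zs" "z0 \<in> U" "\<forall>t\<in>set zs. z0 < t" "zs \<in> incr U (length w)"
    using Cons.prems(5) by (auto simp: incr_Suc)
  have supp: "f (y0 # ys) = 0" if "\<not> ((\<forall>t\<in>set ys. y0 < t) \<and> ys \<in> incr UNIV (length w))" for y0 ys
    by (rule Cons.prems(3)) (use that in \<open>auto simp: incr_Cons\<close>)
  have kc: "kmat (l # w) (dual (l # w)) (z0 # zs) (y0 # ys) =
     of_bool (rel l z0 y0 \<and> (\<forall>t\<in>set ys. y0 < t) \<and> (\<forall>t\<in>set ys. z0 < t) \<and> (\<forall>t\<in>set zs. y0 < t)) * (kmat w (dual w) zs ys :: 'k)" for y0 ys
    using z(3) by (auto simp: kmat_on_def incr_Cons)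
  have IH: "euler (length w) (\<lambda>ys. kmat w (dual w) zs ys * f (y0 # ys)) = f (y0 # zs)"
    \<comment> \<open>With \<open>y0\<close> fixed, the one-variable conditions survive only at
      tuples to the right of \<open>y0\<close>; this is why the statement is made relative to
      \<open>U\<close>.\<close>
    if y0: "y0 \<in> U" "\<forall>t\<in>set zs. y0 < t" for y0
  proof (rule Cons.IH)
    show "up {y0<..}" by simp
    show "ltame (insert y0 S) (\<lambda>ys. f (y0 # ys))" by (rule ltame_Cons[OF Cons.prems(2)])
    show "f (y0 # ys) = 0" if "ys \<notin> incr UNIV (length w)" for ys using supp that by blast
    show "zs \<in> incr {y0<..} (length w)" using z(4) y0 by (auto simp: incr_def)
    show "proj_fixed {y0<..} w (\<lambda>ys. f (y0 # ys))"
      unfolding proj_fixed_def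
    proof (intro ballI allI impI)
      fix us i assume us: "us \<in> incr {y0<..} (length w)" and i: "i < length w"
      then have "y0 # us \<in> incr U (length (l # w))"
      proof -
        have "{y0<..} \<subseteq> U" using up_mem[OF Cons.prems(1) y0(1)] by (auto simp: less_imp_le)
        then show ?thesis using us y0(1) by (auto simp: incr_Cons incr_def)
      qed
      then show "proj (w ! i) (us ! i) (\<lambda>t. f (y0 # us[i := t])) = f (y0 # us)"
        using proj_fixedD[OF Cons.prems(4), of "y0 # us" "Suc i"] i by simp
    qed
  qed
  have first: "proj l z0 (\<lambda>t. f (t # us)) = f (z0 # us)" if "z0 # us \<in> incr U (length (l # w))" for us
    using proj_fixedD[OF Cons.prems(4) that, of 0] by simp
  show ?case
  proof (cases l)
    case Bullet
    have "euler (length w) (\<lambda>ys. kmat (l # w) (dual (l # w)) z (y0 # ys) * f (y0 # ys)) = of_bool (rel l z0 y0) * f (y0 # zs)" for y0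
    proof (cases "z0 \<le> y0 \<and> (\<forall>t\<in>set zs. y0 < t)")
      case True
      then have "y0 \<in> U" using up_mem[OF Cons.prems(1) z(2)] by blast
      \<comment> \<open>Where \<open>ys\<close> does not continue \<open>y0\<close> increasingly
        \<open>f\<close> vanishes, so this order condition may be dropped from the kernel.\<close>
      have eq: "kmat (l # w) (dual (l # w)) z (y0 # ys) * f (y0 # ys) = kmat w (dual w) zs ys * f (y0 # ys)" for ys
        using True supp[of ys y0] Bullet unfolding z(1) kc by (cases "\<forall>t\<in>set ys. y0 < t") auto
      show ?thesis unfolding eq using IH[OF \<open>y0 \<in> U\<close>] True Bullet by simp
    next
      case False
      then have "kmat (l # w) (dual (l # w)) z (y0 # ys) = (0::'k)" for ys
        unfolding z(1) kc using Bullet by auto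
      moreover have "of_bool (rel l z0 y0) * f (y0 # zs) = 0" using False Bullet supp[of zs y0] by auto
      ultimately show ?thesis by simp
    qed
    then show ?thesis using first[of zs] z Cons.prems(5) by (simp add: proj_def)
  next
    case Circ
    define G where "G y0 ys = kmat (l # w) (dual (l # w)) z (y0 # ys) * f (y0 # ys)" for y0 ys
    have "euler1 (\<lambda>y0. euler (length w) (G y0)) = euler (length w) (\<lambda>ys. euler1 (\<lambda>y0. G y0 ys))"
    proof (rule euler1_euler_swap[of "S \<union> set z"])
      show "finite (S \<union> set z)" using Cons.prems(2) by (simp add: ltame_def)
      fix g t ts assume g: "g \<in> autf (S \<union> set z)"
      then have gS: "g \<in> autf S" and gz: "map g z = z" by (auto simp: autf_def intro: map_idI)
      have "f (map g (t # ts)) = f (t # ts)" using Cons.prems(2) gS unfolding ltame_def by blast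
      moreover have "kmat (l # w) (dual (l # w)) z (map g (t # ts)) = (kmat (l # w) (dual (l # w)) z (t # ts) :: 'k)"
        using kmat_map[OF autf_empty[OF g], of "l # w" "dual (l # w)" z "t # ts"] gz by simp
      ultimately show "G (g t) (map g ts) = G t ts" by (simp add: G_def)
    qed
    also have "\<dots> = euler (length w) (\<lambda>ys. kmat w (dual w) zs ys * f (z0 # ys))"
    proof (rule arg_cong[where f="euler (length w)"], rule ext)
      fix ys
      show "euler1 (\<lambda>y0. G y0 ys) = kmat w (dual w) zs ys * f (z0 # ys)"
      proof (cases "kmat w (dual w) zs ys = (0::'k) \<or> \<not> (\<forall>t\<in>set ys. z0 < t)")
        case True
        then have "(\<lambda>y0. G y0 ys) = (\<lambda>_. 0)" unfolding G_def z(1) kc by (auto simp: fun_eq_iff)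
        moreover have "kmat w (dual w) zs ys * f (z0 # ys) = 0" using True supp[of ys z0] by auto
        ultimately show ?thesis by simp
      next
        case False
        then have 1: "kmat w (dual w) zs ys = (1::'k)" and ys: "ys \<in> incr UNIV (length w)" by (auto simp: kmat_on_def)
        \<comment> \<open>For \<open>y0 \<le> z0\<close> the order conditions on \<open>y0\<close>
          follow from those on \<open>z0\<close>; so for fixed \<open>ys\<close> the integrand is
          that of the one-variable condition.\<close>
        have "G y0 ys = of_bool (rel l z0 y0) * f (y0 # ys)" for y0
        proof (cases "y0 \<le> z0")
          case True
          then have "(\<forall>t\<in>set ys. y0 < t)" "(\<forall>t\<in>set zs. y0 < t)" using False z(3) by force+
          then show ?thesis unfolding G_def z(1) kc using 1 False by simp
        next
          case no: False
          then show ?thesis unfolding G_def z(1) kc using Circ by simp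
        qed
        moreover have "z0 # ys \<in> incr U (length (l # w))"
          using False ys z(2) up_mem[OF Cons.prems(1) z(2)] by (auto simp: incr_Cons incr_def less_imp_le)
        ultimately show ?thesis using first[of ys] 1 by (simp add: proj_def)
      qed
    qed
    also have "\<dots> = f z" using IH[OF z(2,3)] z(1) by simp
    finally show ?thesis by (simp add: G_def[abs_def])
  qed
qed

text \<open>The kernel is itself fixed by each one-variable operator, by \<open>kmat_proj\<close>.
  Interchanging the integrals passes this on to \<open>f\<close>, which is an integral of the kernel
  against itself.\<close>

lemma fixed_imp_proj_fixed:
  fixes f :: "real list \<Rightarrow> 'k::field"
  assumes "ltame S f" "\<And>y. y \<notin> incr UNIV (length w) \<Longrightarrow> f y = 0"
    and fx: "\<And>z. z \<in> incr UNIV (length w) \<Longrightarrow> euler (length w) (\<lambda>y. kmat w (dual w) z y * f y) = f z"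
  shows "proj_fixed UNIV w f"
  unfolding proj_fixed_def
proof (intro ballI allI impI)
  fix z i assume z: "z \<in> incr UNIV (length w)" and i: "i < length w"
  have len: "length z = length w" using z by (simp add: incr_UNIV)
  have all: "euler (length w) (\<lambda>y. kmat w (dual w) z y * f y) = f z" for z
  proof (cases "z \<in> incr UNIV (length w)")
    case False then show ?thesis using assms(2) by (simp add: kmat_on_def)
  qed (rule fx)
  define G where "G t y = (of_bool (rel (w ! i) (z ! i) t) * kmat w (dual w) (z[i := t]) y) * f y" for t y
  define T where "T = S \<union> set z"
  have T: "finite T" using assms(1) by (simp add: T_def ltame_def)
  have k: "of_bool (rel (w ! i) (z ! i) (g t)) * kmat w (dual w) (z[i := g t]) (map g y) =
     (of_bool (rel (w ! i) (z ! i) t) * kmat w (dual w) (z[i := t]) y :: 'k)" if g: "g \<in> autf (set z)" for g t y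
  proof -
    have "map g z = z" using autf_fix[OF g] by (auto intro: map_idI)
    then have "map g (z[i := t]) = z[i := g t]" by (simp add: map_update)
    then have "kmat w (dual w) (z[i := g t]) (map g y) = (kmat w (dual w) (z[i := t]) y :: 'k)"
      using kmat_map[OF autf_empty[OF g], of w "dual w" "z[i := t]" y] by simp
    moreover have "rel (w ! i) (z ! i) (g t) \<longleftrightarrow> rel (w ! i) (z ! i) t"
      using autf_less_fix(1,2)[OF g, of "z ! i" t] i len by (cases "w ! i") (auto simp: not_less[symmetric])
    ultimately show ?thesis by simp
  qed
  have "proj (w ! i) (z ! i) (\<lambda>t. f (z[i := t])) = euler1 (\<lambda>t. euler (length w) (G t))"
    unfolding proj_def G_def
  proof (rule arg_cong[where f=euler1], rule ext)
    fix t show "of_bool (rel (w ! i) (z ! i) t) * f (z[i := t]) =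
      euler (length w) (\<lambda>y. of_bool (rel (w ! i) (z ! i) t) * kmat w (dual w) (z[i := t]) y * f y)"
      using all[of "z[i := t]"] by (cases "rel (w ! i) (z ! i) t") simp_all
  qed
  also have "\<dots> = euler (length w) (\<lambda>y. euler1 (\<lambda>t. G t y))"
  proof (rule euler1_euler_swap[OF T])
    fix g t ts assume g: "g \<in> autf T"
    have "f (map g ts) = f ts" using assms(1) g autf_antimono[of S T] unfolding ltame_def T_def by blast
    moreover have "g \<in> autf (set z)" using g by (auto simp: autf_def T_def)
    ultimately show "G (g t) (map g ts) = G t ts" using k by (simp add: G_def)
  qed
  also have "\<dots> = euler (length w) (\<lambda>y. kmat w (dual w) z y * f y)"
  proof (rule arg_cong[where f="euler (length w)"], rule ext)
    fix y
    have "tame (set z \<union> set y) (\<lambda>t. of_bool (rel (w ! i) (z ! i) t) * kmat w (dual w) (z[i := t]) y :: 'k)"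
      unfolding tame_def
    proof (intro conjI ballI allI)
      fix g t assume g: "g \<in> autf (set z \<union> set y)"
      then have "map g y = y" "g \<in> autf (set z)" by (auto simp: autf_def intro: map_idI)
      then show "of_bool (rel (w ! i) (z ! i) (g t)) * kmat w (dual w) (z[i := g t]) y =
        (of_bool (rel (w ! i) (z ! i) t) * kmat w (dual w) (z[i := t]) y :: 'k)"
        using k[of g t y] by simp
    qed simp
    from euler1_scale[OF this, of "f y"]
    have "euler1 (\<lambda>t. G t y) = f y * proj (w ! i) (z ! i) (\<lambda>t. kmat w (dual w) (z[i := t]) y)"
      by (simp add: G_def proj_def mult.commute)
    then show "euler1 (\<lambda>t. G t y) = kmat w (dual w) z y * f y"
      by (simp add: kmat_proj[OF fits_dual up_UNIV z i] mult.commute)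
  qed
  finally show "proj (w ! i) (z ! i) (\<lambda>t. f (z[i := t])) = f z" using fx[OF z] by simp
qed

section \<open>Morphisms between the objects of two weights\<close>

text \<open>\<open>ker\<close> compares a coordinate with all later ones and \<open>E_mat\<close>
  only with the next; on increasing tuples this makes no difference.\<close>

lemma ker_dual_iff:
  assumes "y \<in> incr UNIV (length w)" "x \<in> incr UNIV (length w)"
  shows "ker w (dual w) y x \<longleftrightarrow>
    (\<forall>i<length w. (w ! i = Bullet \<longrightarrow> y ! i \<le> x ! i) \<and> (w ! i = Circ \<longrightarrow> x ! i \<le> y ! i)) \<and>
    (\<forall>i. Suc i < length w \<longrightarrow> y ! i < x ! Suc i \<and> x ! i < y ! Suc i)"
  using assms
proof (induction w arbitrary: y x)
  case (Cons l w)
  obtain y0 ys where y: "y = y0 # ys" "\<forall>t\<in>set ys. y0 < t" "ys \<in> incr UNIV (length w)"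
    using Cons.prems(1) by (auto simp: incr_Suc)
  obtain x0 xs where x: "x = x0 # xs" "\<forall>t\<in>set xs. x0 < t" "xs \<in> incr UNIV (length w)"
    using Cons.prems(2) by (auto simp: incr_Suc)
  have len: "length ys = length w" "length xs = length w" "sorted_wrt (<) ys" "sorted_wrt (<) xs"
    using y(3) x(3) by (auto simp: incr_UNIV)
  have r: "rel l y0 x0 \<longleftrightarrow> (l = Bullet \<longrightarrow> y0 \<le> x0) \<and> (l = Circ \<longrightarrow> x0 \<le> y0)" by (cases l) auto
  have below: "(\<forall>t\<in>set us. a < t) \<longleftrightarrow> (us \<noteq> [] \<longrightarrow> a < us ! 0)" if "sorted_wrt (<) us" for us and a :: real
    using that by (cases us) auto
  have h: "(\<forall>t\<in>set ys \<union> set xs. y0 < t \<and> x0 < t) \<longleftrightarrow> (0 < length w \<longrightarrow> y0 < xs ! 0 \<and> x0 < ys ! 0)"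
    using y(2) x(2) below[OF len(3), of x0] below[OF len(4), of y0] len by (auto simp del: length_greater_0_conv)
  have s: "(\<forall>i. Suc i < Suc (length w) \<longrightarrow> P i) \<longleftrightarrow> (0 < length w \<longrightarrow> P 0) \<and> (\<forall>i. Suc i < length w \<longrightarrow> P (Suc i))" for P
    by (metis Suc_less_eq less_Suc_eq_0_disj not0_implies_Suc zero_less_Suc)
  have "ker (l # w) (dual (l # w)) y x \<longleftrightarrow> rel l y0 x0 \<and> (0 < length w \<longrightarrow> y0 < xs ! 0 \<and> x0 < ys ! 0) \<and> ker w (dual w) ys xs"
    unfolding y(1) x(1) h[symmetric] by simp
  then show ?case
    unfolding Cons.IH[OF y(3) x(3)] r y(1) x(1) length_Cons s All_less_Suc2
    by (simp only: nth_Cons_0 nth_Cons_Suc conj_ac)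
qed (simp add: incr_UNIV)

lemma E_mat_eq_kmat: "E_mat w = (kmat w (dual w) :: _ \<Rightarrow> _ \<Rightarrow> 'k::field)"
proof (intro ext)
  fix y x
  show "E_mat w y x = (kmat w (dual w) y x :: 'k)"
  proof (cases "y \<in> incr UNIV (length w) \<and> x \<in> incr UNIV (length w)")
    case True
    then show ?thesis using ker_dual_iff[of y w x] by (simp add: E_mat_def kmat_on_def pts_RR)
  next
    case False
    then show ?thesis by (auto simp: E_mat_def kmat_on_def pts_RR)
  qed
qed

lemma E_mat_matrices: "E_mat w \<in> matrices (RR (length w)) (RR (length w))"
  using kmat_matrices[of w "dual w"] by (simp add: E_mat_eq_kmat)

lemma E_mat_left_iff:
  fixes A :: "real list \<Rightarrow> real list \<Rightarrow> 'k::field"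
  assumes A: "A \<in> matrices (RR m) (RR (length w))"
  shows "mcomp (RR (length w)) (E_mat w) A = A \<longleftrightarrow> (\<forall>x. proj_fixed UNIV w (\<lambda>y. A y x))"
proof -
  have e: "mcomp (RR (length w)) (E_mat w) A z x = euler (length w) (\<lambda>y. kmat w (dual w) z y * A y x)" for z x
    using mcomp_RR[OF gset_RR gset_RR A E_mat_matrices] by (simp add: E_mat_eq_kmat)
  have supp: "A y x = 0" if "y \<notin> incr UNIV (length w)" for y x using matrices_supp[OF A] that by (simp add: pts_RR)
  show ?thesis
  proof
    assume m: "mcomp (RR (length w)) (E_mat w) A = A"
    have m': "euler (length w) (\<lambda>y. kmat w (dual w) z y * A y x) = A z x" for z x
      unfolding e[symmetric] m ..
    show "\<forall>x. proj_fixed UNIV w (\<lambda>y. A y x)"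
      by (intro allI fixed_imp_proj_fixed[OF matrices_RR_ltame(1)[OF A] supp m'])
  next
    assume p: "\<forall>x. proj_fixed UNIV w (\<lambda>y. A y x)"
    have "mcomp (RR (length w)) (E_mat w) A z x = A z x" for z x
    proof (cases "z \<in> incr UNIV (length w)")
      case True
      then show ?thesis
        unfolding e using p by (intro proj_fixed_imp_fixed[OF up_UNIV matrices_RR_ltame(1)[OF A] supp _ True]) auto
    next
      case False
      then show ?thesis unfolding e using supp by (simp add: kmat_on_def)
    qed
    then show "mcomp (RR (length w)) (E_mat w) A = A" by blast
  qed
qed

lemma E_mat_right_iff:
  fixes A :: "real list \<Rightarrow> real list \<Rightarrow> 'k::field"
  assumes A: "A \<in> matrices (RR (length w)) (RR m)"
  shows "mcomp (RR (length w)) A (E_mat w) = A \<longleftrightarrow> (\<forall>y. proj_fixed UNIV (dual w) (A y))"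
proof -
  define B where "B x y = A y x" for x y
  have B: "B \<in> matrices (RR m) (RR (length (dual w)))" using A by (auto simp: matrices_RR_iff B_def)
  have "mcomp (RR (length w)) A (E_mat w) z x = mcomp (RR (length (dual w))) (E_mat (dual w)) B x z" for z x
    using mcomp_RR[OF gset_RR gset_RR E_mat_matrices A] mcomp_RR[OF gset_RR gset_RR B E_mat_matrices]
    by (simp add: E_mat_eq_kmat B_def mult.commute kmat_sym[of _ w])
  then have "mcomp (RR (length w)) A (E_mat w) = A \<longleftrightarrow> mcomp (RR (length (dual w))) (E_mat (dual w)) B = B"
    by (auto simp: B_def fun_eq_iff)
  then show ?thesis using E_mat_left_iff[OF B] by (simp add: B_def[abs_def])
qed

lemma Hom_M_iff:
  "A \<in> Hom (M_obj \<alpha>) (M_obj \<beta>) \<longleftrightarrow> A \<in> matrices (RR (length \<alpha>)) (RR (length \<beta>)) \<and>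
     (\<forall>x. proj_fixed UNIV \<beta> (\<lambda>y. A y x)) \<and> (\<forall>y. proj_fixed UNIV (dual \<alpha>) (A y))"
  using E_mat_left_iff[of A "length \<alpha>" \<beta>] E_mat_right_iff[of A \<alpha> "length \<beta>"]
  by (auto simp: Hom_def M_obj_def)

lemma kmat_Hom:
  assumes "fits \<beta> (dual \<alpha>)"
  shows "kmat \<beta> (dual \<alpha>) \<in> Hom (M_obj \<alpha>) (M_obj \<beta>)"
proof -
  have "fits (dual \<alpha>) \<beta>" using assms fits_sym by blast
  then show ?thesis
    unfolding Hom_M_iff proj_fixed_def using kmat_matrices[of \<beta> "dual \<alpha>"] kmat_proj[OF assms up_UNIV]
      kmat_proj[of "dual \<alpha>" \<beta> UNIV] by (auto simp: kmat_sym[of _ \<beta>])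
qed

lemma object_M: "object (M_obj w)"
  using kmat_Hom[OF fits_dual, of w] E_mat_matrices
  by (simp add: object_def M_obj_def gset_RR Hom_def E_mat_eq_kmat)

section \<open>Classification of the morphisms\<close>

lemma autf_le_fix: "g \<in> autf S \<Longrightarrow> s \<in> S \<Longrightarrow> s \<le> g u \<longleftrightarrow> s \<le> u" "g \<in> autf S \<Longrightarrow> s \<in> S \<Longrightarrow> g u \<le> s \<longleftrightarrow> u \<le> s"
  by (metis autf_fix autf_le)+

text \<open>Subtracting the two conditions leaves the integral over the half-open interval from
  \<open>t\<close> to \<open>a\<close>, on which \<open>\<phi>\<close> is constant; its measure is
  0.\<close>

lemma proj_left_const:
  assumes T: "tame T \<phi>" and a: "t < a" "T \<inter> {t..<a} = {}"
    and p: "proj Bullet t \<phi> = \<phi> t" "proj Bullet a \<phi> = (\<phi> a :: 'k::field)"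
  shows "\<phi> t = \<phi> a"
proof -
  have c: "\<phi> u = \<phi> t" if "t \<le> u" "u < a" for u
  proof -
    have "T \<inter> {t..u} = {}" using a(2) that by (auto simp: disjoint_iff)
    then show ?thesis using tame_constant_on[OF T that(1)] by simp
  qed
  have fin: "finite (insert t (insert a T))" using T by (simp add: tame_def)
  have T': "tame (insert t (insert a T)) \<phi>" using tame_mono[OF T _ fin] by blast
  have "proj Bullet t \<phi> - proj Bullet a \<phi> = euler1 (\<lambda>u. of_bool (t \<le> u) * \<phi> u - of_bool (a \<le> u) * \<phi> u)"
    unfolding proj_def rel.simps
    by (intro euler1_diff[symmetric, of "insert t (insert a T)"] tame_mult tame_atLeast T' fin) auto
  also have "(\<lambda>u. of_bool (t \<le> u) * \<phi> u - of_bool (a \<le> u) * \<phi> u) = (\<lambda>u. \<phi> t * of_bool (t \<le> u \<and> u < a))"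
  proof
    fix u show "of_bool (t \<le> u) * \<phi> u - of_bool (a \<le> u) * \<phi> u = \<phi> t * of_bool (t \<le> u \<and> u < a)"
      using c[of u] a(1) by (cases "t \<le> u"; cases "u < a") simp_all
  qed
  also have "euler1 \<dots> = \<phi> t * euler1 (\<lambda>u. of_bool (t \<le> u \<and> u < a))"
    by (rule euler1_scale[of "{t, a}"]) (simp add: tame_def autf_less_fix autf_le_fix)
  finally show ?thesis using p a(1) by (simp add: euler1_interval)
qed

text \<open>Since \<open>\<phi>\<close> vanishes from \<open>r\<close> on, the condition equates
  \<open>\<phi> a\<close> with a multiple of the measure of a half-open interval.\<close>

lemma proj_left_zero:
  assumes T: "tame T \<phi>" and a: "a < r" "T \<inter> {a..<r} = {}" and z: "\<And>u. r \<le> u \<Longrightarrow> \<phi> u = 0"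
    and p: "proj Bullet a \<phi> = (\<phi> a :: 'k::field)"
  shows "\<phi> a = 0"
proof -
  have c: "\<phi> u = \<phi> a" if "a \<le> u" "u < r" for u
  proof -
    have "T \<inter> {a..u} = {}" using a(2) that by (auto simp: disjoint_iff)
    then show ?thesis using tame_constant_on[OF T that(1)] by simp
  qed
  have "proj Bullet a \<phi> = euler1 (\<lambda>u. \<phi> a * of_bool (a \<le> u \<and> u < r))"
    unfolding proj_def rel.simps
  proof (rule arg_cong[where f=euler1], rule ext)
    fix u show "of_bool (a \<le> u) * \<phi> u = \<phi> a * of_bool (a \<le> u \<and> u < r)"
      using c[of u] z[of u] by (cases "a \<le> u"; cases "u < r") simp_all
  qed
  also have "\<dots> = \<phi> a * euler1 (\<lambda>u. of_bool (a \<le> u \<and> u < r))"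
    by (rule euler1_scale[of "{a, r}"]) (simp add: tame_def autf_less_fix autf_le_fix)
  finally show ?thesis using p a(1) by (simp add: euler1_interval)
qed

lemma proj_right_const:
  assumes T: "tame T \<phi>" and a: "a < t" "T \<inter> {a<..t} = {}"
    and p: "proj Circ t \<phi> = \<phi> t" "proj Circ a \<phi> = (\<phi> a :: 'k::field)"
  shows "\<phi> t = \<phi> a"
proof -
  have c: "\<phi> u = \<phi> t" if "a < u" "u \<le> t" for u
  proof -
    have "T \<inter> {u..t} = {}" using a(2) that by (auto simp: disjoint_iff)
    then show ?thesis using tame_constant_on[OF T that(2)] by simp
  qed
  have fin: "finite (insert t (insert a T))" using T by (simp add: tame_def)
  have T': "tame (insert t (insert a T)) \<phi>" using tame_mono[OF T _ fin] by blast
  have "tame (insert t (insert a T)) (\<lambda>u. of_bool (u \<le> t) :: 'k)" "tame (insert t (insert a T)) (\<lambda>u. of_bool (u \<le> a) :: 'k)"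
    using fin by (simp_all add: tame_def autf_less_fix autf_le_fix)
  then have "proj Circ t \<phi> - proj Circ a \<phi> = euler1 (\<lambda>u. of_bool (u \<le> t) * \<phi> u - of_bool (u \<le> a) * \<phi> u)"
    unfolding proj_def rel.simps
    by (intro euler1_diff[symmetric, of "insert t (insert a T)"] tame_mult T')
  also have "(\<lambda>u. of_bool (u \<le> t) * \<phi> u - of_bool (u \<le> a) * \<phi> u) = (\<lambda>u. \<phi> t * of_bool (a < u \<and> u \<le> t))"
  proof
    fix u show "of_bool (u \<le> t) * \<phi> u - of_bool (u \<le> a) * \<phi> u = \<phi> t * of_bool (a < u \<and> u \<le> t)"
      using c[of u] a(1) by (cases "a < u"; cases "u \<le> t") simp_all
  qed
  also have "euler1 \<dots> = \<phi> t * euler1 (\<lambda>u. of_bool (a < u \<and> u \<le> t))"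
    by (rule euler1_scale[of "{t, a}"]) (simp add: tame_def autf_less_fix autf_le_fix)
  finally show ?thesis using p a(1) by (simp add: euler1_interval)
qed

lemma proj_right_zero:
  assumes T: "tame T \<phi>" and a: "l < a" "T \<inter> {l<..a} = {}" and z: "\<And>u. u \<le> l \<Longrightarrow> \<phi> u = 0"
    and p: "proj Circ a \<phi> = (\<phi> a :: 'k::field)"
  shows "\<phi> a = 0"
proof -
  have c: "\<phi> u = \<phi> a" if "l < u" "u \<le> a" for u
  proof -
    have "T \<inter> {u..a} = {}" using a(2) that by (auto simp: disjoint_iff)
    then show ?thesis using tame_constant_on[OF T that(2)] by simp
  qed
  have "proj Circ a \<phi> = euler1 (\<lambda>u. \<phi> a * of_bool (l < u \<and> u \<le> a))"
    unfolding proj_def rel.simps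
  proof (rule arg_cong[where f=euler1], rule ext)
    fix u show "of_bool (u \<le> a) * \<phi> u = \<phi> a * of_bool (l < u \<and> u \<le> a)"
      using c[of u] z[of u] by (cases "l < u"; cases "u \<le> a") simp_all
  qed
  also have "\<dots> = \<phi> a * euler1 (\<lambda>u. of_bool (l < u \<and> u \<le> a))"
    by (rule euler1_scale[of "{l, a}"]) (simp add: tame_def autf_less_fix autf_le_fix)
  finally show ?thesis using p a(1) by (simp add: euler1_interval)
qed

text \<open>The closed ray to the left has measure 0. There is no counterpart for
  \<open>Bullet\<close>, as the closed ray to the right has measure 1; this is why a last
  \<open>Bullet\<close> may remain unmatched.\<close>

lemma proj_right_zero_unbounded:
  assumes T: "tame T \<phi>" and a: "T \<inter> {..a} = {}" and p: "proj Circ a \<phi> = (\<phi> a :: 'k::field)"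
  shows "\<phi> a = 0"
proof -
  have c: "\<phi> u = \<phi> a" if "u \<le> a" for u
  proof -
    have "T \<inter> {u..a} = {}" using a that by (auto simp: disjoint_iff)
    then show ?thesis using tame_constant_on[OF T that] by simp
  qed
  have "proj Circ a \<phi> = euler1 (\<lambda>u. \<phi> a * of_bool (u \<le> a))"
    unfolding proj_def rel.simps
  proof (rule arg_cong[where f=euler1], rule ext)
    fix u show "of_bool (u \<le> a) * \<phi> u = \<phi> a * of_bool (u \<le> a)"
      using c[of u]  by (cases "u \<le> a") simp_all
  qed
  also have "\<dots> = \<phi> a * euler1 (\<lambda>u. of_bool (u \<le> a))"
    by (rule euler1_scale[of "{a}"]) (simp add: tame_def autf_less_fix autf_le_fix)
  finally show ?thesis using p by (simp add: euler1_atMost)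
qed

text \<open>The combinatorial content of being fixed, where \<open>T\<close> is meant to be the
  other tuple. A \<open>Bullet\<close> may move left and a \<open>Circ\<close> right as long as no
  point of \<open>T\<close> is met; the start may lie in \<open>T\<close>, the end may not. The
  value is 0 if no point of \<open>T\<close> separates a \<open>Bullet\<close> from its successor,
  or a \<open>Circ\<close> from its predecessor or from the lower end of \<open>U\<close>; a point
  of \<open>T\<close> at the coordinate itself counts as separating, one at the neighbour does
  not.\<close>

definition stepwise :: "real set \<Rightarrow> weight \<Rightarrow> real set \<Rightarrow> (real list \<Rightarrow> 'k::zero) \<Rightarrow> bool" where
  "stepwise U w T f \<longleftrightarrow> (\<forall>z\<in>incr U (length w). \<forall>i<length w.
     (\<forall>t. w ! i = Bullet \<and> t < z ! i \<and> z[i := t] \<in> incr U (length w) \<and> T \<inter> {t..<z ! i} = {} \<longrightarrow> f (z[i := t]) = f z) \<and>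
     (w ! i = Bullet \<and> Suc i < length w \<and> T \<inter> {z ! i..<z ! Suc i} = {} \<longrightarrow> f z = 0) \<and>
     (\<forall>t. w ! i = Circ \<and> z ! i < t \<and> z[i := t] \<in> incr U (length w) \<and> T \<inter> {z ! i<..t} = {} \<longrightarrow> f (z[i := t]) = f z) \<and>
     (w ! i = Circ \<and> T \<inter> {l \<in> U. (0 < i \<longrightarrow> z ! (i - 1) < l) \<and> l \<le> z ! i} = {} \<longrightarrow> f z = 0))"

lemma stepwiseD:
  assumes "stepwise U w T f" "z \<in> incr U (length w)" "i < length w"
  shows "w ! i = Bullet \<Longrightarrow> t < z ! i \<Longrightarrow> z[i := t] \<in> incr U (length w) \<Longrightarrow> T \<inter> {t..<z ! i} = {} \<Longrightarrow> f (z[i := t]) = f z"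
    and "w ! i = Bullet \<Longrightarrow> Suc i < length w \<Longrightarrow> T \<inter> {z ! i..<z ! Suc i} = {} \<Longrightarrow> f z = 0"
    and "w ! i = Circ \<Longrightarrow> z ! i < t \<Longrightarrow> z[i := t] \<in> incr U (length w) \<Longrightarrow> T \<inter> {z ! i<..t} = {} \<Longrightarrow> f (z[i := t]) = f z"
    and "w ! i = Circ \<Longrightarrow> T \<inter> {l \<in> U. (0 < i \<longrightarrow> z ! (i - 1) < l) \<and> l \<le> z ! i} = {} \<Longrightarrow> f z = 0"
  using assms unfolding stepwise_def by blast+

lemma stepwise_proj_fixed:
  assumes f: "ltame T f" "\<And>y. y \<notin> incr UNIV (length w) \<Longrightarrow> f y = (0::'k::field)" and p: "proj_fixed UNIV w f"
  shows "stepwise UNIV w T f"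
  unfolding stepwise_def
proof (intro ballI allI impI)
  fix z i assume z: "z \<in> incr UNIV (length w)" and i: "i < length w"
  have len: "length z = length w" and sorted: "sorted_wrt (<) z" using z by (auto simp: incr_UNIV)
  have less: "z ! j < z ! k" if "j < k" "k < length w" for j k
    using sorted_wrt_nth_less[OF sorted] that len by simp
  define \<phi> where "\<phi> t = f (z[i := t])" for t
  define R where "R = {z ! j | j. j < length w \<and> j \<noteq> i}"
  have finT: "finite (T \<union> R)" using f(1) by (auto simp: ltame_def R_def)
  have tm: "tame (T \<union> R) \<phi>"
    unfolding tame_def
  proof (intro conjI ballI allI finT)
    fix g t assume g: "g \<in> autf (T \<union> R)"
    have "map g (z[i := t]) = z[i := g t]"
    proof (rule nth_equalityI)
      fix j assume "j < length (map g (z[i := t]))"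
      then have j: "j < length w" using len by simp
      then have "j \<noteq> i \<Longrightarrow> g (z ! j) = z ! j" using autf_fix[OF g, of "z ! j"] by (auto simp: R_def)
      then show "map g (z[i := t]) ! j = z[i := g t] ! j" using j len by (cases "j = i") auto
    qed simp
    moreover have "g \<in> autf T" using g by (auto simp: autf_def)
    then have "f (map g (z[i := t])) = f (z[i := t])" using f(1) by (auto simp: ltame_def)
    ultimately show "\<phi> (g t) = \<phi> t" by (simp add: \<phi>_def)
  qed
  have self: "\<phi> (z ! i) = f z" by (simp add: \<phi>_def)
  have pz: "proj (w ! i) (z ! i) \<phi> = \<phi> (z ! i)" using proj_fixedD[OF p z i] self by (simp add: \<phi>_def[abs_def])
  have pt: "proj (w ! i) t \<phi> = \<phi> t" if "z[i := t] \<in> incr UNIV (length w)" for t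
    using proj_fixedD[OF p that i] i len by (simp add: \<phi>_def[abs_def])
  have between: "z ! j < t" if "z[i := t] \<in> incr UNIV (length w)" "j < i" for j t
  proof -
    have "z[i := t] ! j < z[i := t] ! i"
      using that i len by (intro sorted_wrt_nth_less[of "(<)"]) (auto simp: incr_UNIV)
    then show ?thesis using that(2) i len by simp
  qed
  have between': "t < z ! j" if "z[i := t] \<in> incr UNIV (length w)" "i < j" "j < length w" for j t
  proof -
    have "z[i := t] ! i < z[i := t] ! j"
      using that i len by (intro sorted_wrt_nth_less[of "(<)"]) (auto simp: incr_UNIV)
    then show ?thesis using that(2) i len by simp
  qed
  have notin: "u \<notin> R" if "\<And>j. j < i \<Longrightarrow> z ! j < u" "\<And>j. i < j \<Longrightarrow> j < length w \<Longrightarrow> u < z ! j" for u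
  proof
    assume "u \<in> R"
    then obtain j where j: "u = z ! j" "j < length w" "j \<noteq> i" by (auto simp: R_def)
    then show False using that(1)[of j] that(2)[of j] by (cases "j < i") auto
  qed
  have zero: "\<phi> u = 0" if "j < i \<and> u \<le> z ! j \<or> i < j \<and> j < length w \<and> z ! j \<le> u" for u j
  proof -
    have "z[i := u] \<notin> incr UNIV (length w)" using that between[of u j] between'[of u j] by auto
    then show ?thesis using f(2) by (simp add: \<phi>_def)
  qed
  show "(\<forall>t. w ! i = Bullet \<and> t < z ! i \<and> z[i := t] \<in> incr UNIV (length w) \<and> T \<inter> {t..<z ! i} = {} \<longrightarrow> f (z[i := t]) = f z) \<and>
     (w ! i = Bullet \<and> Suc i < length w \<and> T \<inter> {z ! i..<z ! Suc i} = {} \<longrightarrow> f z = 0) \<and>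
     (\<forall>t. w ! i = Circ \<and> z ! i < t \<and> z[i := t] \<in> incr UNIV (length w) \<and> T \<inter> {z ! i<..t} = {} \<longrightarrow> f (z[i := t]) = f z) \<and>
     (w ! i = Circ \<and> T \<inter> {l \<in> UNIV. (0 < i \<longrightarrow> z ! (i - 1) < l) \<and> l \<le> z ! i} = {} \<longrightarrow> f z = 0)"
  proof (intro conjI allI impI; elim conjE)
    fix t assume a: "w ! i = Bullet" "t < z ! i" "z[i := t] \<in> incr UNIV (length w)" "T \<inter> {t..<z ! i} = {}"
    have "u \<notin> R" if "t \<le> u" "u < z ! i" for u
      by (rule notin) (use between[OF a(3)] less that in \<open>force+\<close>)
    then have "(T \<union> R) \<inter> {t..<z ! i} = {}" using a(4) by (auto simp: disjoint_iff)
    then show "f (z[i := t]) = f z"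
      using proj_left_const[OF tm a(2)] pz pt[OF a(3)] a(1) self by (simp add: \<phi>_def)
  next
    assume a: "w ! i = Bullet" "Suc i < length w" "T \<inter> {z ! i..<z ! Suc i} = {}"
    have "u \<notin> R" if u: "z ! i \<le> u" "u < z ! Suc i" for u
    proof (rule notin)
      show "z ! j < u" if "j < i" for j using less[OF that i] u by simp
      show "u < z ! j" if "i < j" "j < length w" for j
        using u less[of "Suc i" j] that by (cases "j = Suc i") auto
    qed
    then have "(T \<union> R) \<inter> {z ! i..<z ! Suc i} = {}" using a(3) by (auto simp: disjoint_iff)
    then show "f z = 0"
      using proj_left_zero[OF tm less[of i "Suc i"]] pz a self zero[of "Suc i"] by simp
  next
    fix t assume a: "w ! i = Circ" "z ! i < t" "z[i := t] \<in> incr UNIV (length w)" "T \<inter> {z ! i<..t} = {}"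
    have "u \<notin> R" if "z ! i < u" "u \<le> t" for u
      by (rule notin) (use between'[OF a(3)] less i that in \<open>force+\<close>)
    then have "(T \<union> R) \<inter> {z ! i<..t} = {}" using a(4) by (auto simp: disjoint_iff)
    then show "f (z[i := t]) = f z"
      using proj_right_const[OF tm a(2)] pz pt[OF a(3)] a(1) self by (simp add: \<phi>_def)
  next
    assume a: "w ! i = Circ" "T \<inter> {l \<in> UNIV. (0 < i \<longrightarrow> z ! (i - 1) < l) \<and> l \<le> z ! i} = {}"
    show "f z = 0"
    proof (cases "i = 0")
      case True
      have "u \<notin> R" if "u \<le> z ! i" for u
        by (rule notin) (use less i True that in \<open>force+\<close>)
      then have "(T \<union> R) \<inter> {..z ! i} = {}" using a(2) True by (auto simp: disjoint_iff)
      then show ?thesis using proj_right_zero_unbounded[OF tm, of "z ! i"] pz a(1) self by simp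
    next
      case False
      have "u \<notin> R" if u: "z ! (i - 1) < u" "u \<le> z ! i" for u
      proof (rule notin)
        show "z ! j < u" if "j < i" for j
        proof (cases "j = i - 1")
          case False
          then have "j < i - 1" "i - 1 < length w" using that i by auto
          then show ?thesis using less[of j "i - 1"] u(1) by simp
        qed (use u in simp)
        show "u < z ! j" if "i < j" "j < length w" for j using less[OF that] u by simp
      qed
      then have "(T \<union> R) \<inter> {z ! (i - 1)<..z ! i} = {}" using a(2) False by (auto simp: disjoint_iff)
      moreover have "z ! (i - 1) < z ! i" using less[of "i - 1" i] False i by simp
      moreover have "\<phi> u = 0" if "u \<le> z ! (i - 1)" for u using zero[of "i - 1" u] that False by simp
      ultimately show ?thesis using proj_right_zero[OF tm, of "z ! (i - 1)" "z ! i"] pz a(1) self by simp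
    qed
  qed
qed

lemma stepwise_left: "stepwise U (Bullet # w) T f \<Longrightarrow> up U \<Longrightarrow> y # ys \<in> incr U (Suc (length w)) \<Longrightarrow> t < y \<Longrightarrow> t \<in> U \<Longrightarrow>
    T \<inter> {t..<y} = {} \<Longrightarrow> f (t # ys) = f (y # ys)"
  using stepwiseD(1)[of U "Bullet # w" T f "y # ys" 0 t] by (force simp: incr_Cons)

lemma stepwise_left_zero: "stepwise U (Bullet # w) T f \<Longrightarrow> y # y' # ys \<in> incr U (Suc (length w)) \<Longrightarrow>
    T \<inter> {y..<y'} = {} \<Longrightarrow> f (y # y' # ys) = 0"
  using stepwiseD(2)[of U "Bullet # w" T f "y # y' # ys" 0] by (cases w) (auto simp: incr_Cons)

lemma stepwise_right: "stepwise U (Circ # w) T f \<Longrightarrow> up U \<Longrightarrow> y # ys \<in> incr U (Suc (length w)) \<Longrightarrow> y < t \<Longrightarrow>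
    \<forall>u\<in>set ys. t < u \<Longrightarrow> T \<inter> {y<..t} = {} \<Longrightarrow> f (t # ys) = f (y # ys)"
  using stepwiseD(3)[of U "Circ # w" T f "y # ys" 0 t] up_mem[of U y t] by (auto simp: incr_Cons)

lemma stepwise_right_zero: "stepwise U (Circ # w) T f \<Longrightarrow> y # ys \<in> incr U (Suc (length w)) \<Longrightarrow>
    (\<And>u. u \<in> T \<Longrightarrow> u \<in> U \<Longrightarrow> y < u) \<Longrightarrow> f (y # ys) = 0"
  using stepwiseD(4)[of U "Circ # w" T f "y # ys" 0] by (force simp: disjoint_iff)

definition bistepwise :: "real set \<Rightarrow> weight \<Rightarrow> weight \<Rightarrow> (real list \<Rightarrow> real list \<Rightarrow> 'k::zero) \<Rightarrow> bool" where
  "bistepwise U \<beta> \<gamma> B \<longleftrightarrow>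
     (\<forall>xs\<in>incr U (length \<gamma>). stepwise U \<beta> (set xs) (\<lambda>ys. B ys xs)) \<and>
     (\<forall>ys\<in>incr U (length \<beta>). stepwise U \<gamma> (set ys) (B ys))"

lemma bistepwiseD:
  assumes "bistepwise U \<beta> \<gamma> B"
  shows "xs \<in> incr U (length \<gamma>) \<Longrightarrow> stepwise U \<beta> (set xs) (\<lambda>ys. B ys xs)"
    and "ys \<in> incr U (length \<beta>) \<Longrightarrow> stepwise U \<gamma> (set ys) (B ys)"
  using assms by (auto simp: bistepwise_def)

lemma bistepwise_sym: "bistepwise U \<beta> \<gamma> B \<Longrightarrow> bistepwise U \<gamma> \<beta> (\<lambda>xs ys. B ys xs)"
  by (simp add: bistepwise_def)

text \<open>Because \<open>fits\<close> stands inside the factor, the same statement says that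
  \<open>B\<close> vanishes on \<open>U\<close> when the words do not fit.\<close>

definition kernel_multiple :: "real set \<Rightarrow> weight \<Rightarrow> weight \<Rightarrow> (real list \<Rightarrow> real list \<Rightarrow> 'k::field) \<Rightarrow> bool" where
  "kernel_multiple U \<beta> \<gamma> B \<longleftrightarrow> (\<exists>c. \<forall>ys\<in>incr U (length \<beta>). \<forall>xs\<in>incr U (length \<gamma>).
     B ys xs = c * of_bool (fits \<beta> \<gamma> \<and> ker \<beta> \<gamma> ys xs))"

lemma kernel_multiple_sym: "kernel_multiple U \<beta> \<gamma> B \<Longrightarrow> kernel_multiple U \<gamma> \<beta> (\<lambda>xs ys. B ys xs)"
  unfolding kernel_multiple_def using ker_sym[of \<beta> \<gamma>] fits_sym[of \<beta> \<gamma>] by auto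

section \<open>Elimination of the leading coordinates, by the pair of leading letters\<close>

lemma ex_between: "finite T \<Longrightarrow> (\<And>u. u \<in> T \<Longrightarrow> (y::real) < u) \<Longrightarrow> \<exists>t>y. \<forall>u\<in>T. t < u"
proof (cases "T = {}")
  case False
  assume "finite T" "\<And>u. u \<in> T \<Longrightarrow> y < u"
  then have "y < Min T" using False by simp
  then obtain t where "y < t" "t < Min T" using dense by blast
  then show ?thesis using \<open>finite T\<close> by (intro exI[of _ t]) (auto intro: order.strict_trans2)
qed (use gt_ex in auto)

text \<open>Besides showing that kernels are not zero, this supplies a reference point, beyond any
  given bound, at which constants can be compared.\<close>

lemma kernel_point: "fits \<beta> \<gamma> \<Longrightarrow> \<exists>ys\<in>incr {m<..} (length \<beta>). \<exists>xs\<in>incr {m<..} (length \<gamma>). ker \<beta> \<gamma> ys xs"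
proof (induction \<beta> \<gamma> arbitrary: m rule: fits.induct)
  case (1 b \<beta> g \<gamma>)
  show ?case
  proof (cases "b = g")
    case True
    then have "\<beta> = []" "\<gamma> = []" using "1.prems" by (auto split: if_splits)
    then show ?thesis using True by (intro bexI[of _ "[m + 1]"]) (auto simp: incr_Cons)
  next
    case False
    then obtain ys xs where "ys \<in> incr {m + 1<..} (length \<beta>)" "xs \<in> incr {m + 1<..} (length \<gamma>)" "ker \<beta> \<gamma> ys xs"
      using "1.IH"[of "m + 1"] "1.prems" by auto
    moreover have "rel b (m + 1) (m + 1)" by (cases b) auto
    ultimately show ?thesis
      by (intro bexI[of _ "(m + 1) # ys"] bexI[of _ "(m + 1) # xs"]) (auto simp: incr_def subset_iff)
  qed
next
  case (2 \<gamma>)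
  moreover have "[m + 1] \<in> incr {m<..} (Suc 0)" by (simp add: incr_Cons)
  ultimately show ?case by auto
next
  case (3 b \<beta>)
  moreover have "[m + 1] \<in> incr {m<..} (Suc 0)" by (simp add: incr_Cons)
  ultimately show ?case by auto
qed

text \<open>With an empty second tuple nothing blocks a move and nothing separates coordinates, so
  only the empty word and a single \<open>Bullet\<close> admit a non-zero value.\<close>

lemma kernel_multiple_Nil:
  assumes U: "up U" and B: "bistepwise U \<beta> [] B"
  shows "kernel_multiple U \<beta> [] B"
proof (cases \<beta>)
  case Nil
  then show ?thesis by (auto simp: kernel_multiple_def)
next
  case (Cons b \<beta>')
  have s: "stepwise U (b # \<beta>') {} (\<lambda>ys. B ys [])" using B Cons by (simp add: bistepwise_def)
  show ?thesis
  proof (cases b)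
    case Circ
    have "B ys [] = 0" if ys: "ys \<in> incr U (Suc (length \<beta>'))" for ys
    proof -
      obtain y zs where "ys = y # zs" using ys by (auto simp: incr_Suc)
      then show ?thesis using stepwise_right_zero[of U \<beta>' "{}" "\<lambda>ys. B ys []" y zs] s Circ ys by simp
    qed
    then show ?thesis using Cons by (auto simp: kernel_multiple_def)
  next
    case Bullet
    show ?thesis
    proof (cases \<beta>')
      case (Cons b' \<beta>'')
      have "B ys [] = 0" if ys: "ys \<in> incr U (Suc (length \<beta>'))" for ys
      proof -
        obtain y y' zs where "ys = y # y' # zs" using ys Cons by (auto simp: incr_Suc)
        then show ?thesis using stepwise_left_zero[of U \<beta>' "{}" "\<lambda>ys. B ys []" y y' zs] s Bullet ys by simp
      qed
      then show ?thesis using \<open>\<beta> = b # \<beta>'\<close> Cons by (auto simp: kernel_multiple_def)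
    next
      case Nil
      have eq: "B [t] [] = B [y] []" if "t \<in> U" "y \<in> U" "t < y" for t y
        using stepwise_left[of U "[]" "{}" "\<lambda>ys. B ys []" y "[]" t] s Bullet Nil that U by (simp add: incr_Cons)
      have "B ys [] = B [SOME u. u \<in> U] []" if ys: "ys \<in> incr U (Suc 0)" for ys
      proof -
        obtain y where y: "ys = [y]" "y \<in> U" using ys by (auto simp: incr_Suc)
        define u where "u = (SOME u. u \<in> U)"
        have u: "u \<in> U" unfolding u_def using y(2) by (rule someI)
        have "B [y] [] = B [u] []"
          using eq[OF u y(2)] eq[OF y(2) u] by (cases y u rule: linorder_cases) simp_all
        then show ?thesis by (simp add: y(1) u_def)
      qed
      then show ?thesis using \<open>\<beta> = b # \<beta>'\<close> Nil Bullet
        by (auto simp: kernel_multiple_def intro!: exI[of _ "B [SOME u. u \<in> U] []"])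
    qed
  qed
qed

text \<open>The smaller of the two leading coordinates has no point of the other tuple at or below
  it. If they are equal, one is first pushed slightly to the right.\<close>

lemma Circ_Circ_zero:
  assumes U: "up U" and B: "bistepwise U (Circ # \<beta>) (Circ # \<gamma>) B"
    and ys: "y # ys \<in> incr U (Suc (length \<beta>))" and xs: "x # xs \<in> incr U (Suc (length \<gamma>))"
  shows "B (y # ys) (x # xs) = 0"
proof -
  have sy: "stepwise U (Circ # \<beta>) (set (x # xs)) (\<lambda>ys. B ys (x # xs))" if "x # xs \<in> incr U (Suc (length \<gamma>))" for x xs
    by (rule bistepwiseD(1)[OF B]) (use that in simp)
  have sx: "stepwise U (Circ # \<gamma>) (set (y # ys)) (B (y # ys))" if "y # ys \<in> incr U (Suc (length \<beta>))" for y ys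
    by (rule bistepwiseD(2)[OF B]) (use that in simp)
  have xy: "B (y # ys) (x # xs) = 0" if "x < y" "y # ys \<in> incr U (Suc (length \<beta>))" for y
    by (rule stepwise_right_zero[OF sx[OF that(2)] xs]) (use that in \<open>auto simp: incr_Cons\<close>)
  consider "y < x" | "x < y" | "y = x" by linarith
  then show ?thesis
  proof cases
    case 1
    show ?thesis
      by (rule stepwise_right_zero[OF sy[OF xs] ys]) (use 1 xs in \<open>auto simp: incr_Cons\<close>)
  next
    case 2 then show ?thesis using xy ys by blast
  next
    case 3
    obtain t where t: "y < t" "\<forall>u\<in>set ys \<union> set xs. t < u"
      using ex_between[of "set ys \<union> set xs" y] ys xs 3 by (auto simp: incr_Cons)
    have "B (t # ys) (x # xs) = B (y # ys) (x # xs)"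
      by (rule stepwise_right[OF sy[OF xs] U ys t(1)]) (use t 3 in \<open>auto simp: disjoint_iff ball_Un\<close>)
    moreover have "t # ys \<in> incr U (Suc (length \<beta>))"
      using ys t up_mem[OF U, of y t] by (auto simp: incr_Cons)
    ultimately show ?thesis using xy[of t] t 3 by simp
  qed
qed

text \<open>From a common position either leading \<open>Bullet\<close> can move left without
  changing the value. If there are further letters, then once the other head has moved away nothing
  separates a leading \<open>Bullet\<close> from the nearest next coordinate, and the value is
  0.\<close>

lemma kernel_multiple_Bullet_Bullet:
  assumes U: "up U" and B: "bistepwise U (Bullet # \<beta>) (Bullet # \<gamma>) B"
  shows "kernel_multiple U (Bullet # \<beta>) (Bullet # \<gamma>) B"
proof -
  let ?Y = "\<lambda>ys. ys \<in> incr U (Suc (length \<beta>))" and ?X = "\<lambda>xs. xs \<in> incr U (Suc (length \<gamma>))"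
  have sy: "stepwise U (Bullet # \<beta>) (set (x # xs)) (\<lambda>ys. B ys (x # xs))" if "?X (x # xs)" for x xs
    by (rule bistepwiseD(1)[OF B]) (use that in simp)
  have sx: "stepwise U (Bullet # \<gamma>) (set (y # ys)) (B (y # ys))" if "?Y (y # ys)" for y ys
    by (rule bistepwiseD(2)[OF B]) (use that in simp)
  have lift: "B (y # ys) (x # xs) = B (max y x # ys) (max y x # xs)"
    if ys: "?Y (y # ys)" and xs: "?X (x # xs)" and lt: "\<forall>u\<in>set ys \<union> set xs. y < u \<and> x < u" for y ys x xs
  proof -
    consider "y < x" | "x < y" | "y = x" by linarith
    then show ?thesis
    proof cases
      case 1
      have "?Y (x # ys)" using ys xs lt by (auto simp: incr_Cons)
      then have "B (y # ys) (x # xs) = B (x # ys) (x # xs)"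
        using 1 ys lt by (intro stepwise_left[OF sy[OF xs] U]) (auto simp: incr_Cons disjoint_iff ball_Un)
      then show ?thesis using 1 by (simp add: max_def)
    next
      case 2
      have "?X (y # xs)" using ys xs lt by (auto simp: incr_Cons)
      then have "B (y # ys) (x # xs) = B (y # ys) (y # xs)"
        using 2 xs lt by (intro stepwise_left[OF sx[OF ys] U]) (auto simp: incr_Cons disjoint_iff ball_Un)
      then show ?thesis using 2 by (simp add: max_def)
    qed simp
  qed
  have lowY: "B (s # ys) (m # xs) = B (m # ys) (m # xs)" and lowX: "B (m # ys) (s # xs) = B (m # ys) (m # xs)"
    if m: "?Y (m # ys)" "?X (m # xs)" and s: "s < m" "s \<in> U" for m ys xs s
  proof -
    show "B (s # ys) (m # xs) = B (m # ys) (m # xs)"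
      using m s by (intro stepwise_left[OF sy[OF m(2)] U]) (auto simp: incr_Cons disjoint_iff ball_Un)
    show "B (m # ys) (s # xs) = B (m # ys) (m # xs)"
      using m s by (intro stepwise_left[OF sx[OF m(1)] U]) (auto simp: incr_Cons disjoint_iff ball_Un)
  qed
  show ?thesis
  proof (cases "\<beta> = [] \<and> \<gamma> = []")
    case True
    have diag: "B [m] [m] = B [m'] [m']" if m: "m \<in> U" "m' \<in> U" "m < m'" for m m'
    proof -
      obtain s where s: "s < m" "s \<in> U" using up_below[OF U m(1)] by blast
      have mem: "?Y [u]" "?X [u]" if "u \<in> U" for u using that True by (auto simp: incr_Cons)
      \<comment> \<open>With the first coordinate out of the way at \<open>s < m\<close>, the second
        passes from \<open>m'\<close> to \<open>m\<close> unhindered.\<close>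
      have "B [s] [m] = B [s] [m']"
        using m s mem True by (intro stepwise_left[OF sx[of s "[]"] U]) (auto simp: disjoint_iff)
      then show ?thesis using lowY[of m "[]" "[]" s] lowY[of m' "[]" "[]" s] mem m s by simp
    qed
    have "B ys xs = B [SOME u. u \<in> U] [SOME u. u \<in> U]" if mem: "?Y ys" "?X xs" for ys xs
    proof -
      obtain y x where yx: "ys = [y]" "y \<in> U" "xs = [x]" "x \<in> U" using mem True by (auto simp: incr_Suc)
      define u where "u = (SOME u. u \<in> U)"
      have u: "u \<in> U" unfolding u_def using yx(2) by (rule someI)
      define m where "m = max y x"
      have m: "m \<in> U" using yx by (simp add: max_def m_def)
      have "B ys xs = B [m] [m]" using lift[of y "[]" x "[]"] mem yx by (simp add: m_def)
      moreover have "B [m] [m] = B [u] [u]"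
      proof (cases m u rule: linorder_cases)
        case less then show ?thesis by (rule diag[OF m u])
      next
        case greater then show ?thesis by (rule diag[OF u m, symmetric])
      qed simp
      ultimately show ?thesis by (simp add: u_def)
    qed
    then show ?thesis using True
      by (auto simp: kernel_multiple_def incr_Suc intro!: exI[of _ "B [SOME u. u \<in> U] [SOME u. u \<in> U]"])
  next
    case False
    have "B ys xs = 0" if "?Y ys" "?X xs" for ys xs
    proof -
      obtain y us x vs where yx: "ys = y # us" "xs = x # vs" using \<open>?Y ys\<close> \<open>?X xs\<close> by (auto simp: incr_Suc)
      have Y: "?Y (y # us)" and X: "?X (x # vs)" using that yx by auto
      have len: "length us = length \<beta>" "length vs = length \<gamma>" using Y X by (auto simp: incr_def)
      have hdY: "\<forall>t\<in>set us'. u' < t" if "us = u' # us'" for u' us' using Y that by (auto simp: incr_Cons)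
      have hdX: "\<forall>t\<in>set us'. u' < t" if "vs = u' # us'" for u' us' using X that by (auto simp: incr_Cons)
      consider (a) u us' where "us = u # us'" "u \<le> x" | (b) v vs' where "vs = v # vs'" "v \<le> y"
        | (c) "\<forall>u\<in>set us. x < u" "\<forall>v\<in>set vs. y < v"
      proof -
        have "(\<forall>u\<in>set us. x < u) \<or> (\<exists>u us'. us = u # us' \<and> u \<le> x)"
          using hdY by (cases us) force+
        moreover have "(\<forall>v\<in>set vs. y < v) \<or> (\<exists>v vs'. vs = v # vs' \<and> v \<le> y)"
          using hdX by (cases vs) force+
        ultimately show thesis using that by blast
      qed
      then show ?thesis
      proof cases
        case a
        have "y < u" using Y a(1) by (auto simp: incr_Cons)
        show ?thesis
        proof (cases "x < y \<or> u \<le> x")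
          case True
          have "set (x # vs) \<inter> {y..<u} = {}" using X a(2) by (auto simp: incr_Cons disjoint_iff ball_Un)
          then show ?thesis using stepwise_left_zero[OF sy[OF X], of y u us'] Y a(1) yx by simp
        qed (use a in simp)
      next
        case b
        have "set (y # us) \<inter> {x..<v} = {}" using Y b(2) by (auto simp: incr_Cons disjoint_iff ball_Un)
        then show ?thesis using stepwise_left_zero[OF sx[OF Y], of x v vs'] X b(1) yx by simp
      next
        case c
        define m where "m = max y x"
        have lt: "\<forall>u\<in>set us \<union> set vs. y < u \<and> x < u" using c Y X by (auto simp: incr_Cons)
        have mU: "m \<in> U" using Y X by (auto simp: incr_Cons m_def max_def)
        have mY: "?Y (m # us)" and mX: "?X (m # vs)" using Y X lt mU by (auto simp: incr_Cons m_def)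
        obtain s where s: "s < m" "s \<in> U" using up_below[OF U mU] by blast
        have sY: "?Y (s # us)" and sX: "?X (s # vs)" using mY mX s by (auto simp: incr_Cons)
        have e: "B ys xs = B (m # us) (m # vs)" using lift[OF Y X lt] yx by (simp add: m_def)
        consider (d) u us' where "us = u # us'" "\<forall>v\<in>set vs. u \<le> v" | (e) v vs' where "vs = v # vs'" "\<forall>u\<in>set us. v \<le> u"
        proof (cases us)
          case Nil
          then obtain v vs' where "vs = v # vs'" using False len by (cases vs) auto
          then show thesis using Nil that(2) by auto
        next
          case u: (Cons u us')
          show thesis
          proof (cases vs)
            case v: (Cons v vs')
            show thesis
            proof (cases "u \<le> v")
              case True then show thesis using that(1)[OF u] hdX[OF v] v by force
            next
              case False then show thesis using that(2)[OF v] hdY[OF u] u by force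
            qed
          qed (use that(1)[OF u] in simp)
        qed
        then show ?thesis
        proof cases
          case d
          have "set (s # vs) \<inter> {m..<u} = {}" using d(2) s(1) by (auto simp: disjoint_iff)
          then show ?thesis using stepwise_left_zero[OF sy[OF sX], of m u us'] mY d(1) e lowX[OF mY mX s] by simp
        next
          case e': e
          have "set (s # us) \<inter> {m..<v} = {}" using e'(2) s(1) by (auto simp: disjoint_iff)
          then show ?thesis using stepwise_left_zero[OF sx[OF sY], of m v vs'] mX e'(1) e lowY[OF mY mX s] by simp
        qed
      qed
    qed
    then show ?thesis using False by (auto simp: kernel_multiple_def)
  qed
qed

lemma bistepwise_peel:
  assumes U: "up U" and B: "bistepwise U (Bullet # \<beta>) (Circ # \<gamma>) B" and y: "y \<in> U" "x \<in> U" "y \<le> x"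
  shows "bistepwise {x<..} \<beta> \<gamma> (\<lambda>ys xs. B (y # ys) (x # xs))"
proof -
  have sub: "{x<..} \<subseteq> U" using up_mem[OF U y(2)] by (auto simp: less_imp_le)
  have memY: "v # ys \<in> incr U (Suc (length \<beta>))" if "ys \<in> incr {x<..} (length \<beta>)" "v \<le> x" "v \<in> U" for ys v
    using that sub by (auto simp: incr_Cons incr_def subset_iff)
  have memX: "x # xs \<in> incr U (Suc (length \<gamma>))" if "xs \<in> incr {x<..} (length \<gamma>)" for xs
    using that sub y by (auto simp: incr_Cons incr_def)
  have inU: "ys ! i \<in> {x<..}" if "ys \<in> incr {x<..} n" "i < n" for ys i n
    using that by (auto simp: incr_def subset_iff)
  have sy: "stepwise U (Bullet # \<beta>) (set (x # xs)) (\<lambda>ys. B ys (x # xs))" if "x # xs \<in> incr U (Suc (length \<gamma>))" for x xs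
    by (rule bistepwiseD(1)[OF B]) (use that in simp)
  have sx: "stepwise U (Circ # \<gamma>) (set (v # ys)) (B (v # ys))" if "v # ys \<in> incr U (Suc (length \<beta>))" for v ys
    by (rule bistepwiseD(2)[OF B]) (use that in simp)
  have "stepwise {x<..} \<beta> (set xs) (\<lambda>ys. B (y # ys) (x # xs))" if xs: "xs \<in> incr {x<..} (length \<gamma>)" for xs
    unfolding stepwise_def
  proof (intro ballI allI impI)
    fix ys i assume ys: "ys \<in> incr {x<..} (length \<beta>)" and i: "i < length \<beta>"
    have len: "length ys = length \<beta>" using ys by (simp add: incr_def)
    note Y = memY[OF ys y(3,1)] and X = memX[OF xs]
    note D = stepwiseD[OF sy[OF X], of "y # ys" "Suc i"]
    show "(\<forall>t. \<beta> ! i = Bullet \<and> t < ys ! i \<and> ys[i := t] \<in> incr {x<..} (length \<beta>) \<and> set xs \<inter> {t..<ys ! i} = {} \<longrightarrow> B (y # ys[i := t]) (x # xs) = B (y # ys) (x # xs)) \<and>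
     (\<beta> ! i = Bullet \<and> Suc i < length \<beta> \<and> set xs \<inter> {ys ! i..<ys ! Suc i} = {} \<longrightarrow> B (y # ys) (x # xs) = 0) \<and>
     (\<forall>t. \<beta> ! i = Circ \<and> ys ! i < t \<and> ys[i := t] \<in> incr {x<..} (length \<beta>) \<and> set xs \<inter> {ys ! i<..t} = {} \<longrightarrow> B (y # ys[i := t]) (x # xs) = B (y # ys) (x # xs)) \<and>
     (\<beta> ! i = Circ \<and> set xs \<inter> {l \<in> {x<..}. (0 < i \<longrightarrow> ys ! (i - 1) < l) \<and> l \<le> ys ! i} = {} \<longrightarrow> B (y # ys) (x # xs) = 0)"
    proof (intro conjI allI impI; elim conjE)
      fix t assume a: "\<beta> ! i = Bullet" "t < ys ! i" "ys[i := t] \<in> incr {x<..} (length \<beta>)" "set xs \<inter> {t..<ys ! i} = {}"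
      have "x < t" using inU[OF a(3) i] len i by simp
      then show "B (y # ys[i := t]) (x # xs) = B (y # ys) (x # xs)"
        using D(1)[of t] a Y i memY[OF a(3) y(3,1)] by (auto simp: disjoint_iff)
    next
      assume a: "\<beta> ! i = Bullet" "Suc i < length \<beta>" "set xs \<inter> {ys ! i..<ys ! Suc i} = {}"
      then show "B (y # ys) (x # xs) = 0" using D(2) Y i inU[OF ys i] by (auto simp: disjoint_iff)
    next
      fix t assume a: "\<beta> ! i = Circ" "ys ! i < t" "ys[i := t] \<in> incr {x<..} (length \<beta>)" "set xs \<inter> {ys ! i<..t} = {}"
      then show "B (y # ys[i := t]) (x # xs) = B (y # ys) (x # xs)"
        using D(3)[of t] Y i memY[OF a(3) y(3,1)] inU[OF ys i] by (auto simp: disjoint_iff)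
    next
      assume a: "\<beta> ! i = Circ" "set xs \<inter> {l \<in> {x<..}. (0 < i \<longrightarrow> ys ! (i - 1) < l) \<and> l \<le> ys ! i} = {}"
      show "B (y # ys) (x # xs) = 0"
      proof (cases i)
        case (Suc j)
        then have "x < ys ! j" using inU[OF ys, of j] i by simp
        then show ?thesis using D(4) a Y i Suc by (auto simp: disjoint_iff)
      next
        case 0
        obtain \<beta>' where \<beta>: "\<beta> = Circ # \<beta>'" using a(1) i 0 by (cases \<beta>) auto
        obtain v vs where v: "ys = v # vs" "x < v" "\<forall>t\<in>set vs. v < t" using ys \<beta> by (auto simp: incr_Suc)
        have gt: "\<forall>u\<in>set xs. v < u" using a(2) 0 v xs by (auto simp: incr_def disjoint_iff subset_iff not_le)
        \<comment> \<open>The detour: bring \<open>y\<close> to some \<open>s\<close> left of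
          \<open>x\<close>, lower \<open>v\<close> to \<open>x\<close>, then push \<open>x\<close>
          up to \<open>t\<close>. Now no entry of the second tuple separates the
          \<open>Bullet\<close> at \<open>s\<close> from its successor at \<open>x\<close>, so the
          value is 0.\<close>
        obtain s where s: "s < x" "s \<in> U" "B (s # ys) (x # xs) = B (y # ys) (x # xs)"
        proof (cases "y < x")
          case False
          then have "y = x" using y(3) by simp
          obtain s where s: "s < y" "s \<in> U" using up_below[OF U y(1)] by blast
          have "B (s # ys) (x # xs) = B (y # ys) (x # xs)"
            using Y s X \<open>y = x\<close> by (intro stepwise_left[OF sy[OF X] U]) (auto simp: incr_Cons disjoint_iff ball_Un)
          then show thesis using that s \<open>y = x\<close> by blast
        qed (use that y in blast)
        have Y1: "s # x # vs \<in> incr U (Suc (length \<beta>))" using ys v s y \<beta> sub by (auto simp: incr_Cons incr_def)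
        have 1: "B (s # v # vs) (x # xs) = B (s # x # vs) (x # xs)"
          using stepwiseD(3)[OF sy[OF X], of "s # x # vs" "Suc 0" v] Y1 memY[OF ys _ s(2)] v s \<beta> gt
          by (force simp: disjoint_iff)
        obtain t where t: "x < t" "\<forall>u\<in>set vs \<union> set xs. t < u"
          using ex_between[of "set vs \<union> set xs" x] v gt by force
        have tX: "t # xs \<in> incr U (Suc (length \<gamma>))" using t X up_mem[OF U y(2), of t] by (auto simp: incr_Cons)
        have 2: "B (s # x # vs) (t # xs) = B (s # x # vs) (x # xs)"
          using t s by (intro stepwise_right[OF sx[OF Y1] U X]) (auto simp: disjoint_iff ball_Un)
        have "B (s # x # vs) (t # xs) = 0"
          using t by (intro stepwise_left_zero[OF sy[OF tX] Y1]) (auto simp: disjoint_iff ball_Un)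
        then show ?thesis using 1 2 s(3) v(1) by simp
      qed
    qed
  qed
  moreover have "stepwise {x<..} \<gamma> (set ys) (\<lambda>xs. B (y # ys) (x # xs))" if ys: "ys \<in> incr {x<..} (length \<beta>)" for ys
    unfolding stepwise_def
  proof (intro ballI allI impI)
    fix xs i assume xs: "xs \<in> incr {x<..} (length \<gamma>)" and i: "i < length \<gamma>"
    have len: "length xs = length \<gamma>" using xs by (simp add: incr_def)
    note Y = memY[OF ys y(3,1)] and X = memX[OF xs]
    note D = stepwiseD[OF sx[OF Y], of "x # xs" "Suc i"]
    show "(\<forall>t. \<gamma> ! i = Bullet \<and> t < xs ! i \<and> xs[i := t] \<in> incr {x<..} (length \<gamma>) \<and> set ys \<inter> {t..<xs ! i} = {} \<longrightarrow> B (y # ys) (x # xs[i := t]) = B (y # ys) (x # xs)) \<and>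
     (\<gamma> ! i = Bullet \<and> Suc i < length \<gamma> \<and> set ys \<inter> {xs ! i..<xs ! Suc i} = {} \<longrightarrow> B (y # ys) (x # xs) = 0) \<and>
     (\<forall>t. \<gamma> ! i = Circ \<and> xs ! i < t \<and> xs[i := t] \<in> incr {x<..} (length \<gamma>) \<and> set ys \<inter> {xs ! i<..t} = {} \<longrightarrow> B (y # ys) (x # xs[i := t]) = B (y # ys) (x # xs)) \<and>
     (\<gamma> ! i = Circ \<and> set ys \<inter> {l \<in> {x<..}. (0 < i \<longrightarrow> xs ! (i - 1) < l) \<and> l \<le> xs ! i} = {} \<longrightarrow> B (y # ys) (x # xs) = 0)"
    proof (intro conjI allI impI; elim conjE)
      fix t assume a: "\<gamma> ! i = Bullet" "t < xs ! i" "xs[i := t] \<in> incr {x<..} (length \<gamma>)" "set ys \<inter> {t..<xs ! i} = {}"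
      have "x < t" using inU[OF a(3) i] len i by simp
      then show "B (y # ys) (x # xs[i := t]) = B (y # ys) (x # xs)"
        using D(1)[of t] a X i y(3) memX[OF a(3)] by (auto simp: disjoint_iff)
    next
      assume a: "\<gamma> ! i = Bullet" "Suc i < length \<gamma>" "set ys \<inter> {xs ! i..<xs ! Suc i} = {}"
      then show "B (y # ys) (x # xs) = 0" using D(2) X i y(3) inU[OF xs i] by (auto simp: disjoint_iff)
    next
      fix t assume a: "\<gamma> ! i = Circ" "xs ! i < t" "xs[i := t] \<in> incr {x<..} (length \<gamma>)" "set ys \<inter> {xs ! i<..t} = {}"
      then show "B (y # ys) (x # xs[i := t]) = B (y # ys) (x # xs)"
        using D(3)[of t] X i y(3) memX[OF a(3)] inU[OF xs i] by (auto simp: disjoint_iff)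
    next
      assume a: "\<gamma> ! i = Circ" "set ys \<inter> {l \<in> {x<..}. (0 < i \<longrightarrow> xs ! (i - 1) < l) \<and> l \<le> xs ! i} = {}"
      show "B (y # ys) (x # xs) = 0"
      proof (cases i)
        case (Suc j)
        then have "x < xs ! j" using inU[OF xs, of j] i by simp
        then show ?thesis using D(4) a X i y(3) Suc by (auto simp: disjoint_iff)
      next
        case 0
        then show ?thesis using D(4) a X i y(3) by (auto simp: disjoint_iff)
      qed
    qed
  qed
  ultimately show ?thesis by (simp add: bistepwise_def)
qed

text \<open>The induction hypothesis gives a constant for each pair of heads. It is the same for all
  pairs because the heads can be moved, the \<open>Circ\<close> right and the \<open>Bullet\<close>
  left, to a common position in front of one fixed kernel point.\<close>

lemma kernel_multiple_Bullet_Circ: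
  fixes B :: "real list \<Rightarrow> real list \<Rightarrow> 'k::field"
  assumes U: "up U" and B: "bistepwise U (Bullet # \<beta>) (Circ # \<gamma>) B"
    and IH: "\<And>U (B' :: real list \<Rightarrow> real list \<Rightarrow> 'k). up U \<Longrightarrow> bistepwise U \<beta> \<gamma> B' \<Longrightarrow> kernel_multiple U \<beta> \<gamma> B'"
  shows "kernel_multiple U (Bullet # \<beta>) (Circ # \<gamma>) B"
proof -
  let ?Y = "\<lambda>ys. ys \<in> incr U (Suc (length \<beta>))" and ?X = "\<lambda>xs. xs \<in> incr U (Suc (length \<gamma>))"
  have sy: "stepwise U (Bullet # \<beta>) (set xs) (\<lambda>ys. B ys xs)" if "?X xs" for xs
    by (rule bistepwiseD(1)[OF B]) (use that in simp)
  have sx: "stepwise U (Circ # \<gamma>) (set ys) (B ys)" if "?Y ys" for ys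
    by (rule bistepwiseD(2)[OF B]) (use that in simp)
  have off: "B (y # ys) (x # xs) = 0"
    if Y: "?Y (y # ys)" and X: "?X (x # xs)" and n: "\<not> (y \<le> x \<and> (\<forall>t\<in>set ys. x < t))" for y ys x xs
  proof (cases "y \<le> x")
    case False
    then show ?thesis
      using Y by (intro stepwise_right_zero[OF sx[OF Y] X]) (auto simp: incr_Cons)
  next
    case True
    then obtain t where "t \<in> set ys" "t \<le> x" using n by (auto simp: not_less)
    then obtain v vs where v: "ys = v # vs" "v \<le> x" using Y by (cases ys) (auto simp: incr_Cons)
    have "set (x # xs) \<inter> {y..<v} = {}" using X v(2) by (auto simp: incr_Cons disjoint_iff ball_Un)
    then show ?thesis using stepwise_left_zero[OF sy[OF X], of y v vs] Y v(1) by simp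
  qed
  have inner: "\<exists>c. \<forall>ys\<in>incr {x<..} (length \<beta>). \<forall>xs\<in>incr {x<..} (length \<gamma>).
      B (y # ys) (x # xs) = c * of_bool (fits \<beta> \<gamma> \<and> ker \<beta> \<gamma> ys xs)" if "y \<in> U" "x \<in> U" "y \<le> x" for y x
    using IH[OF _ bistepwise_peel[OF U B that]] by (simp add: kernel_multiple_def)
  have ker_iff: "ker (Bullet # \<beta>) (Circ # \<gamma>) (y # ys) (x # xs) \<longleftrightarrow> y \<le> x \<and> (\<forall>t\<in>set ys. x < t) \<and> ker \<beta> \<gamma> ys xs"
    if "?Y (y # ys)" "?X (x # xs)" for y ys x xs
    using that by (auto simp: incr_Cons)
  have above: "ys \<in> incr {x<..} (length \<beta>) \<and> xs \<in> incr {x<..} (length \<gamma>)"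
    if "?Y (y # ys)" "?X (x # xs)" "\<forall>t\<in>set ys. x < t" for y ys x xs
    using that by (auto simp: incr_Cons incr_def)
  have zero: "B ys xs = 0" if Y: "?Y ys" and X: "?X xs" and n: "\<not> (fits \<beta> \<gamma> \<and> ker (Bullet # \<beta>) (Circ # \<gamma>) ys xs)" for ys xs
  proof -
    obtain y us x vs where e: "ys = y # us" "xs = x # vs" "y \<in> U" "x \<in> U" using Y X by (auto simp: incr_Suc)
    show ?thesis
    proof (cases "y \<le> x \<and> (\<forall>t\<in>set us. x < t)")
      case True
      then obtain c where "B (y # us) (x # vs) = c * of_bool (fits \<beta> \<gamma> \<and> ker \<beta> \<gamma> us vs)"
        using inner[OF e(3,4)] above[of y us x vs] Y X e(1,2) by blast
      then show ?thesis using n ker_iff[of y us x vs] True Y X e(1,2) by (simp del: ker.simps)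
    qed (use off[of y us x vs] Y X e in simp)
  qed
  have same: "B ys xs = B ys' xs'" if fit: "fits \<beta> \<gamma>" and Y: "?Y ys" "?Y ys'" and X: "?X xs" "?X xs'"
    and k: "ker (Bullet # \<beta>) (Circ # \<gamma>) ys xs" "ker (Bullet # \<beta>) (Circ # \<gamma>) ys' xs'" for ys xs ys' xs'
  proof -
    obtain y us x vs where e: "ys = y # us" "xs = x # vs" "y \<in> U" "x \<in> U" using Y(1) X(1) by (auto simp: incr_Suc)
    obtain y' us' x' vs' where e': "ys' = y' # us'" "xs' = x' # vs'" "y' \<in> U" "x' \<in> U" using Y(2) X(2) by (auto simp: incr_Suc)
    \<comment> \<open>Chosen so that both pairs of heads reach the position \<open>n\<close>,
      \<open>m\<close> by permitted moves.\<close>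
    define m n where "m = max x x'" and "n = min y y'"
    have mU: "m \<in> U" "n \<in> U" using e e' by (auto simp: m_def n_def max_def min_def)
    obtain ps qs where pq: "ps \<in> incr {m<..} (length \<beta>)" "qs \<in> incr {m<..} (length \<gamma>)" "ker \<beta> \<gamma> ps qs"
      using kernel_point[OF fit, of m] by blast
    have move: "B (y # us) (x # vs) = B (n # ps) (m # qs)"
      if Y: "?Y (y # us)" and X: "?X (x # vs)" and k: "ker (Bullet # \<beta>) (Circ # \<gamma>) (y # us) (x # vs)"
        and mn: "x \<le> m" "n \<le> y" for y us x vs
    proof -
      have k': "y \<le> x" "\<forall>t\<in>set us. x < t" "ker \<beta> \<gamma> us vs" using k ker_iff[OF Y X] by auto
      have U': "y \<in> U" "x \<in> U" using Y X by (auto simp: incr_Cons)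
      have ps: "ps \<in> incr {x<..} (length \<beta>)" "qs \<in> incr {x<..} (length \<gamma>)" using pq mn by (auto simp: incr_def subset_iff)
      obtain c where c: "\<And>ys xs. ys \<in> incr {x<..} (length \<beta>) \<Longrightarrow> xs \<in> incr {x<..} (length \<gamma>) \<Longrightarrow>
          B (y # ys) (x # xs) = c * of_bool (fits \<beta> \<gamma> \<and> ker \<beta> \<gamma> ys xs)"
        using inner[OF U' k'(1)] by blast
      have 1: "B (y # us) (x # vs) = B (y # ps) (x # qs)"
        using c[OF ps] c[of us vs] above[OF Y X k'(2)] k'(3) pq(3) by simp
      have sub: "{m<..} \<subseteq> U" using up_mem[OF U mU(1)] by (auto simp: less_imp_le)
      have Yp: "?Y (v # ps)" if "v \<in> U" "v \<le> m" for v
        using pq(1) sub that by (auto simp: incr_Cons incr_def subset_iff)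
      have Xq: "?X (v # qs)" if "v \<in> U" "v \<le> m" for v
        using pq(2) sub that by (auto simp: incr_Cons incr_def subset_iff)
      have 2: "B (y # ps) (m # qs) = B (y # ps) (x # qs)"
      proof (cases "x = m")
        case False
        have "y \<le> m" using k'(1) mn by simp
        show ?thesis
        proof (rule stepwise_right[OF sx[OF Yp[OF U'(1) \<open>y \<le> m\<close>]] U Xq[OF U'(2) mn(1)]])
          show "x < m" using False mn by simp
          show "\<forall>u\<in>set qs. m < u" using pq(2) by (auto simp: incr_def)
          show "set (y # ps) \<inter> {x<..m} = {}" using pq(1) k'(1) by (auto simp: incr_def disjoint_iff subset_iff)
        qed
      qed simp
      have 3: "B (n # ps) (m # qs) = B (y # ps) (m # qs)"
      proof (cases "n = y")
        case False
        have "y \<le> m" using k'(1) mn by simp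
        show ?thesis
        proof (rule stepwise_left[OF sy[OF Xq[OF mU(1) order_refl]] U Yp[OF U'(1) \<open>y \<le> m\<close>]])
          show "n < y" using False mn by simp
          show "n \<in> U" by fact
          show "set (m # qs) \<inter> {n..<y} = {}" using pq(2) \<open>y \<le> m\<close> by (auto simp: incr_def disjoint_iff subset_iff)
        qed
      qed simp
      show ?thesis using 1 2 3 by simp
    qed
    have "B ys xs = B (n # ps) (m # qs)" unfolding e(1,2) by (rule move) (use Y X k e in \<open>auto simp: m_def n_def\<close>)
    moreover have "B ys' xs' = B (n # ps) (m # qs)" unfolding e'(1,2) by (rule move) (use Y X k e' in \<open>auto simp: m_def n_def\<close>)
    ultimately show ?thesis by simp
  qed
  show ?thesis
  proof (cases "\<exists>ys xs. ?Y ys \<and> ?X xs \<and> fits \<beta> \<gamma> \<and> ker (Bullet # \<beta>) (Circ # \<gamma>) ys xs")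
    case True
    then obtain ys0 xs0 where p: "?Y ys0" "?X xs0" "fits \<beta> \<gamma>" "ker (Bullet # \<beta>) (Circ # \<gamma>) ys0 xs0" by blast
    have "B ys xs = B ys0 xs0 * of_bool (fits (Bullet # \<beta>) (Circ # \<gamma>) \<and> ker (Bullet # \<beta>) (Circ # \<gamma>) ys xs)" if "?Y ys" "?X xs" for ys xs
      using zero[OF that] same[OF p(3) that(1) p(1) that(2) p(2) _ p(4)] p(3)
      by (cases "ker (Bullet # \<beta>) (Circ # \<gamma>) ys xs") (simp_all del: ker.simps)
    then show ?thesis unfolding kernel_multiple_def by auto
  next
    case False
    then have "B ys xs = 0" if "?Y ys" "?X xs" for ys xs using zero[OF that] that by blast
    then show ?thesis unfolding kernel_multiple_def by (auto intro: exI[of _ 0])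
  qed
qed

lemma bistepwise_kernel_multiple:
  fixes B :: "real list \<Rightarrow> real list \<Rightarrow> 'k::field"
  assumes "up U" "bistepwise U \<beta> \<gamma> B"
  shows "kernel_multiple U \<beta> \<gamma> B"
  using assms
proof (induction \<beta> arbitrary: \<gamma> U B)
  case Nil
  then show ?case
    using kernel_multiple_sym[OF kernel_multiple_Nil[OF Nil(1) bistepwise_sym[OF Nil(2)]]] by simp
next
  case (Cons b \<beta>)
  show ?case
  proof (cases \<gamma>)
    case Nil then show ?thesis using kernel_multiple_Nil Cons.prems by blast
  next
    case g: (Cons g \<gamma>')
    consider "b = Circ" "g = Circ" | "b = Bullet" "g = Bullet" | "b = Bullet" "g = Circ" | "b = Circ" "g = Bullet"
      by (cases b; cases g) auto
    then show ?thesis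
    proof cases
      case 1
      have "B ys xs = 0" if mem: "ys \<in> incr U (Suc (length \<beta>))" "xs \<in> incr U (Suc (length \<gamma>'))" for ys xs
      proof -
        obtain y us x vs where "ys = y # us" "xs = x # vs" using mem by (auto simp: incr_Suc)
        then show ?thesis using Circ_Circ_zero[of U \<beta> \<gamma>' B] Cons.prems 1 g mem by blast
      qed
      then show ?thesis using 1 g by (auto simp: kernel_multiple_def)
    next
      case 2 then show ?thesis using kernel_multiple_Bullet_Bullet Cons.prems g by blast
    next
      case 3 then show ?thesis using kernel_multiple_Bullet_Circ[OF Cons.prems(1)] Cons.IH Cons.prems(2) g by blast
    next
      case 4
      have "kernel_multiple U (Bullet # \<gamma>') (Circ # \<beta>) (\<lambda>xs ys. B ys xs)"
      proof (rule kernel_multiple_Bullet_Circ[OF Cons.prems(1)])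
        show "bistepwise U (Bullet # \<gamma>') (Circ # \<beta>) (\<lambda>xs ys. B ys xs)"
          using bistepwise_sym[OF Cons.prems(2)] g 4 by simp
        fix U and B' :: "real list \<Rightarrow> real list \<Rightarrow> 'k" assume "up U" "bistepwise U \<gamma>' \<beta> B'"
        then show "kernel_multiple U \<gamma>' \<beta> B'"
          using kernel_multiple_sym[OF Cons.IH[OF _ bistepwise_sym[of U \<gamma>' \<beta> B']]] by simp
      qed
      from kernel_multiple_sym[OF this] show ?thesis using 4 g by simp
    qed
  qed
qed

lemma Hom_M_kmat:
  fixes A :: "real list \<Rightarrow> real list \<Rightarrow> 'k::field"
  assumes "A \<in> Hom (M_obj \<alpha>) (M_obj \<beta>)"
  shows "\<exists>c. A = (if fits \<beta> (dual \<alpha>) then mscale c (kmat \<beta> (dual \<alpha>)) else 0)"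
proof -
  have A: "A \<in> matrices (RR (length \<alpha>)) (RR (length \<beta>))" and p: "\<And>x. proj_fixed UNIV \<beta> (\<lambda>y. A y x)"
    "\<And>y. proj_fixed UNIV (dual \<alpha>) (A y)" using assms unfolding Hom_M_iff by auto
  have supp: "A y x = 0" if "y \<notin> incr UNIV (length \<beta>) \<or> x \<notin> incr UNIV (length \<alpha>)" for y x
    using matrices_supp[OF A] that by (auto simp: pts_RR)
  have "bistepwise UNIV \<beta> (dual \<alpha>) A"
    unfolding bistepwise_def
    using stepwise_proj_fixed[OF matrices_RR_ltame(1)[OF A] _ p(1)] stepwise_proj_fixed[OF matrices_RR_ltame(2)[OF A] _ p(2)] supp
    by auto
  then obtain c where c: "\<And>ys xs. ys \<in> incr UNIV (length \<beta>) \<Longrightarrow> xs \<in> incr UNIV (length \<alpha>) \<Longrightarrow>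
     A ys xs = c * of_bool (fits \<beta> (dual \<alpha>) \<and> ker \<beta> (dual \<alpha>) ys xs)"
    using bistepwise_kernel_multiple[OF up_UNIV, of \<beta> "dual \<alpha>" A] by (auto simp: kernel_multiple_def)
  have "A ys xs = (if fits \<beta> (dual \<alpha>) then mscale c (kmat \<beta> (dual \<alpha>)) else 0) ys xs" for ys xs
  proof (cases "ys \<in> incr UNIV (length \<beta>) \<and> xs \<in> incr UNIV (length \<alpha>)")
    case True then show ?thesis using c[of ys xs] by (simp add: mscale_def kmat_on_def)
  next
    case False then show ?thesis using supp[of ys xs] by (auto simp: mscale_def kmat_on_def)
  qed
  then show ?thesis by (intro exI[of _ c]) (simp add: fun_eq_iff)
qed

section \<open>The four kinds of morphisms\<close>

lemma fits_iff: "fits \<beta> \<gamma> \<longleftrightarrow> (\<exists>w. \<beta> = w \<and> \<gamma> = dual w \<or> \<beta> = w \<and> \<gamma> = dual w @ [Bullet] \<or>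
    \<beta> = w @ [Bullet] \<and> \<gamma> = dual w \<or> \<beta> = w @ [Bullet] \<and> \<gamma> = dual w @ [Bullet])" (is "_ \<longleftrightarrow> ?R \<beta> \<gamma>")
proof
  show "?R \<beta> \<gamma>" if "fits \<beta> \<gamma>"
    using that
  proof (induction \<beta> \<gamma> rule: fits.induct)
    case (1 b \<beta> g \<gamma>)
    show ?case
    proof (cases "b = g")
      case True
      then show ?thesis using 1 by (auto split: if_splits)
    next
      case False
      then obtain w where "\<beta> = w \<and> \<gamma> = dual w \<or> \<beta> = w \<and> \<gamma> = dual w @ [Bullet] \<or>
        \<beta> = w @ [Bullet] \<and> \<gamma> = dual w \<or> \<beta> = w @ [Bullet] \<and> \<gamma> = dual w @ [Bullet]" using 1 by auto
      then show ?thesis using False letter_neq[of b g] by (intro exI[of _ "b # w"]) auto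
    qed
  qed auto
next
  have "fits w (dual w @ [Bullet])" "fits (w @ [Bullet]) (dual w)" "fits (w @ [Bullet]) (dual w @ [Bullet])" for w
    by (induction w) auto
  then show "fits \<beta> \<gamma>" if "?R \<beta> \<gamma>" using that fits_dual by auto
qed

lemma fits_dual_iff: "fits \<beta> (dual \<alpha>) \<longleftrightarrow> (\<exists>w. \<alpha> = w \<and> \<beta> = w \<or> \<alpha> = w @ [Circ] \<and> \<beta> = w \<or>
    \<alpha> = w \<and> \<beta> = w @ [Bullet] \<or> \<alpha> = w @ [Circ] \<and> \<beta> = w @ [Bullet])"
proof -
  have "dual \<alpha> = \<gamma> \<longleftrightarrow> \<alpha> = dual \<gamma>" for \<gamma> by (metis dual_dual)
  then show ?thesis unfolding fits_iff by (auto simp: dual_dual)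
qed

lemma kmat_nonzero: assumes "fits \<beta> \<gamma>" shows "kmat \<beta> \<gamma> \<noteq> (0 :: real list \<Rightarrow> real list \<Rightarrow> 'k::field)"
proof -
  obtain ys xs where "ys \<in> incr {0<..} (length \<beta>)" "xs \<in> incr {0<..} (length \<gamma>)" "ker \<beta> \<gamma> ys xs"
    using kernel_point[OF assms, of 0] by blast
  then have "kmat \<beta> \<gamma> ys xs = (1 :: 'k)" by (auto simp: kmat_on_def incr_def)
  then show ?thesis by (metis zero_fun_apply zero_neq_one)
qed

lemma E_mat_nonzero: "E_mat w \<noteq> (0 :: real list \<Rightarrow> real list \<Rightarrow> 'k::field)"
  using kmat_nonzero[OF fits_dual] by (simp add: E_mat_eq_kmat)

lemma Hom_matrices: "A \<in> Hom P Q \<Longrightarrow> A \<in> matrices (base P) (base Q)"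
  and Hom_left: "A \<in> Hom P Q \<Longrightarrow> mcomp (base Q) (idem Q) A = A"
  and Hom_right: "A \<in> Hom P Q \<Longrightarrow> mcomp (base P) A (idem P) = A"
  by (auto simp: Hom_def)

lemma objectD: "object P \<Longrightarrow> gset (base P)" "object P \<Longrightarrow> idem P \<in> matrices (base P) (base P)"
    "object P \<Longrightarrow> mcomp (base P) (idem P) (idem P) = idem P"
  by (auto simp: object_def)

lemma Hom_comp:
  assumes P: "object P" and Q: "object Q" and R: "object R" and A: "A \<in> Hom P Q" and B: "B \<in> Hom Q R"
  shows "mcomp (base Q) B A \<in> Hom P R"
proof -
  note g = objectD(1)[OF P] objectD(1)[OF Q] objectD(1)[OF R]
  note m = Hom_matrices[OF A] Hom_matrices[OF B]
  show ?thesis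
    unfolding Hom_def
    using mcomp_closed[OF g m] mcomp_assoc[OF g(1,2,3,3) m objectD(2)[OF R]]
      mcomp_assoc[OF g(1,1,2,3) objectD(2)[OF P] m] Hom_left[OF B] Hom_right[OF A]
    by simp
qed

lemma Hom_scale:
  assumes P: "object P" and Q: "object Q" and A: "A \<in> Hom P Q"
  shows "mscale c A \<in> Hom P Q"
  using mcomp_scale(2)[OF objectD(1)[OF P] objectD(1)[OF Q] objectD(1)[OF Q] Hom_matrices[OF A] objectD(2)[OF Q], of c]
    mcomp_scale(1)[OF objectD(1)[OF P] objectD(1)[OF P] objectD(1)[OF Q] objectD(2)[OF P] Hom_matrices[OF A], of c]
    A matrices_scale[of A] unfolding Hom_def by simp

lemma M_obj_simps [simp]: "base (M_obj w) = RR (length w)" "idem (M_obj w) = E_mat w"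
  by (simp_all add: M_obj_def)

lemma Hom_M_line:
  assumes "fits \<beta> (dual \<alpha>)" "A \<in> Hom (M_obj \<alpha>) (M_obj \<beta>)" "A \<noteq> 0"
  shows "line_spanned_by (Hom (M_obj \<alpha>) (M_obj \<beta>)) (A :: real list \<Rightarrow> real list \<Rightarrow> 'k::field)"
proof -
  obtain c where c: "A = mscale c (kmat \<beta> (dual \<alpha>))" using Hom_M_kmat[OF assms(2)] assms(1) by auto
  then have "c \<noteq> 0" using assms(3) by (auto simp: mscale_def fun_eq_iff)
  have "Hom (M_obj \<alpha>) (M_obj \<beta>) = mat.span {A}"
  proof
    show "Hom (M_obj \<alpha>) (M_obj \<beta>) \<subseteq> mat.span {A}"
    proof
      fix B :: "real list \<Rightarrow> real list \<Rightarrow> 'k" assume "B \<in> Hom (M_obj \<alpha>) (M_obj \<beta>)"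
      then obtain b where "B = mscale b (kmat \<beta> (dual \<alpha>))" using Hom_M_kmat assms(1) by metis
      then have "B = mscale (b / c) A" using c \<open>c \<noteq> 0\<close> by (simp add: mscale_def)
      then show "B \<in> mat.span {A}" by (auto simp: mat.span_singleton)
    qed
    show "mat.span {A} \<subseteq> Hom (M_obj \<alpha>) (M_obj \<beta>)"
      using Hom_scale[OF object_M object_M assms(2)] by (auto simp: mat.span_singleton)
  qed
  moreover have "mat.dim (mat.span {A}) = 1"
    using mat.dim_span_eq_card_independent[of "{A}"] assms(3) by (simp add: mat.dependent_single)
  ultimately show ?thesis using assms(3) by (simp add: line_spanned_by_def)
qed

lemma ker_snoc:
  assumes "length ys = length w" "length xs = length w"
  shows "ker (w @ [Bullet]) (dual w) (ys @ [a]) xs \<longleftrightarrow> ker w (dual w) ys xs \<and> (\<forall>t\<in>set ys \<union> set xs. t < a)"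
    and "ker w (dual w @ [Bullet]) ys (xs @ [b]) \<longleftrightarrow> ker w (dual w) ys xs \<and> (\<forall>t\<in>set ys \<union> set xs. t < b)"
    and "ker (w @ [l]) (dual w @ [g]) (ys @ [a]) (xs @ [b]) \<longleftrightarrow>
      ker w (dual w) ys xs \<and> (\<forall>t\<in>set ys \<union> set xs. t < a \<and> t < b) \<and> (l = g \<or> rel l a b)"
proof -
  have "(ker (w @ [Bullet]) (dual w) (ys @ [a]) xs \<longleftrightarrow> ker w (dual w) ys xs \<and> (\<forall>t\<in>set ys \<union> set xs. t < a)) \<and>
    (ker w (dual w @ [Bullet]) ys (xs @ [b]) \<longleftrightarrow> ker w (dual w) ys xs \<and> (\<forall>t\<in>set ys \<union> set xs. t < b)) \<and>
    (ker (w @ [l]) (dual w @ [g]) (ys @ [a]) (xs @ [b]) \<longleftrightarrow>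
      ker w (dual w) ys xs \<and> (\<forall>t\<in>set ys \<union> set xs. t < a \<and> t < b) \<and> (l = g \<or> rel l a b))"
    using assms(1) assms(2)[symmetric] by (induction ys w xs rule: list_induct3) auto
  then show "ker (w @ [Bullet]) (dual w) (ys @ [a]) xs \<longleftrightarrow> ker w (dual w) ys xs \<and> (\<forall>t\<in>set ys \<union> set xs. t < a)"
    "ker w (dual w @ [Bullet]) ys (xs @ [b]) \<longleftrightarrow> ker w (dual w) ys xs \<and> (\<forall>t\<in>set ys \<union> set xs. t < b)"
    "ker (w @ [l]) (dual w @ [g]) (ys @ [a]) (xs @ [b]) \<longleftrightarrow>
      ker w (dual w) ys xs \<and> (\<forall>t\<in>set ys \<union> set xs. t < a \<and> t < b) \<and> (l = g \<or> rel l a b)" by blast+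
qed

lemma incr_snoc: "ys @ [a] \<in> incr UNIV (Suc n) \<longleftrightarrow> ys \<in> incr UNIV n \<and> (\<forall>t\<in>set ys. t < a)"
  by (auto simp: incr_UNIV sorted_wrt_append)

abbreviation up_map :: "weight \<Rightarrow> real list \<Rightarrow> real list \<Rightarrow> 'k::field" where
  "up_map w \<equiv> kmat (w @ [Bullet]) (dual w)"

abbreviation down_map :: "weight \<Rightarrow> real list \<Rightarrow> real list \<Rightarrow> 'k::field" where
  "down_map w \<equiv> kmat w (dual w @ [Bullet])"

lemma up_map_Hom: "up_map w \<in> Hom (M_obj w) (M_obj (w @ [Bullet]))"
  by (rule kmat_Hom) (auto simp: fits_dual_iff)

lemma down_map_Hom: "down_map w \<in> Hom (M_obj (w @ [Circ])) (M_obj w)"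
proof -
  have "fits w (dual (w @ [Circ]))" unfolding fits_dual_iff by blast
  from kmat_Hom[OF this] show ?thesis by simp
qed

text \<open>The composite is a multiple of the kernel on the right by the classification, so it suffices
  to evaluate it at one point; on the diagonal \<open>E_mat w * down_map w = down_map w\<close> gives the value.\<close>

lemma up_down: "mcomp (RR (length w)) (up_map w) (down_map w) = (kmat (w @ [Bullet]) (dual w @ [Bullet]) :: real list \<Rightarrow> real list \<Rightarrow> 'k::field)"
proof -
  have h: "mcomp (RR (length w)) (up_map w) (down_map w) \<in> (Hom (M_obj (w @ [Circ])) (M_obj (w @ [Bullet])) :: (real list \<Rightarrow> real list \<Rightarrow> 'k) set)"
    using Hom_comp[OF object_M object_M object_M down_map_Hom up_map_Hom] by simp
  have f: "fits (w @ [Bullet]) (dual (w @ [Circ]))" unfolding fits_dual_iff by blast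
  obtain c where c: "mcomp (RR (length w)) (up_map w) (down_map w) = mscale c (kmat (w @ [Bullet]) (dual w @ [Bullet]) :: real list \<Rightarrow> real list \<Rightarrow> 'k)"
    using Hom_M_kmat[OF h] f by auto
  define n where "n = length w"
  define p where "p = map real [0..<n]"
  define s where "s = real n"
  have p: "p \<in> incr UNIV n" "\<forall>t\<in>set p. t < s" "length p = n" using incr_UNIV_nonempty[of n] by (auto simp: p_def s_def)
  have kpp: "ker w (dual w) p p"
    using p(1) by (subst ker_dual_iff) (auto simp: n_def incr_UNIV intro: sorted_wrt_nth_less)
  have ps: "p @ [s] \<in> incr UNIV (Suc n)" using p by (simp add: incr_snoc)
  \<comment> \<open>The condition that \<open>y\<close> stays below \<open>s\<close>, imposed by
    \<open>up_map\<close>, is already imposed by \<open>down_map\<close>; so \<open>up_map\<close>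
    may be replaced by the kernel of \<open>E_mat w\<close>.\<close>
  have e: "up_map w (p @ [s]) y * down_map w y (p @ [s]) = kmat w (dual w) p y * (down_map w y (p @ [s]) :: 'k)" for y
  proof (cases "y \<in> incr UNIV n")
    case True
    then have l: "length y = length w" by (simp add: incr_UNIV n_def)
    show ?thesis
      using True p ps ker_snoc(1)[of p w y s] ker_snoc(2)[of y w p s] l
      by (auto simp: kmat_on_def n_def)
  qed (simp add: kmat_on_def n_def)
  have "mcomp (RR n) (up_map w) (down_map w) (p @ [s]) (p @ [s]) = (euler n (\<lambda>y. kmat w (dual w) p y * down_map w y (p @ [s])) :: 'k)"
    unfolding n_def
    by (subst mcomp_RR[OF gset_RR gset_RR Hom_matrices[OF down_map_Hom, of w, simplified] Hom_matrices[OF up_map_Hom, of w, simplified]])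
      (simp only: e)
  also have "\<dots> = mcomp (RR n) (E_mat w) (down_map w) p (p @ [s])"
    unfolding n_def
    by (subst mcomp_RR[OF gset_RR gset_RR Hom_matrices[OF down_map_Hom, of w, simplified] E_mat_matrices])
      (simp only: E_mat_eq_kmat)
  also have "\<dots> = down_map w p (p @ [s])" by (simp add: n_def Hom_left[OF down_map_Hom, of w, simplified])
  also have "\<dots> = 1" using p ps kpp ker_snoc(2)[of p w p s] by (auto simp: kmat_on_def n_def)
  finally have "c * kmat (w @ [Bullet]) (dual w @ [Bullet]) (p @ [s]) (p @ [s]) = 1"
    using c by (simp add: mscale_def n_def)
  moreover have "kmat (w @ [Bullet]) (dual w @ [Bullet]) (p @ [s]) (p @ [s]) = (1 :: 'k)"
    using p ps kpp ker_snoc(3)[of p w p Bullet Bullet s s] by (auto simp: kmat_on_def n_def)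
  ultimately show ?thesis using c by (simp add: mscale_def)
qed

section \<open>Matrices that factor through the objects of weights\<close>

text \<open>\<open>b\<close> and \<open>a\<close> are maps out of and into \<open>M_obj w\<close>.
  The outer sets stand for themselves, with the identity as idempotent, so no condition is imposed
  on that side.\<close>

definition factor_triple :: "'x gset \<Rightarrow> 'y gset \<Rightarrow> weight \<times> ('y \<Rightarrow> real list \<Rightarrow> 'k::field) \<times> (real list \<Rightarrow> 'x \<Rightarrow> 'k) \<Rightarrow> bool" where
  "factor_triple X Y = (\<lambda>(w, b, a). b \<in> matrices (RR (length w)) Y \<and> a \<in> matrices X (RR (length w)) \<and>
     mcomp (RR (length w)) b (E_mat w) = b \<and> mcomp (RR (length w)) (E_mat w) a = a)"

definition triple_comp :: "weight \<times> ('y \<Rightarrow> real list \<Rightarrow> 'k::field) \<times> (real list \<Rightarrow> 'x \<Rightarrow> 'k) \<Rightarrow> 'y \<Rightarrow> 'x \<Rightarrow> 'k" where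
  "triple_comp = (\<lambda>(w, b, a). mcomp (RR (length w)) b a)"

definition factors :: "'x gset \<Rightarrow> 'y gset \<Rightarrow> ('y \<Rightarrow> 'x \<Rightarrow> 'k::field) \<Rightarrow> bool" where
  "factors X Y A \<longleftrightarrow> (\<exists>L. (\<forall>t\<in>set L. factor_triple X Y t) \<and> A = sum_list (map triple_comp L))"

lemma factors_zero: "factors X Y 0"
  unfolding factors_def by (intro exI[of _ "[]"]) simp

lemma factors_add: "factors X Y A \<Longrightarrow> factors X Y B \<Longrightarrow> factors X Y (A + B)"
  unfolding factors_def by (elim exE, rule_tac x="L @ La" in exI) auto

lemma factors_sum: "(\<And>i. i \<in> I \<Longrightarrow> factors X Y (F i)) \<Longrightarrow> factors X Y (\<Sum>i\<in>I. F i)"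
  by (induction I rule: infinite_finite_induct) (auto intro: factors_zero factors_add)

lemma triple_comp_matrices:
  "gset X \<Longrightarrow> gset Y \<Longrightarrow> factor_triple X Y t \<Longrightarrow> triple_comp t \<in> matrices X Y"
  by (auto simp: factor_triple_def triple_comp_def intro: mcomp_closed gset_RR split: prod.splits)

lemma mcomp_sum_list:
  assumes X: "gset X" and Y: "gset Y" and Z: "gset Z" and "\<forall>t\<in>set L. F t \<in> matrices X Y"
  shows "sum_list (map F L) \<in> matrices X Y"
    and "C \<in> matrices Y Z \<Longrightarrow> mcomp Y C (sum_list (map F L)) = sum_list (map (\<lambda>t. mcomp Y C (F t)) L)"
    and "D \<in> matrices Z X \<Longrightarrow> mcomp X (sum_list (map F L)) D = sum_list (map (\<lambda>t. mcomp X (F t) D) L)"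
proof -
  have "sum_list (map F L) \<in> matrices X Y \<and>
    (C \<in> matrices Y Z \<longrightarrow> mcomp Y C (sum_list (map F L)) = sum_list (map (\<lambda>t. mcomp Y C (F t)) L)) \<and>
    (D \<in> matrices Z X \<longrightarrow> mcomp X (sum_list (map F L)) D = sum_list (map (\<lambda>t. mcomp X (F t) D) L))"
    using assms(4)
  proof (induction L)
    case Nil then show ?case unfolding list.map sum_list.Nil using matrices_zero mcomp_zero[OF X] mcomp_zero[OF Y] by blast
  next
    case (Cons t L)
    then have t: "F t \<in> matrices X Y" and IH: "sum_list (map F L) \<in> matrices X Y \<and>
      (C \<in> matrices Y Z \<longrightarrow> mcomp Y C (sum_list (map F L)) = sum_list (map (\<lambda>t. mcomp Y C (F t)) L)) \<and>
      (D \<in> matrices Z X \<longrightarrow> mcomp X (sum_list (map F L)) D = sum_list (map (\<lambda>t. mcomp X (F t) D) L))" by auto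
    then have L: "sum_list (map F L) \<in> matrices X Y" by blast
    show ?case
      unfolding list.map sum_list.Cons
    proof (intro conjI impI)
      show "F t + sum_list (map F L) \<in> matrices X Y" by (rule matrices_add[OF t L])
      show "mcomp Y C (F t + sum_list (map F L)) = mcomp Y C (F t) + sum_list (map (\<lambda>t. mcomp Y C (F t)) L)" if C: "C \<in> matrices Y Z"
        unfolding mcomp_add(2)[OF X Y Z t L C C] using IH C by metis
      show "mcomp X (F t + sum_list (map F L)) D = mcomp X (F t) D + sum_list (map (\<lambda>t. mcomp X (F t) D) L)" if D: "D \<in> matrices Z X"
        unfolding mcomp_add(1)[OF Z X Y D D t L] using IH D by metis
    qed
  qed
  then show "sum_list (map F L) \<in> matrices X Y"
    "C \<in> matrices Y Z \<Longrightarrow> mcomp Y C (sum_list (map F L)) = sum_list (map (\<lambda>t. mcomp Y C (F t)) L)"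
    "D \<in> matrices Z X \<Longrightarrow> mcomp X (sum_list (map F L)) D = sum_list (map (\<lambda>t. mcomp X (F t) D) L)" by auto
qed

lemma factors_left:
  fixes C :: "'z \<Rightarrow> 'y \<Rightarrow> 'k::field" and A :: "'y \<Rightarrow> 'x \<Rightarrow> 'k"
  assumes X: "gset X" and Y: "gset Y" and Z: "gset Z" and C: "C \<in> matrices Y Z" and A: "factors X Y A"
  shows "factors X Z (mcomp Y C A)"
proof -
  obtain L where L: "\<forall>t\<in>set L. factor_triple X Y t" "A = sum_list (map triple_comp L)" using A by (auto simp: factors_def)
  define h where "h = (\<lambda>(w :: weight, b :: 'y \<Rightarrow> real list \<Rightarrow> 'k, a :: real list \<Rightarrow> 'x \<Rightarrow> 'k). (w, mcomp Y C b, a))"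
  have h: "factor_triple X Z (h t) \<and> triple_comp (h t) = mcomp Y C (triple_comp t)" if t: "factor_triple X Y t" for t
  proof -
    obtain w b a where e: "t = (w, b, a)" by (cases t) auto
    have b: "b \<in> matrices (RR (length w)) Y" "mcomp (RR (length w)) b (E_mat w) = b" and a: "a \<in> matrices X (RR (length w))"
      "mcomp (RR (length w)) (E_mat w) a = a" using t by (auto simp: factor_triple_def e)
    show ?thesis
      using a b mcomp_closed[OF gset_RR Y Z b(1) C] mcomp_assoc[OF gset_RR gset_RR Y Z E_mat_matrices b(1) C]
        mcomp_assoc[OF X gset_RR Y Z a(1) b(1) C]
      by (simp add: factor_triple_def triple_comp_def e h_def)
  qed
  have "mcomp Y C A = sum_list (map (\<lambda>t. mcomp Y C (triple_comp t)) L)"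
    unfolding L(2) using L(1) triple_comp_matrices[OF X Y] by (intro mcomp_sum_list(2)[OF X Y Z _ C]) auto
  also have "\<dots> = sum_list (map triple_comp (map h L))" using L(1) h by (auto intro!: arg_cong[of _ _ sum_list])
  finally show ?thesis unfolding factors_def using L(1) h by (intro exI[of _ "map h L"]) auto
qed

lemma factors_right:
  fixes A :: "'y \<Rightarrow> 'x \<Rightarrow> 'k::field" and C :: "'x \<Rightarrow> 'z \<Rightarrow> 'k"
  assumes X: "gset X" and Y: "gset Y" and Z: "gset Z" and C: "C \<in> matrices Z X" and A: "factors X Y A"
  shows "factors Z Y (mcomp X A C)"
proof -
  obtain L where L: "\<forall>t\<in>set L. factor_triple X Y t" "A = sum_list (map triple_comp L)" using A by (auto simp: factors_def)
  define h where "h = (\<lambda>(w :: weight, b :: 'y \<Rightarrow> real list \<Rightarrow> 'k, a :: real list \<Rightarrow> 'x \<Rightarrow> 'k). (w, b, mcomp X a C))"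
  have h: "factor_triple Z Y (h t) \<and> triple_comp (h t) = mcomp X (triple_comp t) C" if t: "factor_triple X Y t" for t
  proof -
    obtain w b a where e: "t = (w, b, a)" by (cases t) auto
    have b: "b \<in> matrices (RR (length w)) Y" "mcomp (RR (length w)) b (E_mat w) = b" and a: "a \<in> matrices X (RR (length w))"
      "mcomp (RR (length w)) (E_mat w) a = a" using t by (auto simp: factor_triple_def e)
    show ?thesis
      using a b mcomp_closed[OF Z X gset_RR C a(1)] mcomp_assoc[OF Z X gset_RR gset_RR C a(1) E_mat_matrices]
        mcomp_assoc[OF Z X gset_RR Y C a(1) b(1)]
      by (simp add: factor_triple_def triple_comp_def e h_def)
  qed
  have "mcomp X A C = sum_list (map (\<lambda>t. mcomp X (triple_comp t) C) L)"
    unfolding L(2) using L(1) triple_comp_matrices[OF X Y] by (intro mcomp_sum_list(3)[OF X Y Z _ C]) auto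
  also have "\<dots> = sum_list (map triple_comp (map h L))" using L(1) h by (auto intro!: arg_cong[of _ _ sum_list])
  finally show ?thesis unfolding factors_def using L(1) h by (intro exI[of _ "map h L"]) auto
qed

lemma factors_E_mat: "factors (RR (length w)) (RR (length w)) (E_mat w)"
  unfolding factors_def
  by (intro exI[of _ "[(w, E_mat w, E_mat w)]"])
    (simp add: factor_triple_def triple_comp_def E_mat_matrices objectD(3)[OF object_M, of w, simplified])

lemma factors_scale:
  fixes A :: "'y \<Rightarrow> 'x \<Rightarrow> 'k::field"
  assumes X: "gset X" and Y: "gset Y" and f: "factors X Y A" and A: "A \<in> matrices X Y"
  shows "factors X Y (mscale c A)"
proof -
  note I = idmat_matrices[OF Y, where 'b='k]
  have "factors X Y (mcomp Y (mscale c (idmat Y)) A)"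
    by (rule factors_left[OF X Y Y matrices_scale[OF I] f])
  then show ?thesis using mcomp_scale(1)[OF X Y Y A I, of c] mcomp_idmat(1)[OF X Y A] by simp
qed

text \<open>Interpolates between the identity of \<open>RR n\<close>, for empty \<open>u\<close>,
  and \<open>E_mat u\<close>, for \<open>u\<close> of length \<open>n\<close>.\<close>

definition part_mat :: "weight \<Rightarrow> nat \<Rightarrow> real list \<Rightarrow> real list \<Rightarrow> 'k::field" where
  "part_mat u n z x = of_bool (z \<in> incr UNIV n \<and> x \<in> incr UNIV n \<and>
     ker u (dual u) (take (length u) z) (take (length u) x) \<and> drop (length u) z = drop (length u) x)"

text \<open>The words may differ in length, so that \<open>up_map\<close> and
  \<open>down_map\<close> can be extended by equality in the trailing coordinates.\<close>

definition extend_mat :: "weight \<Rightarrow> weight \<Rightarrow> nat \<Rightarrow> nat \<Rightarrow> real list \<Rightarrow> real list \<Rightarrow> 'k::field" where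
  "extend_mat \<beta> \<gamma> m n y x = of_bool (y \<in> incr UNIV m \<and> x \<in> incr UNIV n \<and>
     ker \<beta> \<gamma> (take (length \<beta>) y) (take (length \<gamma>) x) \<and> drop (length \<beta>) y = drop (length \<gamma>) x)"

lemma extend_mat_matrices: "extend_mat \<beta> \<gamma> m n \<in> matrices (RR n) (RR m)"
proof -
  have "extend_mat \<beta> \<gamma> m n (map g y) (map g x) = (extend_mat \<beta> \<gamma> m n y x :: 'a)" if g: "g \<in> autf {}" for g y x
  proof -
    have "inj (map g)" using autf_bij[OF g] by (simp add: bij_is_inj)
    then have "map g us = map g vs \<longleftrightarrow> us = vs" for us vs by (simp add: inj_eq)
    then show ?thesis using g by (simp add: extend_mat_def take_map drop_map ker_map incr_map)
  qed
  then show ?thesis unfolding matrices_RR_iff by (auto simp: extend_mat_def)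
qed

lemma part_mat_Nil: "part_mat [] n = idmat (RR n)"
  by (auto simp: part_mat_def idmat_def pts_RR fun_eq_iff)

lemma part_mat_full: "part_mat w (length w) = E_mat w"
  by (auto simp: part_mat_def E_mat_eq_kmat kmat_on_def fun_eq_iff incr_UNIV)

lemma split_at: "length z = Suc m \<Longrightarrow> i \<le> m \<Longrightarrow> \<exists>zs a v. z = zs @ a # v \<and> length zs = i \<and> length v = m - i"
  by (intro exI[of _ "take i z"] exI[of _ "z ! i"] exI[of _ "drop (Suc i) z"]) (simp add: id_take_nth_drop[symmetric])

text \<open>For the coordinates \<open>a\<close>, \<open>b\<close> that follow the word
  \<open>u\<close>, the indicator of \<open>a = b\<close> is that of \<open>a \<le> b\<close> plus
  that of \<open>b \<le> a\<close> minus 1. The last term is the kernel with two equal letters,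
  which imposes no relation.\<close>

lemma part_mat_step:
  assumes "length u \<le> m"
  shows "part_mat u (Suc m) = part_mat (u @ [Bullet]) (Suc m) + part_mat (u @ [Circ]) (Suc m) +
    mscale (- 1) (extend_mat (u @ [Bullet]) (dual u @ [Bullet]) (Suc m) (Suc m) :: real list \<Rightarrow> real list \<Rightarrow> 'k::field)"
proof (intro ext)
  fix z x
  show "part_mat u (Suc m) z x = (part_mat (u @ [Bullet]) (Suc m) + part_mat (u @ [Circ]) (Suc m) +
    mscale (- 1) (extend_mat (u @ [Bullet]) (dual u @ [Bullet]) (Suc m) (Suc m) :: real list \<Rightarrow> real list \<Rightarrow> 'k)) z x"
  proof (cases "z \<in> incr UNIV (Suc m) \<and> x \<in> incr UNIV (Suc m)")
    case True
    obtain zs a v where z: "z = zs @ a # v" "length zs = length u"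
      using split_at[of z m "length u"] True assms by (auto simp: incr_UNIV)
    obtain xs b v' where x: "x = xs @ b # v'" "length xs = length u"
      using split_at[of x m "length u"] True assms by (auto simp: incr_UNIV)
    have lt: "\<forall>t\<in>set zs. t < a" "\<forall>t\<in>set xs. t < b" using True z x by (auto simp: incr_UNIV sorted_wrt_append)
    have k: "ker (u @ [l]) (dual u @ [g]) (zs @ [a]) (xs @ [b]) \<longleftrightarrow>
      ker u (dual u) zs xs \<and> (\<forall>t\<in>set zs \<union> set xs. t < a \<and> t < b) \<and> (l = g \<or> rel l a b)" for l g a b
      using ker_snoc(3) z(2) x(2) by blast
    show ?thesis
      using True z x lt by (cases a b rule: linorder_cases) (auto simp: part_mat_def extend_mat_def mscale_def k)
  qed (auto simp: part_mat_def extend_mat_def mscale_def)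
qed

text \<open>The trailing coordinates integrate out as a point mass and the leading ones give
  \<open>up_down\<close>. What matters is that the composite passes through \<open>RR m\<close>, one
  coordinate fewer.\<close>

lemma extend_mat_comp:
  assumes u: "length u \<le> m"
  shows "mcomp (RR m) (extend_mat (u @ [Bullet]) (dual u) (Suc m) m) (extend_mat u (dual u @ [Bullet]) m (Suc m)) =
    (extend_mat (u @ [Bullet]) (dual u @ [Bullet]) (Suc m) (Suc m) :: real list \<Rightarrow> real list \<Rightarrow> 'k::field)"
proof (intro ext)
  fix z x
  define T :: "real list \<Rightarrow> real list \<Rightarrow> 'k" where "T = extend_mat (u @ [Bullet]) (dual u) (Suc m) m"
  define T' :: "real list \<Rightarrow> real list \<Rightarrow> 'k" where "T' = extend_mat u (dual u @ [Bullet]) m (Suc m)"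
  have eu: "mcomp (RR m) T T' z x = euler m (\<lambda>y. T z y * T' y x)"
    unfolding T_def T'_def by (rule mcomp_RR[OF gset_RR gset_RR extend_mat_matrices extend_mat_matrices])
  show "mcomp (RR m) (extend_mat (u @ [Bullet]) (dual u) (Suc m) m) (extend_mat u (dual u @ [Bullet]) m (Suc m)) z x =
    (extend_mat (u @ [Bullet]) (dual u @ [Bullet]) (Suc m) (Suc m) z x :: 'k)"
  proof (cases "z \<in> incr UNIV (Suc m) \<and> x \<in> incr UNIV (Suc m)")
    case False
    then have "T z y * T' y x = 0" for y by (auto simp: T_def T'_def extend_mat_def)
    then show ?thesis using eu False unfolding T_def T'_def by (auto simp: extend_mat_def)
  next
    case True
    define i where "i = length u"
    obtain zs a v where z: "z = zs @ a # v" "length zs = i" "length v = m - i"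
      using split_at[of z m i] True u by (auto simp: incr_UNIV i_def)
    obtain xs b v' where x: "x = xs @ b # v'" "length xs = i" "length v' = m - i"
      using split_at[of x m i] True u by (auto simp: incr_UNIV i_def)
    have srt: "sorted_wrt (<) (zs @ [a])" "sorted_wrt (<) (xs @ [b])" "sorted_wrt (<) v" "\<forall>t\<in>set v. a < t"
      using True z x by (auto simp: incr_UNIV sorted_wrt_append)
    have zi: "zs @ [a] \<in> incr UNIV (Suc i)" "xs @ [b] \<in> incr UNIV (Suc i)" using srt z x by (auto simp: incr_UNIV)
    have "euler (m - i) (\<lambda>vs. T z (ys @ vs) * T' (ys @ vs) x) =
      of_bool (v = v') * (up_map u (zs @ [a]) ys * down_map u ys (xs @ [b]))" if ys: "length ys = i" for ys
    proof -
      have eqT: "T z (ys @ vs) * T' (ys @ vs) x = of_bool (vs = v) * (of_bool (v = v' \<and> ys @ vs \<in> incr UNIV m \<and>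
         ker (u @ [Bullet]) (dual u) (zs @ [a]) ys \<and> ker u (dual u @ [Bullet]) ys (xs @ [b])))" for vs
        using True ys z x unfolding T_def T'_def extend_mat_def by (auto simp: i_def)
      have "euler (m - i) (\<lambda>vs. T z (ys @ vs) * T' (ys @ vs) x) = of_bool (v = v' \<and> ys @ v \<in> incr UNIV m \<and>
         ker (u @ [Bullet]) (dual u) (zs @ [a]) ys \<and> ker u (dual u @ [Bullet]) ys (xs @ [b]))"
        unfolding eqT by (rule euler_delta[OF z(3)])
      also have "\<dots> = of_bool (v = v') * (up_map u (zs @ [a]) ys * down_map u ys (xs @ [b]))"
      proof -
        \<comment> \<open>All of \<open>ys\<close> lies below \<open>a\<close> and all of
          \<open>v\<close> above it, so the order condition across the cut is automatic.\<close>
        have "ys @ v \<in> incr UNIV m \<longleftrightarrow> ys \<in> incr UNIV i" if "ker (u @ [Bullet]) (dual u) (zs @ [a]) ys"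
        proof -
          have "\<forall>t\<in>set ys. t < a" using that ker_snoc(1)[of zs u ys a] z(2) ys by (auto simp: i_def)
          then show ?thesis using srt(3,4) ys z(3) u by (force simp: incr_UNIV sorted_wrt_append i_def)
        qed
        then show ?thesis using zi by (auto simp: kmat_on_def i_def)
      qed
      finally show ?thesis .
    qed
    then have "euler i (\<lambda>ys. euler (m - i) (\<lambda>vs. T z (ys @ vs) * T' (ys @ vs) x)) =
      euler i (\<lambda>ys. of_bool (v = v') * (up_map u (zs @ [a]) ys * down_map u ys (xs @ [b])))"
      by (intro euler_cong) blast
    also have "\<dots> = of_bool (v = v') * mcomp (RR i) (up_map u) (down_map u) (zs @ [a]) (xs @ [b])"
      by (cases "v = v'") (simp_all add: i_def mcomp_RR[OF gset_RR gset_RR Hom_matrices[OF down_map_Hom, of u, simplified]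
        Hom_matrices[OF up_map_Hom, of u, simplified]])
    also have "\<dots> = of_bool (v = v') * kmat (u @ [Bullet]) (dual u @ [Bullet]) (zs @ [a]) (xs @ [b])"
      using up_down[of u, where 'k='k] by (simp add: i_def)
    also have "\<dots> = extend_mat (u @ [Bullet]) (dual u @ [Bullet]) (Suc m) (Suc m) z x"
      using True zi z x by (auto simp: extend_mat_def kmat_on_def i_def)
    finally show ?thesis
      using eu euler_append[of i "m - i" "\<lambda>y. T z y * T' y x"] u by (simp add: T_def T'_def i_def)
  qed
qed

text \<open>Inside the strong induction on \<open>n\<close>, the word \<open>u\<close> is shortened
  step by step from full length, where \<open>part_mat\<close> is an \<open>E_mat\<close>, to the
  empty word. The outer hypothesis takes care of the correction term of each step.\<close>

lemma factors_idmat_RR: "factors (RR n) (RR n) (idmat (RR n) :: real list \<Rightarrow> real list \<Rightarrow> 'k::field)"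
proof (induction n rule: less_induct)
  case (less n)
  have "factors (RR n) (RR n) (part_mat u n :: real list \<Rightarrow> real list \<Rightarrow> 'k)" if "length u \<le> n" for u
    using that
  proof (induction "n - length u" arbitrary: u)
    case 0
    then have "n = length u" by simp
    then show ?case using factors_E_mat[of u] by (simp add: part_mat_full)
  next
    case (Suc k)
    then obtain m where n: "n = Suc m" and u: "length u \<le> m" by (cases n) auto
    let ?T = "extend_mat (u @ [Bullet]) (dual u) (Suc m) m :: real list \<Rightarrow> real list \<Rightarrow> 'k"
    let ?T' = "extend_mat u (dual u @ [Bullet]) m (Suc m) :: real list \<Rightarrow> real list \<Rightarrow> 'k"
    have "factors (RR m) (RR m) (idmat (RR m) :: real list \<Rightarrow> real list \<Rightarrow> 'k)" by (rule less.IH) (simp add: n)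
    from factors_left[OF gset_RR gset_RR gset_RR extend_mat_matrices this]
    have "factors (RR m) (RR (Suc m)) (mcomp (RR m) ?T (idmat (RR m)))" .
    then have "factors (RR m) (RR (Suc m)) ?T" using mcomp_idmat(2)[OF gset_RR gset_RR extend_mat_matrices] by metis
    from factors_right[OF gset_RR gset_RR gset_RR extend_mat_matrices this]
    have "factors (RR (Suc m)) (RR (Suc m)) (mcomp (RR m) ?T ?T')" .
    then have "factors (RR (Suc m)) (RR (Suc m)) (mscale (- 1) (extend_mat (u @ [Bullet]) (dual u @ [Bullet]) (Suc m) (Suc m)) :: real list \<Rightarrow> real list \<Rightarrow> 'k)"
      unfolding extend_mat_comp[OF u] by (rule factors_scale[OF gset_RR gset_RR _ extend_mat_matrices])
    moreover have "factors (RR (Suc m)) (RR (Suc m)) (part_mat (u @ [l]) (Suc m) :: real list \<Rightarrow> real list \<Rightarrow> 'k)" for l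
      using Suc.hyps(1)[of "u @ [l]"] Suc.hyps(2) u n by simp
    ultimately show ?case unfolding n part_mat_step[OF u] by (intro factors_add)
  qed
  from this[of "[]"] show ?case by (simp add: part_mat_Nil)
qed

section \<open>The identity of an arbitrary set, orbit by orbit\<close>

lemma sum_fun_apply2: "(\<Sum>i\<in>I. F i) x y = (\<Sum>i\<in>I. F i x y)"
  by (induction I rule: infinite_finite_induct) simp_all

text \<open>\<open>I Q\<close> and \<open>J Q\<close> are the graph of a chart, read in both
  directions; their composite is the identity on one orbit, and it passes through
  \<open>RR (N Q)\<close>.\<close>

lemma factors_idmat:
  assumes X: "gset X"
  shows "factors X X (idmat X :: 'x \<Rightarrow> 'x \<Rightarrow> 'k::field)"
proof -
  obtain N f where ch: "charts X N f" using charts_obtain[OF X] .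
  define I :: "'x set \<Rightarrow> 'x \<Rightarrow> real list \<Rightarrow> 'k" where "I Q x t = of_bool (t \<in> incr UNIV (N Q) \<and> x = f Q t)" for Q x t
  define J :: "'x set \<Rightarrow> real list \<Rightarrow> 'x \<Rightarrow> 'k" where "J Q t x = I Q x t" for Q t x
  have c: "chart X Q (N Q) (f Q)" "Q \<subseteq> pts X" if "Q \<in> aut_orbits X" for Q
    using ch that aut_orbit_subset[OF X that] by (auto simp: charts_def)
  have inv: "I Q (act X g x) (map g t) = I Q x t" if Q: "Q \<in> aut_orbits X" and g: "g \<in> autf {}" and x: "x \<in> pts X" for Q g x t
  proof (cases "t \<in> incr UNIV (N Q)")
    case True
    have "f Q t \<in> pts X" using chart_in[OF c(1)[OF Q] True] c(2)[OF Q] by blast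
    moreover have "f Q (map g t) = act X g (f Q t)" using c(1)[OF Q] g True by (simp add: chart_def)
    ultimately show ?thesis using True x incr_map[OF g] act_eq_iff[OF X g x] by (simp add: I_def)
  qed (simp add: I_def incr_map[OF g])
  have supp: "x \<in> pts X" if "Q \<in> aut_orbits X" "t \<in> incr UNIV (N Q)" "x = f Q t" for Q x t
    using chart_in[OF c(1)[OF that(1)] that(2)] c(2)[OF that(1)] that(3) by blast
  have I: "I Q \<in> matrices (RR (N Q)) X" if Q: "Q \<in> aut_orbits X" for Q
    using inv[OF Q] supp[OF Q] by (auto simp: matrices_def pts_RR act_RR carrier_aut_R) (auto simp: I_def)
  have J: "J Q \<in> matrices X (RR (N Q))" if Q: "Q \<in> aut_orbits X" for Q
    using inv[OF Q] supp[OF Q] by (auto simp: matrices_def pts_RR act_RR carrier_aut_R J_def) (auto simp: I_def)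
  have comp: "mcomp (RR (N Q)) (I Q) (J Q) x x' = of_bool (x = x' \<and> x \<in> Q)" if Q: "Q \<in> aut_orbits X" for Q x x'
  proof -
    have "mcomp (RR (N Q)) (I Q) (J Q) x x' = euler (N Q) (\<lambda>t. I Q x t * J Q t x')"
      by (rule mcomp_RR[OF X X J[OF Q] I[OF Q]])
    also have "\<dots> = of_bool (x = x' \<and> x \<in> Q)"
    proof (cases "x \<in> Q")
      case True
      obtain s where s: "s \<in> incr UNIV (N Q)" "f Q s = x" using chart_surj[OF c(1)[OF Q] True] .
      have "I Q x t * J Q t x' = of_bool (t = s) * of_bool (x = x')" for t
        using s chart_inj[OF c(1)[OF Q]] by (auto simp: I_def J_def inj_on_def)
      then show ?thesis using True euler_delta[of s "N Q" "\<lambda>_. of_bool (x = x')"] s(1) by (simp add: incr_UNIV)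
    next
      case False
      then have "I Q x t = 0" for t using chart_in[OF c(1)[OF Q]] by (auto simp: I_def)
      then show ?thesis using False by simp
    qed
    finally show ?thesis .
  qed
  have "idmat X = (\<Sum>Q\<in>aut_orbits X. mcomp (RR (N Q)) (I Q) (J Q))"
  proof (intro ext)
    fix x x'
    show "idmat X x x' = (\<Sum>Q\<in>aut_orbits X. mcomp (RR (N Q)) (I Q) (J Q)) x x'"
    proof (cases "x \<in> pts X")
      case True
      obtain R where R: "R \<in> aut_orbits X" "x \<in> R" using aut_orbits_cover[OF X True] by blast
      have "(\<Sum>Q\<in>aut_orbits X. mcomp (RR (N Q)) (I Q) (J Q) x x') = (\<Sum>Q\<in>aut_orbits X. if Q = R then of_bool (x = x') else 0)"
      proof (rule sum.cong[OF refl])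
        fix Q assume Q: "Q \<in> aut_orbits X"
        have "x \<in> Q \<longleftrightarrow> Q = R" using aut_orbits_disjoint[OF X Q R(1) _ R(2)] R(2) by blast
        then show "mcomp (RR (N Q)) (I Q) (J Q) x x' = (if Q = R then of_bool (x = x') else 0)"
          unfolding comp[OF Q] by simp
      qed
      also have "\<dots> = of_bool (x = x')" using X R(1) by (simp add: gset_def)
      finally show ?thesis using True by (simp add: sum_fun_apply2 idmat_def)
    next
      case False
      then have "(\<Sum>Q\<in>aut_orbits X. mcomp (RR (N Q)) (I Q) (J Q) x x') = 0"
        using c(2) by (intro sum.neutral) (auto simp: comp)
      then show ?thesis using False by (simp add: sum_fun_apply2 idmat_def)
    qed
  qed
  moreover have "factors X X (mcomp (RR (N Q)) (I Q) (J Q))" if Q: "Q \<in> aut_orbits X" for Q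
  proof -
    have "factors (RR (N Q)) X (mcomp (RR (N Q)) (I Q) (idmat (RR (N Q))))"
      by (rule factors_left[OF gset_RR gset_RR X I[OF Q] factors_idmat_RR])
    then have "factors (RR (N Q)) X (I Q)" using mcomp_idmat(2)[OF gset_RR X I[OF Q]] by simp
    then show ?thesis by (rule factors_right[OF gset_RR X X J[OF Q]])
  qed
  ultimately show ?thesis by (simp add: factors_sum)
qed

section \<open>Indecomposable objects\<close>

text \<open>Endomorphisms are scalars, so the idempotent cutting out a summand is 0 or the
  identity.\<close>

lemma indecomposable_M: "indecomposable TYPE('y) (M_obj w :: (real list, 'k::field) obj)"
  unfolding indecomposable_def
proof (intro conjI allI impI)
  let ?P = "M_obj w :: (real list, 'k) obj"
  show "object ?P" by (rule object_M)
  show "\<not> zero_object ?P" using E_mat_nonzero by (simp add: zero_object_def)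
  fix Q R :: "('y, 'k) obj"
  assume "object Q \<and> object R \<and> is_direct_sum ?P Q R"
  then obtain i1 i2 p1 p2 where Q: "object Q" and R: "object R"
    and i: "i1 \<in> Hom Q ?P" "i2 \<in> Hom R ?P" and p: "p1 \<in> Hom ?P Q" "p2 \<in> Hom ?P R"
    and e: "mcomp (RR (length w)) p1 i1 = idem Q" "mcomp (RR (length w)) p2 i2 = idem R"
      "mcomp (base Q) i1 p1 + mcomp (base R) i2 p2 = E_mat w"
    unfolding is_direct_sum_def by auto
  \<comment> \<open>As \<open>idem S\<close> is idempotent it equals the composite of
    \<open>p\<close>, \<open>i\<close>, \<open>p\<close>, \<open>i\<close>, which contains
    \<open>i\<close> after \<open>p\<close>, that is, 0.\<close>
  have vanish: "zero_object S" if S: "object S" and i: "i \<in> Hom S ?P" and p: "p \<in> Hom ?P S"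
    and e: "mcomp (RR (length w)) p i = idem S" and z: "mcomp (base S) i p = 0" for S :: "('y, 'k) obj" and i p
  proof -
    note gS = objectD(1)[OF S] and mi = Hom_matrices[OF i, simplified] and mp = Hom_matrices[OF p, simplified]
    have "mcomp (RR (length w)) p (mcomp (base S) i (idem S)) = mcomp (base S) (mcomp (RR (length w)) p i) (idem S)"
      by (rule mcomp_assoc[OF gS gS gset_RR gS objectD(2)[OF S] mi mp])
    have "idem S = mcomp (base S) (mcomp (RR (length w)) p i) (mcomp (RR (length w)) p i)"
      using objectD(3)[OF S] e by simp
    also have "\<dots> = mcomp (RR (length w)) p (mcomp (base S) i (mcomp (RR (length w)) p i))"
      by (rule mcomp_assoc[OF gS gS gset_RR gS mcomp_closed[OF gS gset_RR gS mi mp] mi mp, symmetric])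
    also have "mcomp (base S) i (mcomp (RR (length w)) p i) = mcomp (RR (length w)) (mcomp (base S) i p) i"
      by (rule mcomp_assoc[OF gS gset_RR gS gset_RR mi mp mi])
    finally show ?thesis unfolding z mcomp_zero(1)[OF gset_RR] mcomp_zero(2)[OF gset_RR] zero_object_def .
  qed
  define q where "q = mcomp (base Q) i1 p1"
  have q: "q \<in> Hom ?P ?P" unfolding q_def by (rule Hom_comp[OF object_M Q object_M p(1) i(1)])
  obtain c where c: "q = mscale c (E_mat w)" using Hom_M_kmat[OF q] fits_dual[of w] by (auto simp: E_mat_eq_kmat)
  note gQ = objectD(1)[OF Q] and mi = Hom_matrices[OF i(1), simplified] and mp = Hom_matrices[OF p(1), simplified]
  have "mcomp (RR (length w)) q q = mcomp (base Q) (mcomp (RR (length w)) q i1) p1"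
    unfolding q_def by (rule mcomp_assoc[OF gset_RR gQ gset_RR gset_RR mp mi mcomp_closed[OF gset_RR gQ gset_RR mp mi]])
  also have "mcomp (RR (length w)) q i1 = mcomp (base Q) i1 (mcomp (RR (length w)) p1 i1)"
    unfolding q_def by (rule mcomp_assoc[OF gQ gset_RR gQ gset_RR mi mp mi, symmetric])
  also have "\<dots> = i1" using e(1) Hom_right[OF i(1)] by simp
  finally have qq: "mcomp (RR (length w)) q q = q" by (simp add: q_def)
  have "mcomp (RR (length w)) (mscale c (E_mat w)) q = mscale c (mcomp (RR (length w)) (E_mat w) q)"
    by (rule mcomp_scale(1)[OF gset_RR gset_RR gset_RR Hom_matrices[OF q, simplified] E_mat_matrices])
  then have "mcomp (RR (length w)) q q = mscale c q" using Hom_left[OF q, simplified] c by metis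
  then have "mscale (c * c) (E_mat w) = mscale c (E_mat w :: real list \<Rightarrow> real list \<Rightarrow> 'k)" using qq c by (simp add: mscale_def mult.assoc)
  then have "c * c = c" using E_mat_nonzero[of w, where 'k='k] by (auto simp: mscale_def fun_eq_iff)
  then consider "c = 0" | "c = 1" by auto
  then show "zero_object Q \<or> zero_object R"
  proof cases
    case 1
    then have "mcomp (base Q) i1 p1 = 0" using c by (simp add: q_def mscale_def fun_eq_iff)
    then show ?thesis using vanish[OF Q i(1) p(1) e(1)] by blast
  next
    case 2
    then have "mcomp (base Q) i1 p1 = E_mat w" using c by (simp add: q_def mscale_def fun_eq_iff)
    then have "mcomp (base R) i2 p2 = 0" using e(3) by simp
    then show ?thesis using vanish[OF R i(2) p(2) e(2)] by blast
  qed
qed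

text \<open>At most one of the two lengths is non-zero. The number strictly drops along every
  non-zero map between different weights, so no chain of such maps can return to its start.\<close>

definition tail_rank :: "weight \<Rightarrow> int" where
  "tail_rank w = int (length (takeWhile ((=) Circ) (rev w))) - int (length (takeWhile ((=) Bullet) (rev w)))"

lemma tail_rank_snoc: "tail_rank (w @ [Bullet]) < tail_rank w" "tail_rank w < tail_rank (w @ [Circ])"
  by (cases "rev w"; cases "hd (rev w)"; simp add: tail_rank_def)+

lemma fits_tail_rank: "fits \<beta> (dual \<alpha>) \<Longrightarrow> \<alpha> \<noteq> \<beta> \<Longrightarrow> tail_rank \<beta> < tail_rank \<alpha>"
  unfolding fits_dual_iff using tail_rank_snoc by (auto intro: less_trans)

lemma sum_list_zero: "(\<And>t. t \<in> set L \<Longrightarrow> F t = 0) \<Longrightarrow> sum_list (map F L) = (0 :: 'a::comm_monoid_add)"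
  by (induction L) auto

text \<open>The composite \<open>q\<close> of \<open>i\<close> after \<open>p\<close> is idempotent
  and, with \<open>r\<close> as complement, splits \<open>P\<close>. It is not 0, since
  \<open>p\<close> after \<open>i\<close> is the identity of \<open>M_obj w\<close>; hence
  \<open>r\<close> is 0, and \<open>p\<close> and \<open>i\<close> are inverse to each
  other.\<close>

lemma summand_of_indecomposable:
  fixes P :: "('x, 'k::field) obj"
  assumes ind: "indecomposable TYPE('x) P" and i: "i \<in> Hom (M_obj w) P" and p: "p \<in> Hom P (M_obj w)"
    and pi: "mcomp (base P) p i = E_mat w"
  shows "isomorphic P (M_obj w)"
proof -
  define X e where "X = base P" and "e = idem P"
  have P: "object P" using ind by (simp add: indecomposable_def)
  have X: "gset X" and e: "e \<in> matrices X X" "mcomp X e e = e" using objectD[OF P] by (auto simp: X_def e_def)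
  have mi: "i \<in> matrices (RR (length w)) X" "mcomp X e i = i" and mp: "p \<in> matrices X (RR (length w))" "mcomp X p e = p"
    using i p by (auto simp: Hom_def X_def e_def)
  define q where "q = mcomp (RR (length w)) i p"
  have q: "q \<in> matrices X X" unfolding q_def by (rule mcomp_closed[OF X gset_RR X mp(1) mi(1)])
  have eq: "mcomp X e q = q" unfolding q_def using mcomp_assoc[OF X gset_RR X X mp(1) mi(1) e(1)] mi(2) by simp
  have qe: "mcomp X q e = q" unfolding q_def using mcomp_assoc[OF X X gset_RR X e(1) mp(1) mi(1)] mp(2) by simp
  have qi: "mcomp X q i = i"
    unfolding q_def using mcomp_assoc[OF gset_RR X gset_RR X mi(1) mp(1) mi(1)] pi Hom_right[OF i] by (simp add: X_def)
  have qq: "mcomp X q q = q"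
    using mcomp_assoc[OF X gset_RR X X mp(1) mi(1) q] qi by (simp add: q_def)
  define r where "r = e + mscale (- 1) q"
  have r: "r \<in> matrices X X" unfolding r_def by (intro matrices_add matrices_scale e q)
  have left: "mcomp X A r = mcomp X A e + mscale (- 1) (mcomp X A q)" if "A \<in> matrices X X" for A
    unfolding r_def mcomp_add(2)[OF X X X e(1) matrices_scale[OF q] that that] mcomp_scale(2)[OF X X X q that] ..
  have right: "mcomp X r A = mcomp X e A + mscale (- 1) (mcomp X q A)" if "A \<in> matrices X X" for A
    unfolding r_def mcomp_add(1)[OF X X X that that e(1) matrices_scale[OF q]] mcomp_scale(1)[OF X X X that q] ..
  have cancel: "A + mscale (- 1) A = 0" for A :: "'x \<Rightarrow> 'x \<Rightarrow> 'k" by (simp add: mscale_def fun_eq_iff)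
  have er: "mcomp X e r = r" and re: "mcomp X r e = r" and qr: "mcomp X q r = 0" and rq: "mcomp X r q = 0"
    unfolding left[OF e(1)] right[OF e(1)] left[OF q] right[OF q] e(2) eq qe qq cancel
    by (simp_all only: r_def)
  have rr: "mcomp X r r = r" using right[OF r] er qr by (simp add: mscale_def fun_eq_iff)
  define Q R :: "('x, 'k) obj" where "Q = \<lparr>base = X, idem = q\<rparr>" and "R = \<lparr>base = X, idem = r\<rparr>"
  have "object Q" "object R" using X q qq r rr by (auto simp: object_def Q_def R_def)
  moreover have "is_direct_sum P Q R"
  proof -
    have "q \<in> Hom Q P" "q \<in> Hom P Q" "r \<in> Hom R P" "r \<in> Hom P R"
      using q r by (auto simp: Hom_def Q_def R_def X_def[symmetric] e_def[symmetric] qq rr eq qe er re)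
    moreover have "q + r = e" by (simp add: r_def mscale_def fun_eq_iff)
    ultimately show ?thesis
      unfolding is_direct_sum_def
      by (intro bexI[of _ q] bexI[of _ r]) (auto simp: Q_def R_def X_def[symmetric] e_def[symmetric] qq rr qr rq)
  qed
  ultimately have "zero_object Q \<or> zero_object R" using ind unfolding indecomposable_def by blast
  moreover have "q \<noteq> 0"
  proof
    assume "q = 0"
    then have "i = 0" using qi by (simp add: mcomp_zero X)
    then have "E_mat w = (0 :: real list \<Rightarrow> real list \<Rightarrow> 'k)" using pi by (simp add: mcomp_zero X flip: X_def)
    then show False using E_mat_nonzero by blast
  qed
  ultimately have "r = 0" by (simp add: zero_object_def Q_def R_def)
  then have "q = e" by (simp add: r_def mscale_def fun_eq_iff)
  then show ?thesis
    unfolding isomorphic_def using i p pi by (intro bexI[of _ p] bexI[of _ i]) (simp_all add: q_def e_def)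
qed

lemma indecomposable_isomorphic_M:
  fixes P :: "('x, 'k::field) obj"
  assumes ind: "indecomposable TYPE('x) P"
  shows "\<exists>w. isomorphic P (M_obj w)"
proof -
  define X e where "X = base P" and "e = idem P"
  have P: "object P" and nz: "e \<noteq> 0" using ind by (auto simp: indecomposable_def zero_object_def e_def)
  have X: "gset X" and e: "e \<in> matrices X X" "mcomp X e e = e" using objectD[OF P] by (auto simp: X_def e_def)
  obtain L where L: "\<forall>t\<in>set L. factor_triple X X t" "(idmat X :: 'x \<Rightarrow> 'x \<Rightarrow> 'k) = sum_list (map triple_comp L)"
    using factors_idmat[OF X] unfolding factors_def by blast
  define wt :: "weight \<times> ('x \<Rightarrow> real list \<Rightarrow> 'k) \<times> (real list \<Rightarrow> 'x \<Rightarrow> 'k) \<Rightarrow> weight" where "wt = fst"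
  define inj :: "weight \<times> ('x \<Rightarrow> real list \<Rightarrow> 'k) \<times> (real list \<Rightarrow> 'x \<Rightarrow> 'k) \<Rightarrow> 'x \<Rightarrow> real list \<Rightarrow> 'k"
    where "inj t = mcomp X e (fst (snd t))" for t
  define prj :: "weight \<times> ('x \<Rightarrow> real list \<Rightarrow> 'k) \<times> (real list \<Rightarrow> 'x \<Rightarrow> 'k) \<Rightarrow> real list \<Rightarrow> 'x \<Rightarrow> 'k"
    where "prj t = mcomp X (snd (snd t)) e" for t
  have triple: "fst (snd t) \<in> matrices (RR (length (wt t))) X" "snd (snd t) \<in> matrices X (RR (length (wt t)))"
    "mcomp (RR (length (wt t))) (fst (snd t)) (E_mat (wt t)) = fst (snd t)"
    "mcomp (RR (length (wt t))) (E_mat (wt t)) (snd (snd t)) = snd (snd t)"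
    "triple_comp t = mcomp (RR (length (wt t))) (fst (snd t)) (snd (snd t))" if "t \<in> set L" for t
  proof -
    obtain w b a where e: "t = (w, b, a)" by (cases t) auto
    have "factor_triple X X (w, b, a)" using L(1) that e by blast
    then show "fst (snd t) \<in> matrices (RR (length (wt t))) X" "snd (snd t) \<in> matrices X (RR (length (wt t)))"
      "mcomp (RR (length (wt t))) (fst (snd t)) (E_mat (wt t)) = fst (snd t)"
      "mcomp (RR (length (wt t))) (E_mat (wt t)) (snd (snd t)) = snd (snd t)"
      "triple_comp t = mcomp (RR (length (wt t))) (fst (snd t)) (snd (snd t))"
      by (simp_all add: e factor_triple_def triple_comp_def wt_def)
  qed
  have inj: "inj t \<in> Hom (M_obj (wt t)) P" if t: "t \<in> set L" for t
    unfolding Hom_def inj_def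
    using mcomp_closed[OF gset_RR X X triple(1)[OF t] e(1)] mcomp_assoc[OF gset_RR X X X triple(1)[OF t] e(1) e(1)] e(2)
      mcomp_assoc[OF gset_RR gset_RR X X E_mat_matrices triple(1)[OF t] e(1)] triple(3)[OF t]
    by (simp add: X_def[symmetric] e_def[symmetric])
  have prj: "prj t \<in> Hom P (M_obj (wt t))" if t: "t \<in> set L" for t
    unfolding Hom_def prj_def
    using mcomp_closed[OF X X gset_RR e(1) triple(2)[OF t]] mcomp_assoc[OF X X X gset_RR e(1) e(1) triple(2)[OF t]] e(2)
      mcomp_assoc[OF X X gset_RR gset_RR e(1) triple(2)[OF t] E_mat_matrices] triple(4)[OF t]
    by (simp add: X_def[symmetric] e_def[symmetric])
  have mi: "inj t \<in> matrices (RR (length (wt t))) X" and mp: "prj t \<in> matrices X (RR (length (wt t)))" if "t \<in> set L" for t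
    using Hom_matrices[OF inj[OF that]] Hom_matrices[OF prj[OF that]] by (simp_all add: X_def)
  have tm: "\<forall>t\<in>set L. triple_comp t \<in> matrices X X" using L(1) triple_comp_matrices[OF X X] by blast
  have "e = mcomp X (mcomp X e (idmat X)) e" using mcomp_idmat(2)[OF X X e(1)] e(2) by simp
  also have "mcomp X e (idmat X) = sum_list (map (\<lambda>t. mcomp X e (triple_comp t)) L)"
    unfolding L(2) by (rule mcomp_sum_list(2)[OF X X X tm e(1)])
  also have "mcomp X \<dots> e = sum_list (map (\<lambda>t. mcomp X (mcomp X e (triple_comp t)) e) L)"
    using tm by (intro mcomp_sum_list(3)[OF X X X _ e(1)]) (auto intro: mcomp_closed[OF X X X _ e(1)])
  also have "\<dots> = sum_list (map (\<lambda>t. mcomp (RR (length (wt t))) (inj t) (prj t)) L)"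
  proof (intro arg_cong[where f=sum_list] map_cong refl)
    fix t assume t: "t \<in> set L"
    have "mcomp X e (triple_comp t) = mcomp (RR (length (wt t))) (inj t) (snd (snd t))"
      unfolding triple(5)[OF t] inj_def by (rule mcomp_assoc[OF X gset_RR X X triple(2)[OF t] triple(1)[OF t] e(1)])
    then show "mcomp X (mcomp X e (triple_comp t)) e = mcomp (RR (length (wt t))) (inj t) (prj t)"
      unfolding prj_def using mcomp_assoc[OF X X gset_RR X e(1) triple(2)[OF t] mi[OF t]] by simp
  qed
  finally have sum: "e = sum_list (map (\<lambda>t. mcomp (RR (length (wt t))) (inj t) (prj t)) L)" .
  have pim: "mcomp X (prj t) (inj s) \<in> Hom (M_obj (wt s)) (M_obj (wt t))" if "t \<in> set L" "s \<in> set L" for t s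
    using Hom_comp[OF object_M P object_M inj[OF that(2)] prj[OF that(1)]] by (simp add: X_def)
  show ?thesis
  \<comment> \<open>A non-zero composite between equal weights is a non-zero scalar and exhibits a
    summand of \<open>P\<close>. If there is none, every non-zero composite lowers
    \<open>tail_rank\<close>.\<close>
  proof (cases "\<exists>t\<in>set L. \<exists>s\<in>set L. wt t = wt s \<and> mcomp X (prj t) (inj s) \<noteq> 0")
    case True
    then obtain t s where ts: "t \<in> set L" "s \<in> set L" "wt t = wt s" "mcomp X (prj t) (inj s) \<noteq> 0" by blast
    obtain c where c: "mcomp X (prj t) (inj s) = mscale c (E_mat (wt s))"
      using Hom_M_kmat[OF pim[OF ts(1,2)]] ts(3) fits_dual[of "wt s"] by (auto simp: E_mat_eq_kmat)
    then have "c \<noteq> 0" using ts(4) by (auto simp: mscale_def fun_eq_iff)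
    have mpt: "prj t \<in> matrices X (RR (length (wt s)))" using mp[OF ts(1)] ts(3) by simp
    have "mcomp X (prj t) (mscale (1 / c) (inj s)) = mscale (1 / c) (mscale c (E_mat (wt s)))"
      unfolding mcomp_scale(2)[OF gset_RR X gset_RR mi[OF ts(2)] mpt] c ..
    then have "mcomp X (prj t) (mscale (1 / c) (inj s)) = E_mat (wt s)"
      using \<open>c \<noteq> 0\<close> by simp
    moreover have "mscale (1 / c) (inj s) \<in> Hom (M_obj (wt s)) P" by (rule Hom_scale[OF object_M P inj[OF ts(2)]])
    ultimately show ?thesis
      using summand_of_indecomposable[OF ind, of _ "wt s" "prj t"] prj[OF ts(1)] ts(3) by (auto simp: X_def)
  next
    case False
    have "inj s = 0" if "s \<in> set L" for s
    proof (rule ccontr)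
      assume "inj s \<noteq> 0"
      then have "finite {s \<in> set L. inj s \<noteq> 0}" "{s \<in> set L. inj s \<noteq> 0} \<noteq> {}" using that by (simp, blast)
      \<comment> \<open>When \<open>inj k\<close> is expanded by means of the decomposition of
        \<open>e\<close>, a non-zero term would contain some non-zero \<open>inj l\<close> of
        smaller \<open>tail_rank\<close>; minimality excludes this.\<close>
      from ex_is_arg_min_if_finite[OF this, of "\<lambda>t. tail_rank (wt t)"]
      obtain k where k: "k \<in> set L" "inj k \<noteq> 0"
        and least: "\<And>l. l \<in> set L \<Longrightarrow> inj l \<noteq> 0 \<Longrightarrow> \<not> tail_rank (wt l) < tail_rank (wt k)"
        unfolding is_arg_min_def by blast
      have "inj k = mcomp X e (inj k)" using Hom_left[OF inj[OF k(1)]] by (simp add: X_def e_def)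
      also have "\<dots> = sum_list (map (\<lambda>t. mcomp X (mcomp (RR (length (wt t))) (inj t) (prj t)) (inj k)) L)"
        unfolding sum using mi mp
        by (intro mcomp_sum_list(3)[OF X X gset_RR _ mi[OF k(1)]]) (auto intro: mcomp_closed[OF X gset_RR X])
      also have "\<dots> = 0"
      proof (rule sum_list_zero)
        fix l assume l: "l \<in> set L"
        have e1: "mcomp X (mcomp (RR (length (wt l))) (inj l) (prj l)) (inj k) = mcomp (RR (length (wt l))) (inj l) (mcomp X (prj l) (inj k))"
          by (rule mcomp_assoc[OF gset_RR X gset_RR X mi[OF k(1)] mp[OF l] mi[OF l], symmetric])
        show "mcomp X (mcomp (RR (length (wt l))) (inj l) (prj l)) (inj k) = 0"
        proof (cases "mcomp X (prj l) (inj k) = 0")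
          case True then show ?thesis unfolding e1 by (simp add: mcomp_zero gset_RR)
        next
          case nonzero: False
          then have "wt k \<noteq> wt l" using False l k(1) by metis
          moreover have "fits (wt l) (dual (wt k))" using Hom_M_kmat[OF pim[OF l k(1)]] nonzero by (auto split: if_splits)
          ultimately have "tail_rank (wt l) < tail_rank (wt k)" using fits_tail_rank by blast
          then have "inj l = 0" using least l by blast
          then show ?thesis unfolding e1 by (simp add: mcomp_zero gset_RR)
        qed
      qed
      finally show False using k(2) by simp
    qed
    then have "e = 0" unfolding sum by (intro sum_list_zero) (simp add: mcomp_zero gset_RR)
    then show ?thesis using nz by simp
  qed
qed

theorem theorem1:
  shows
    "let M = (M_obj :: weight \<Rightarrow> (real list, 'k::field) obj) in
     (\<forall>w. indecomposable TYPE('y) (M w)) \<and>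
     (\<forall>P :: ('x, 'k) obj. indecomposable TYPE('x) P \<longrightarrow> (\<exists>w. isomorphic P (M w))) \<and>
     (\<exists>d u. \<forall>w.
        line_spanned_by (Hom (M w) (M w)) (ident (M w)) \<and>
        line_spanned_by (Hom (M (w @ [Circ])) (M w)) (d w) \<and>
        line_spanned_by (Hom (M w) (M (w @ [Bullet]))) (u w) \<and>
        line_spanned_by (Hom (M (w @ [Circ])) (M (w @ [Bullet]))) (cmp (M w) (u w) (d w))) \<and>
     (\<forall>a b.
        \<not> (\<exists>w. a = w \<and> b = w \<or>
               a = w @ [Circ] \<and> b = w \<or>
               a = w \<and> b = w @ [Bullet] \<or>
               a = w @ [Circ] \<and> b = w @ [Bullet]) \<longrightarrow>
        Hom (M a) (M b) = {0})"
proof -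
  let ?M = "M_obj :: weight \<Rightarrow> (real list, 'k) obj"
  have four: "line_spanned_by (Hom (?M w) (?M w)) (ident (?M w)) \<and>
        line_spanned_by (Hom (?M (w @ [Circ])) (?M w)) (down_map w) \<and>
        line_spanned_by (Hom (?M w) (?M (w @ [Bullet]))) (up_map w) \<and>
        line_spanned_by (Hom (?M (w @ [Circ])) (?M (w @ [Bullet]))) (cmp (?M w) (up_map w) (down_map w))" for w
  proof (intro conjI)
    show "line_spanned_by (Hom (?M w) (?M w)) (ident (?M w))"
      using kmat_Hom[OF fits_dual, of w] E_mat_nonzero[of w] by (intro Hom_M_line[OF fits_dual]) (simp_all add: E_mat_eq_kmat)
    show "line_spanned_by (Hom (?M (w @ [Circ])) (?M w)) (down_map w)"
      by (rule Hom_M_line[OF _ down_map_Hom kmat_nonzero]) (use fits_dual_iff fits_iff in blast)+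
    show "line_spanned_by (Hom (?M w) (?M (w @ [Bullet]))) (up_map w)"
      by (rule Hom_M_line[OF _ up_map_Hom kmat_nonzero]) (use fits_dual_iff fits_iff in blast)+
    have "mcomp (RR (length w)) (up_map w) (down_map w) \<in> Hom (?M (w @ [Circ])) (?M (w @ [Bullet]))"
      using Hom_comp[OF object_M object_M object_M down_map_Hom up_map_Hom] by simp
    moreover have "mcomp (RR (length w)) (up_map w) (down_map w) \<noteq> (0 :: real list \<Rightarrow> real list \<Rightarrow> 'k)"
      unfolding up_down by (rule kmat_nonzero) (use fits_iff in blast)
    moreover have "fits (w @ [Bullet]) (dual (w @ [Circ]))" unfolding fits_dual_iff by blast
    ultimately show "line_spanned_by (Hom (?M (w @ [Circ])) (?M (w @ [Bullet]))) (cmp (?M w) (up_map w) (down_map w))"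
      unfolding M_obj_simps by (intro Hom_M_line)
  qed
  have none: "Hom (?M a) (?M b) = {0}" if "\<not> fits b (dual a)" for a b
  proof -
    have "0 \<in> Hom (?M a) (?M b)" by (simp add: Hom_def matrices_zero mcomp_zero gset_RR)
    then show ?thesis using Hom_M_kmat[of _ a b] that by auto
  qed
  have "(\<exists>d u. \<forall>w. line_spanned_by (Hom (?M w) (?M w)) (ident (?M w)) \<and>
        line_spanned_by (Hom (?M (w @ [Circ])) (?M w)) (d w) \<and>
        line_spanned_by (Hom (?M w) (?M (w @ [Bullet]))) (u w) \<and>
        line_spanned_by (Hom (?M (w @ [Circ])) (?M (w @ [Bullet]))) (cmp (?M w) (u w) (d w)))"
    by (rule exI[of _ down_map], rule exI[of _ up_map]) (use four in blast)
  then show ?thesis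
    unfolding Let_def
    using indecomposable_M indecomposable_isomorphic_M none[unfolded fits_dual_iff] by blast
qed

end
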